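(* Let $A$ be a finite-dimensional algebra over a field $F$, and suppose that $F$ is a splitting field for $A$. Then the following statements are equivalent. (i) $A$ is Morita equivalent to $F[X]/(X^2)$. (ii) $k(A) = 2$ and $\ell(A) = 1$.
   Context: Algebras are associative and unital. $K(A)$ denotes the commutator subspace of $A$, i.e. the $F$-subspace of $A$ spanned by all $xy - yx$ with $x, y \in A$, and $k(A) := \operatorname{codim} K(A) = \dim_F A/K(A)$. $\ell(A)$ is the number of isomorphism classes of simple right $A$-modules. $F$ is a splitting field for $A$ if $\operatorname{End}_A(S) = F$ for every simple right $A$-module $S$. Morita equivalence of $F$-algebras means $F$-linear equivalence of their module categories. *)

theory Defs
  imports
    "HOL-Algebra.QuotRing"
    "HOL-Algebra.UnivPoly"
    "HOL-Library.Equipollence"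
    "Jordan_Normal_Form.Missing_VectorSpace"
begin

section \<open>Associative unital algebras\<close>

text \<open>
  The locale \<open>algebra\<close> of HOL-Algebra is restricted to commutative algebras.
  The zero algebra is allowed here.
\<close>

locale assoc_algebra = vectorspace F A + A?: ring A for F and A (structure) +
  assumes smult_mult_left:
      "\<lbrakk>c \<in> carrier F; x \<in> carrier A; y \<in> carrier A\<rbrakk> \<Longrightarrow> (c \<odot> x) \<otimes> y = c \<odot> (x \<otimes> y)"
    and smult_mult_right:
      "\<lbrakk>c \<in> carrier F; x \<in> carrier A; y \<in> carrier A\<rbrakk> \<Longrightarrow> x \<otimes> (c \<odot> y) = c \<odot> (x \<otimes> y)"

text \<open>
  \<open>V / W\<close> with its scalar multiplication: the quotient algebra if \<open>W\<close> is an ideal of the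
  algebra \<open>V\<close>, the quotient vector space if \<open>W\<close> is only a subspace. In the latter case
  the fields \<open>mult\<close> and \<open>one\<close> are meaningless.
\<close>

definition quotient_module ::
  "('f, 'v, 'm) module_scheme \<Rightarrow> 'v set \<Rightarrow> ('f, 'v set) module" where
  "quotient_module V W =
    \<lparr>carrier = a_rcosets\<^bsub>V\<^esub> W, mult = rcoset_mult V W, one = W +>\<^bsub>V\<^esub> \<one>\<^bsub>V\<^esub>,
     zero = W, add = set_add V, smult = (\<lambda>c X. \<Union>x\<in>X. W +>\<^bsub>V\<^esub> (c \<odot>\<^bsub>V\<^esub> x))\<rparr>"

definition poly_mod_X2 :: "('f, 'r) ring_scheme \<Rightarrow> ('f, (nat \<Rightarrow> 'f) set) module" where
  "poly_mod_X2 F = quotient_module (UP F) (PIdl\<^bsub>UP F\<^esub> (monom (UP F) \<one>\<^bsub>F\<^esub> 2))"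

definition commutator_space ::
  "('f, 'r) ring_scheme \<Rightarrow> ('f, 'a, 's) module_scheme \<Rightarrow> 'a set" where
  "commutator_space F A =
    module.span F A {x \<otimes>\<^bsub>A\<^esub> y \<ominus>\<^bsub>A\<^esub> y \<otimes>\<^bsub>A\<^esub> x | x y. x \<in> carrier A \<and> y \<in> carrier A}"

definition commutator_codim ::
  "('f, 'r) ring_scheme \<Rightarrow> ('f, 'a, 's) module_scheme \<Rightarrow> nat" where
  "commutator_codim F A = vectorspace.dim F (quotient_module A (commutator_space F A))"


section \<open>Right modules\<close>

text \<open>
  Right modules are carried by the record \<open>module\<close> of HOL-Algebra: \<open>a \<odot> x\<close> stands for the
  right action \<open>x a\<close>, whence the order of the factors in \<open>act_assoc\<close>. The fields \<open>mult\<close>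
  and \<open>one\<close> of the record are ignored (as they are in the locale \<open>module\<close>).
\<close>

locale right_module = A?: ring A + M?: abelian_group M
  for A :: "('a, 'r) ring_scheme" and M :: "('a, 'm, 'n) module_scheme" (structure) +
  assumes act_closed:
      "\<lbrakk>a \<in> carrier A; x \<in> carrier M\<rbrakk> \<Longrightarrow> a \<odot>\<^bsub>M\<^esub> x \<in> carrier M"
    and act_add_left:
      "\<lbrakk>a \<in> carrier A; b \<in> carrier A; x \<in> carrier M\<rbrakk>
        \<Longrightarrow> (a \<oplus>\<^bsub>A\<^esub> b) \<odot>\<^bsub>M\<^esub> x = a \<odot>\<^bsub>M\<^esub> x \<oplus>\<^bsub>M\<^esub> b \<odot>\<^bsub>M\<^esub> x"
    and act_add_right:
      "\<lbrakk>a \<in> carrier A; x \<in> carrier M; y \<in> carrier M\<rbrakk>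
        \<Longrightarrow> a \<odot>\<^bsub>M\<^esub> (x \<oplus>\<^bsub>M\<^esub> y) = a \<odot>\<^bsub>M\<^esub> x \<oplus>\<^bsub>M\<^esub> a \<odot>\<^bsub>M\<^esub> y"
    and act_assoc:
      "\<lbrakk>a \<in> carrier A; b \<in> carrier A; x \<in> carrier M\<rbrakk>
        \<Longrightarrow> (a \<otimes>\<^bsub>A\<^esub> b) \<odot>\<^bsub>M\<^esub> x = b \<odot>\<^bsub>M\<^esub> (a \<odot>\<^bsub>M\<^esub> x)"
    and act_one: "x \<in> carrier M \<Longrightarrow> \<one>\<^bsub>A\<^esub> \<odot>\<^bsub>M\<^esub> x = x"

text \<open>
  Homomorphisms are extensional, so that equality of morphisms is equality in HOL.
\<close>

definition Hom ::
  "('a, 'r) ring_scheme \<Rightarrow> ('a, 'm) module \<Rightarrow> ('a, 'n) module \<Rightarrow> ('m \<Rightarrow> 'n) set" where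
  "Hom A M N = module_hom A M N \<inter> extensional (carrier M)"

definition Iso ::
  "('a, 'r) ring_scheme \<Rightarrow> ('a, 'm) module \<Rightarrow> ('a, 'n) module \<Rightarrow> ('m \<Rightarrow> 'n) set" where
  "Iso A M N = {f \<in> Hom A M N. bij_betw f (carrier M) (carrier N)}"

definition simple_module :: "('a, 'r) ring_scheme \<Rightarrow> ('a, 'm) module \<Rightarrow> bool" where
  "simple_module A S \<longleftrightarrow> right_module A S \<and> carrier S \<noteq> {\<zero>\<^bsub>S\<^esub>} \<and>
    (\<forall>N. Module.submodule N A S \<longrightarrow> N = {\<zero>\<^bsub>S\<^esub>} \<or> N = carrier S)"

text \<open>
  HOL cannot quantify over all types, so \<open>'u\<close> plays the role of the universe of modules: in
  the following definitions a module has a carrier contained in \<open>'u\<close>. If \<open>'u\<close> is infinite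
  and the field \<open>F\<close> embeds into it, then every module of \<open>F\<close>-dimension at most \<open>|'u|\<close>, in
  particular every finite-dimensional and every simple module of a finite-dimensional
  algebra, is isomorphic to one in the universe.
\<close>

definition num_simple_modules :: "'u itself \<Rightarrow> ('a, 'r) ring_scheme \<Rightarrow> nat" where
  "num_simple_modules u A =
    card ({S :: ('a, 'u) module. simple_module A S} //
      {(S, T). simple_module A S \<and> simple_module A T \<and> Iso A S T \<noteq> {}})"

text \<open>
  \<open>F\<close> acts on an \<open>A\<close>-module through \<open>c \<mapsto> c 1\<^sub>A\<close>. The equality \<open>End\<^sub>A(S) = F\<close>
  means that every endomorphism is the action of a unique scalar.
\<close>

definition splitting_field ::
  "'u itself \<Rightarrow> ('f, 'r) ring_scheme \<Rightarrow> ('f, 'a, 's) module_scheme \<Rightarrow> bool" where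
  "splitting_field u F A \<longleftrightarrow>
    (\<forall>S :: ('a, 'u) module. simple_module A S \<longrightarrow>
      bij_betw (\<lambda>c. \<lambda>x\<in>carrier S. (c \<odot>\<^bsub>A\<^esub> \<one>\<^bsub>A\<^esub>) \<odot>\<^bsub>S\<^esub> x) (carrier F) (Hom A S S))"


section \<open>Morita equivalence\<close>

text \<open>
  A functor between categories of right modules is given by its action \<open>T\<close> on objects and
  its action \<open>T1 M N\<close> on the morphisms from \<open>M\<close> to \<open>N\<close>.
\<close>

locale linear_functor =
  fixes F :: "('f, 'r) ring_scheme"
    and A :: "('f, 'a, 's) module_scheme"
    and B :: "('f, 'b, 't) module_scheme"
    and T :: "('a, 'u) module \<Rightarrow> ('b, 'u) module"
    and T1 :: "('a, 'u) module \<Rightarrow> ('a, 'u) module \<Rightarrow> ('u \<Rightarrow> 'u) \<Rightarrow> 'u \<Rightarrow> 'u"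
  assumes obj: "right_module A M \<Longrightarrow> right_module B (T M)"
    and map: "\<lbrakk>right_module A M; right_module A N; f \<in> Hom A M N\<rbrakk>
      \<Longrightarrow> T1 M N f \<in> Hom B (T M) (T N)"
    and map_id: "right_module A M
      \<Longrightarrow> T1 M M (\<lambda>x\<in>carrier M. x) = (\<lambda>x\<in>carrier (T M). x)"
    and map_comp:
      "\<lbrakk>right_module A L; right_module A M; right_module A N; f \<in> Hom A L M; g \<in> Hom A M N\<rbrakk>
      \<Longrightarrow> T1 L N (compose (carrier L) g f) = compose (carrier (T L)) (T1 M N g) (T1 L M f)"
    and map_add:
      "\<lbrakk>right_module A M; right_module A N; f \<in> Hom A M N; g \<in> Hom A M N\<rbrakk>
      \<Longrightarrow> T1 M N (\<lambda>x\<in>carrier M. f x \<oplus>\<^bsub>N\<^esub> g x) =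
        (\<lambda>x\<in>carrier (T M). T1 M N f x \<oplus>\<^bsub>T N\<^esub> T1 M N g x)"
    and map_smult:
      "\<lbrakk>right_module A M; right_module A N; f \<in> Hom A M N; c \<in> carrier F\<rbrakk>
      \<Longrightarrow> T1 M N (\<lambda>x\<in>carrier M. (c \<odot>\<^bsub>A\<^esub> \<one>\<^bsub>A\<^esub>) \<odot>\<^bsub>N\<^esub> f x) =
        (\<lambda>x\<in>carrier (T M). (c \<odot>\<^bsub>B\<^esub> \<one>\<^bsub>B\<^esub>) \<odot>\<^bsub>T N\<^esub> T1 M N f x)"

text \<open>
  \<open>(S, S1)\<close> and \<open>(T, T1)\<close> are functors from right \<open>A\<close>-modules to right \<open>B\<close>-modules.
\<close>

definition naturally_isomorphic ::
  "('a, 'r) ring_scheme \<Rightarrow> ('b, 's) ring_scheme \<Rightarrow>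
   (('a, 'u) module \<Rightarrow> ('b, 'u) module) \<Rightarrow>
   (('a, 'u) module \<Rightarrow> ('a, 'u) module \<Rightarrow> ('u \<Rightarrow> 'u) \<Rightarrow> 'u \<Rightarrow> 'u) \<Rightarrow>
   (('a, 'u) module \<Rightarrow> ('b, 'u) module) \<Rightarrow>
   (('a, 'u) module \<Rightarrow> ('a, 'u) module \<Rightarrow> ('u \<Rightarrow> 'u) \<Rightarrow> 'u \<Rightarrow> 'u) \<Rightarrow> bool" where
  "naturally_isomorphic A B S S1 T T1 \<longleftrightarrow>
    (\<exists>\<eta>. (\<forall>M. right_module A M \<longrightarrow> \<eta> M \<in> Iso B (S M) (T M)) \<and>
      (\<forall>M N f. right_module A M \<and> right_module A N \<and> f \<in> Hom A M N \<longrightarrow>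
        compose (carrier (S M)) (\<eta> N) (S1 M N f) =
        compose (carrier (S M)) (T1 M N f) (\<eta> M)))"

definition morita_equivalent ::
  "'u itself \<Rightarrow> ('f, 'r) ring_scheme \<Rightarrow>
   ('f, 'a, 's) module_scheme \<Rightarrow> ('f, 'b, 't) module_scheme \<Rightarrow> bool" where
  "morita_equivalent u F A B \<longleftrightarrow>
    (\<exists>(S :: ('a, 'u) module \<Rightarrow> ('b, 'u) module) S1
      (T :: ('b, 'u) module \<Rightarrow> ('a, 'u) module) T1.
      linear_functor F A B S S1 \<and> linear_functor F B A T T1 \<and>
      naturally_isomorphic A A
        (\<lambda>M. T (S M)) (\<lambda>M N f. T1 (S M) (S N) (S1 M N f)) (\<lambda>M. M) (\<lambda>M N f. f) \<and>
      naturally_isomorphic B B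
        (\<lambda>M. S (T M)) (\<lambda>M N f. S1 (T M) (T N) (T1 M N f)) (\<lambda>M. M) (\<lambda>M N f. f))"

end

theory Submission
  imports Defs
begin

text \<open>
  Choose an idempotent \<open>e \<noteq> 0\<close> of \<open>A\<close> with \<open>eA\<close> of minimal dimension. By Fitting's lemma
  every element of \<open>eAe\<close> is nilpotent or invertible, and since \<open>F\<close> is a splitting field,
  \<open>eAe = F e + J\<close> with \<open>J\<close> the set of nonunits. If \<open>AeA = A\<close>, then \<open>M \<mapsto> M e\<close> is an
  equivalence from \<open>A\<close>-modules to \<open>eAe\<close>-modules, with \<open>N \<mapsto> Hom\<^bsub>eAe\<^esub>(A e, N)\<close> as its
  inverse, and \<open>k(A) = k(eAe)\<close> by a trace argument.

  If \<open>\<ell>(A) = 1\<close>, then \<open>AeA = A\<close>, because a simple module annihilated by \<open>e\<close> would not be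
  isomorphic to the simple quotient of \<open>eA\<close>. As \<open>K(eAe) \<subseteq> J\<^sup>2\<close>, the equation \<open>k(eAe) = 2\<close> forces
  \<open>J = F x + J\<^sup>2\<close> for some \<open>x\<close>, so \<open>J = x eAe\<close> by Nakayama's lemma. Hence \<open>eAe\<close> is generated by
  \<open>x\<close> and commutative, and being of dimension \<open>2\<close> it is \<open>F[X]/(X\<^sup>2)\<close>.

  Conversely, let \<open>P\<close> be the \<open>A\<close>-module corresponding to the regular module of
  \<open>B = F[X]/(X\<^sup>2)\<close>. It is a generator, so \<open>eA\<close> is a direct summand of \<open>P\<close>; as \<open>End P \<cong> B\<close> has
  no idempotents other than \<open>0\<close> and \<open>1\<close>, \<open>P \<cong> eA\<close>. Therefore \<open>AeA = A\<close>, all simple modules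
  are isomorphic, and \<open>eAe\<close> is two-dimensional, hence commutative, which gives
  \<open>k(A) = k(eAe) = 2\<close>.
\<close>

section \<open>Finite-dimensional spaces embed into the universe\<close>

text \<open>Two constraints shape the proof. Modules live on the type \<open>'u\<close>, so whatever
  is constructed has to be encoded there: a quotient of a right ideal through chosen representatives
  of its cosets, and Hom(Ae, N) through finitely many values, which suffice because 1 is a finite
  sum of elements x e y. Finite powers of the universe embed into it since it is infinite. Moreover,
  finite dimension is exploited by extremal choices of right ideals, measured by
  \<open>rank\<close>, and locality of eAe has the form that every nonunit is nilpotent. Minimality
  of e yields this: if b in eAe is not nilpotent, Fitting's lemma puts a nonzero idempotent u = b^n
  y into eA; then uA = eA, and e in uA exhibits a right inverse of b. The idempotent is chosen
  before anything is known about the simple modules. That it is full is shown afterwards, in both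
  directions from the same object: if AeA is proper, a maximal right ideal above it gives a simple
  module killed by e.\<close>

lemma finite_PiE_lepoll:
  assumes "infinite (UNIV :: 'u set)" "finite X" "S \<lesssim> (UNIV :: 'u set)"
  shows "(X \<rightarrow>\<^sub>E S) \<lesssim> (UNIV :: 'u set)"
  using assms(2)
proof (induction X)
  case empty
  then show ?case by (simp add: assms(1) finite_lepoll_infinite)
next
  case (insert x X)
  have "(insert x X \<rightarrow>\<^sub>E S) = (\<lambda>(y, f). f(x := y)) ` (S \<times> (X \<rightarrow>\<^sub>E S))"
    by (simp add: PiE_insert_eq)
  also have "\<dots> \<lesssim> S \<times> (X \<rightarrow>\<^sub>E S)"
    by (rule image_lepoll)
  also have "\<dots> \<lesssim> (UNIV :: 'u set) \<times> (UNIV :: 'u set)"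
    by (intro times_lepoll_mono assms insert.IH)
  also have "\<dots> \<approx> (UNIV :: 'u set)"
    using card_of_Times_same_infinite[OF assms(1)]
    by (simp add: eqpoll_iff_card_of_ordIso)
  finally show ?case
    by (meson eqpoll_imp_lepoll lepoll_trans)
qed

text \<open>A vector is encoded by its coefficients on a finite generating set, hence by a point of
  a finite power of the field.\<close>

lemma (in vectorspace) fin_dim_lepoll:
  assumes "infinite (UNIV :: 'u set)" "carrier K \<lesssim> (UNIV :: 'u set)" "fin_dim"
  shows "carrier V \<lesssim> (UNIV :: 'u set)"
proof -
  obtain B where B: "finite B" "B \<subseteq> carrier V" "gen_set B"
    using assms(3) unfolding fin_dim_def by blast
  have "carrier V \<subseteq> (\<lambda>a. lincomb a B) ` (B \<rightarrow>\<^sub>E carrier K)"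
  proof
    fix v assume "v \<in> carrier V"
    then obtain a where a: "a \<in> B \<rightarrow> carrier K" "v = lincomb a B"
      using B finite_in_span[of B v] by auto
    then have "v = lincomb (restrict a B) B"
      using B by (auto intro!: lincomb_cong)
    moreover have "restrict a B \<in> B \<rightarrow>\<^sub>E carrier K"
      using a by auto
    ultimately show "v \<in> (\<lambda>a. lincomb a B) ` (B \<rightarrow>\<^sub>E carrier K)"
      by blast
  qed
  then have "carrier V \<lesssim> (B \<rightarrow>\<^sub>E carrier K)"
    by (meson image_lepoll lepoll_trans subset_imp_lepoll)
  then show ?thesis
    using finite_PiE_lepoll[OF assms(1) B(1) assms(2)] lepoll_trans by blast
qed

section \<open>Homomorphisms of right modules\<close>

lemma right_module_act_zero:
  assumes "right_module A M" "a \<in> carrier A"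
  shows "a \<odot>\<^bsub>M\<^esub> \<zero>\<^bsub>M\<^esub> = \<zero>\<^bsub>M\<^esub>"
proof -
  interpret right_module A M by fact
  have "a \<odot>\<^bsub>M\<^esub> \<zero>\<^bsub>M\<^esub> \<oplus>\<^bsub>M\<^esub> a \<odot>\<^bsub>M\<^esub> \<zero>\<^bsub>M\<^esub> = a \<odot>\<^bsub>M\<^esub> \<zero>\<^bsub>M\<^esub>"
    using act_add_right[of a "\<zero>\<^bsub>M\<^esub>" "\<zero>\<^bsub>M\<^esub>"] assms(2) by simp
  then show ?thesis
    using assms(2) act_closed[of a "\<zero>\<^bsub>M\<^esub>"] by (simp add: M.add.r_cancel_one)
qed

lemma right_module_zero_act:
  assumes "right_module A M" "x \<in> carrier M"
  shows "\<zero>\<^bsub>A\<^esub> \<odot>\<^bsub>M\<^esub> x = \<zero>\<^bsub>M\<^esub>"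
proof -
  interpret right_module A M by fact
  have "\<zero>\<^bsub>A\<^esub> \<odot>\<^bsub>M\<^esub> x \<oplus>\<^bsub>M\<^esub> \<zero>\<^bsub>A\<^esub> \<odot>\<^bsub>M\<^esub> x = \<zero>\<^bsub>A\<^esub> \<odot>\<^bsub>M\<^esub> x"
    using act_add_left[of "\<zero>\<^bsub>A\<^esub>" "\<zero>\<^bsub>A\<^esub>" x] assms(2) by simp
  then show ?thesis
    using assms(2) act_closed[of "\<zero>\<^bsub>A\<^esub>" x] by (simp add: M.add.r_cancel_one)
qed

lemma right_module_minus_act:
  assumes "right_module A M" "x \<in> carrier M" "a \<in> carrier A"
  shows "(\<ominus>\<^bsub>A\<^esub> a) \<odot>\<^bsub>M\<^esub> x = \<ominus>\<^bsub>M\<^esub> (a \<odot>\<^bsub>M\<^esub> x)"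
proof -
  interpret right_module A M by fact
  have "(\<ominus>\<^bsub>A\<^esub> a) \<odot>\<^bsub>M\<^esub> x \<oplus>\<^bsub>M\<^esub> a \<odot>\<^bsub>M\<^esub> x = \<zero>\<^bsub>M\<^esub>"
    using act_add_left[of "\<ominus>\<^bsub>A\<^esub> a" a x] right_module_zero_act[OF assms(1,2)] assms
    by (simp add: A.l_neg)
  then show ?thesis
    using assms act_closed by (simp add: M.minus_equality)
qed

lemma HomI:
  assumes "\<And>x. x \<in> carrier M \<Longrightarrow> f x \<in> carrier N"
    and "\<And>x y. x \<in> carrier M \<Longrightarrow> y \<in> carrier M \<Longrightarrow> f (x \<oplus>\<^bsub>M\<^esub> y) = f x \<oplus>\<^bsub>N\<^esub> f y"
    and "\<And>a x. a \<in> carrier A \<Longrightarrow> x \<in> carrier M \<Longrightarrow> f (a \<odot>\<^bsub>M\<^esub> x) = a \<odot>\<^bsub>N\<^esub> f x"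
    and "f \<in> extensional (carrier M)"
  shows "f \<in> Hom A M N"
  using assms by (auto simp: Hom_def LinearCombinations.module_hom_def)

lemma Hom_closed: "f \<in> Hom A M N \<Longrightarrow> x \<in> carrier M \<Longrightarrow> f x \<in> carrier N"
  and Hom_add: "f \<in> Hom A M N \<Longrightarrow> x \<in> carrier M \<Longrightarrow> y \<in> carrier M \<Longrightarrow>
    f (x \<oplus>\<^bsub>M\<^esub> y) = f x \<oplus>\<^bsub>N\<^esub> f y"
  and Hom_act: "f \<in> Hom A M N \<Longrightarrow> a \<in> carrier A \<Longrightarrow> x \<in> carrier M \<Longrightarrow>
    f (a \<odot>\<^bsub>M\<^esub> x) = a \<odot>\<^bsub>N\<^esub> f x"
  and Hom_extensional: "f \<in> Hom A M N \<Longrightarrow> f \<in> extensional (carrier M)"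
  by (auto simp: Hom_def LinearCombinations.module_hom_def)

lemma Hom_zero:
  assumes "right_module A M" "right_module A N" "f \<in> Hom A M N"
  shows "f \<zero>\<^bsub>M\<^esub> = \<zero>\<^bsub>N\<^esub>"
proof -
  interpret M: right_module A M by fact
  interpret N: right_module A N by fact
  have "f \<zero>\<^bsub>M\<^esub> = f (\<zero>\<^bsub>A\<^esub> \<odot>\<^bsub>M\<^esub> \<zero>\<^bsub>M\<^esub>)"
    by (simp add: right_module_zero_act[OF assms(1)])
  also have "\<dots> = \<zero>\<^bsub>N\<^esub>"
    by (simp add: Hom_act[OF assms(3)] right_module_zero_act[OF assms(2)] Hom_closed[OF assms(3)])
  finally show ?thesis .
qed

lemma Hom_eqI:
  assumes "f \<in> Hom A M N" "g \<in> Hom A M N'" "\<And>x. x \<in> carrier M \<Longrightarrow> f x = g x"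
  shows "f = g"
  using assms Hom_extensional by (metis extensionalityI)

lemma Hom_id: "(\<lambda>x\<in>carrier M. x) \<in> Hom A M M" if "right_module A M"
proof -
  interpret right_module A M by fact
  show ?thesis by (rule HomI) (auto intro: act_closed)
qed

lemma Hom_compose:
  assumes "right_module A L" "f \<in> Hom A L M" "g \<in> Hom A M N"
  shows "compose (carrier L) g f \<in> Hom A L N"
proof -
  interpret right_module A L by fact
  show ?thesis
    by (rule HomI)
      (auto simp: compose_def Hom_closed[OF assms(2)] Hom_closed[OF assms(3)] Hom_add[OF assms(2)]
        Hom_add[OF assms(3)] Hom_act[OF assms(2)] Hom_act[OF assms(3)] act_closed)
qed

lemma Iso_inverseE:
  assumes "right_module A M" "right_module A N" "f \<in> Iso A M N"
  obtains g where "g \<in> Hom A N M" "\<And>x. x \<in> carrier M \<Longrightarrow> g (f x) = x"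
    "\<And>y. y \<in> carrier N \<Longrightarrow> f (g y) = y"
proof -
  define g where "g = restrict (inv_into (carrier M) f) (carrier N)"
  interpret M: right_module A M by fact
  interpret N: right_module A N by fact
  have f: "f \<in> Hom A M N" and bij: "bij_betw f (carrier M) (carrier N)"
    using assms by (auto simp: Iso_def)
  have fg: "f (g y) = y" and gc: "g y \<in> carrier M" if "y \<in> carrier N" for y
    using that bij unfolding g_def
    by (auto simp: bij_betw_inv_into_right inv_into_into bij_betw_imp_surj_on)
  have gf: "g (f x) = x" if "x \<in> carrier M" for x
    using that bij Hom_closed[OF f] unfolding g_def by (simp add: bij_betw_inv_into_left)
  have "g \<in> Hom A N M"
  proof (rule HomI)
    fix x y assume xy: "x \<in> carrier N" "y \<in> carrier N"
    have "g (x \<oplus>\<^bsub>N\<^esub> y) = g (f (g x \<oplus>\<^bsub>M\<^esub> g y))"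
      by (simp add: Hom_add[OF f] gc fg xy)
    then show "g (x \<oplus>\<^bsub>N\<^esub> y) = g x \<oplus>\<^bsub>M\<^esub> g y"
      by (simp add: gf gc xy)
  next
    fix a x assume ax: "a \<in> carrier A" "x \<in> carrier N"
    have "g (a \<odot>\<^bsub>N\<^esub> x) = g (f (a \<odot>\<^bsub>M\<^esub> g x))"
      by (simp add: Hom_act[OF f] gc fg ax)
    then show "g (a \<odot>\<^bsub>N\<^esub> x) = a \<odot>\<^bsub>M\<^esub> g x"
      by (simp add: gf gc ax M.act_closed)
  qed (auto simp: gc, auto simp: g_def)
  then show thesis by (rule that) (fact gf, fact fg)
qed

section \<open>Transport of structure\<close>

text \<open>The operations go through arbitrary preimages under \<open>p\<close>. One definition
  thus serves for copies, where \<open>p\<close> is injective, and for quotients, where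
  \<open>p\<close> is constant on the cosets of a submodule.\<close>

definition image_module ::
  "('v \<Rightarrow> 'u) \<Rightarrow> ('a, 'v) module \<Rightarrow> ('a, 'u) module" where
  "image_module p M =
    \<lparr>carrier = p ` carrier M, mult = (\<lambda>u v. u), one = p \<zero>\<^bsub>M\<^esub>, zero = p \<zero>\<^bsub>M\<^esub>,
     add = (\<lambda>u v. p (inv_into (carrier M) p u \<oplus>\<^bsub>M\<^esub> inv_into (carrier M) p v)),
     smult = (\<lambda>a u. p (a \<odot>\<^bsub>M\<^esub> inv_into (carrier M) p u))\<rparr>"

text \<open>The equivalence relation induced by \<open>p\<close> is a congruence. Varying one
  summand is enough, as addition commutes.\<close>

locale module_congruence = right_module A M
  for A :: "('a, 'r) ring_scheme" and M :: "('a, 'v) module" (structure) +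
  fixes p :: "'v \<Rightarrow> 'u"
  assumes cong_add: "\<lbrakk>x \<in> carrier M; y \<in> carrier M; z \<in> carrier M; p x = p y\<rbrakk>
      \<Longrightarrow> p (x \<oplus>\<^bsub>M\<^esub> z) = p (y \<oplus>\<^bsub>M\<^esub> z)"
    and cong_act: "\<lbrakk>x \<in> carrier M; y \<in> carrier M; a \<in> carrier A; p x = p y\<rbrakk>
      \<Longrightarrow> p (a \<odot>\<^bsub>M\<^esub> x) = p (a \<odot>\<^bsub>M\<^esub> y)"
begin

lemma image_add:
  assumes "x \<in> carrier M" "y \<in> carrier M"
  shows "p x \<oplus>\<^bsub>image_module p M\<^esub> p y = p (x \<oplus>\<^bsub>M\<^esub> y)"
proof -
  let ?i = "inv_into (carrier M) p"
  have i: "?i (p z) \<in> carrier M" "p (?i (p z)) = p z" if "z \<in> carrier M" for z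
    using that by (auto intro: inv_into_into f_inv_into_f)
  have "p (?i (p x) \<oplus>\<^bsub>M\<^esub> ?i (p y)) = p (x \<oplus>\<^bsub>M\<^esub> ?i (p y))"
    by (intro cong_add i assms)
  also have "\<dots> = p (x \<oplus>\<^bsub>M\<^esub> y)"
    using cong_add[of "?i (p y)" y x] i assms by (simp add: M.a_comm)
  finally show ?thesis by (simp add: image_module_def)
qed

lemma image_act:
  assumes "x \<in> carrier M" "a \<in> carrier A"
  shows "a \<odot>\<^bsub>image_module p M\<^esub> p x = p (a \<odot>\<^bsub>M\<^esub> x)"
  using assms cong_act[of "inv_into (carrier M) p (p x)" x a]
  by (simp add: image_module_def inv_into_into f_inv_into_f)

lemma image_carrier: "carrier (image_module p M) = p ` carrier M"
  by (simp add: image_module_def)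

lemma image_zero: "\<zero>\<^bsub>image_module p M\<^esub> = p \<zero>\<^bsub>M\<^esub>"
  by (simp add: image_module_def)

lemma right_module_image: "right_module A (image_module p M)"
proof -
  interpret I: abelian_group "image_module p M"
  proof (rule abelian_groupI)
    fix u assume "u \<in> carrier (image_module p M)"
    then obtain x where x: "x \<in> carrier M" "u = p x" by (auto simp: image_carrier)
    then show "\<exists>v\<in>carrier (image_module p M). v \<oplus>\<^bsub>image_module p M\<^esub> u = \<zero>\<^bsub>image_module p M\<^esub>"
      by (intro bexI[of _ "p (\<ominus>\<^bsub>M\<^esub> x)"])
        (auto simp: image_add image_zero image_carrier M.l_neg)
  qed (auto simp: image_carrier image_zero image_add M.a_ac)
  show ?thesis
    by unfold_locales
      (auto simp: image_carrier image_add image_act act_closed act_add_left act_add_right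
        act_assoc act_one)
qed

lemma image_Hom: "restrict p (carrier M) \<in> Hom A M (image_module p M)"
  by (rule HomI) (auto simp: image_carrier image_add image_act act_closed)

end

section \<open>Quotient spaces\<close>

locale quotient_space = M?: module R M for R and M (structure) +
  fixes W
  assumes sub: "submodule R W M"
begin

abbreviation Q where "Q \<equiv> quotient_module M W"
abbreviation proj where "proj x \<equiv> W +>\<^bsub>M\<^esub> x"

lemma W_closed: "x \<in> W \<Longrightarrow> x \<in> carrier M"
  using submodule.subset[OF sub] by blast

lemma W_smult: "c \<in> carrier R \<Longrightarrow> x \<in> W \<Longrightarrow> c \<odot>\<^bsub>M\<^esub> x \<in> W"
  by (rule submodule.smult_closed[OF sub])

lemma W_add: "y \<in> W \<Longrightarrow> x \<in> W \<Longrightarrow> y \<oplus>\<^bsub>M\<^esub> x \<in> W"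
  by (rule submodule.m_closed[OF sub])

lemma W_zero: "\<zero>\<^bsub>M\<^esub> \<in> W"
  by (rule submodule.zero_closed[OF sub])

lemma W_neg: "x \<in> W \<Longrightarrow> \<ominus>\<^bsub>M\<^esub> x \<in> W"
  using W_smult[of "\<ominus>\<^bsub>R\<^esub> \<one>\<^bsub>R\<^esub>" x] W_closed[of x] by (simp add: smult_l_minus)

lemma W_minus: "x \<in> W \<Longrightarrow> y \<in> W \<Longrightarrow> x \<ominus>\<^bsub>M\<^esub> y \<in> W"
  by (simp add: a_minus_def W_add W_neg)

sublocale W: abelian_subgroup W M
proof (rule abelian_subgroupI3)
  show "additive_subgroup W M"
    by (rule additive_subgroupI, rule M.add.subgroupI)
      (use W_closed W_neg W_add W_zero in \<open>auto simp flip: a_inv_def\<close>)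
qed unfold_locales

lemma proj_eq_iff:
  assumes "x \<in> carrier M" "y \<in> carrier M"
  shows "proj x = proj y \<longleftrightarrow> x \<ominus>\<^bsub>M\<^esub> y \<in> W"
proof -
  have "proj x = proj y \<longleftrightarrow> x \<in> proj y"
    using W.a_repr_independence'[of x y] W.a_rcos_self[of x] assms by auto
  then show ?thesis
    using W.a_rcos_module[OF assms(2,1)] by (simp add: a_minus_def)
qed

lemma Q_carrier: "carrier Q = proj ` carrier M"
  by (auto simp: quotient_module_def A_RCOSETS_def')

lemma Q_add: "x \<in> carrier M \<Longrightarrow> y \<in> carrier M \<Longrightarrow> proj x \<oplus>\<^bsub>Q\<^esub> proj y = proj (x \<oplus>\<^bsub>M\<^esub> y)"
  by (simp add: quotient_module_def W.a_rcos_sum)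

lemma Q_zero: "\<zero>\<^bsub>Q\<^esub> = proj \<zero>\<^bsub>M\<^esub>"
  using W.a_rcos_const[OF W_zero] by (simp add: quotient_module_def)

text \<open>The union in \<open>quotient_module\<close> runs over all representatives of a coset. It
  collapses to one coset because representatives differ by elements of \<open>W\<close>, which is
  closed under scalars.\<close>

lemma Q_smult:
  assumes "c \<in> carrier R" "x \<in> carrier M"
  shows "c \<odot>\<^bsub>Q\<^esub> proj x = proj (c \<odot>\<^bsub>M\<^esub> x)"
proof -
  have "proj (c \<odot>\<^bsub>M\<^esub> y) = proj (c \<odot>\<^bsub>M\<^esub> x)" if y: "y \<in> proj x" for y
  proof -
    have yc: "y \<in> carrier M"
      using y W.a_elemrcos_carrier assms(2) by blast
    then have "y \<ominus>\<^bsub>M\<^esub> x \<in> W"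
      using proj_eq_iff[of y x] W.a_repr_independence'[OF y assms(2)] assms(2) by simp
    then have "c \<odot>\<^bsub>M\<^esub> (y \<ominus>\<^bsub>M\<^esub> x) \<in> W"
      by (rule W_smult[OF assms(1)])
    then show ?thesis
      using proj_eq_iff yc assms by (simp add: a_minus_def smult_r_distr smult_r_minus)
  qed
  moreover have "x \<in> proj x"
    using W.a_rcos_self assms(2) by blast
  ultimately have "(\<Union>y\<in>proj x. proj (c \<odot>\<^bsub>M\<^esub> y)) = proj (c \<odot>\<^bsub>M\<^esub> x)"
    by blast
  then show ?thesis by (simp add: quotient_module_def)
qed

lemma Q_module: "module R Q"
proof -
  interpret Q: abelian_group Q
  proof (rule abelian_groupI)
    fix u assume "u \<in> carrier Q"
    then obtain x where x: "x \<in> carrier M" "u = proj x" by (auto simp: Q_carrier)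
    then show "\<exists>v\<in>carrier Q. v \<oplus>\<^bsub>Q\<^esub> u = \<zero>\<^bsub>Q\<^esub>"
      by (intro bexI[of _ "proj (\<ominus>\<^bsub>M\<^esub> x)"]) (auto simp: Q_carrier Q_add Q_zero M.l_neg)
  qed (auto simp: Q_carrier Q_zero Q_add M.a_ac)
  show ?thesis
    by unfold_locales
      (auto simp: Q_carrier Q_add Q_smult smult_l_distr smult_r_distr smult_assoc1)
qed

lemma proj_hom: "proj \<in> LinearCombinations.module_hom R M Q"
  by (auto simp: LinearCombinations.module_hom_def Q_carrier Q_add Q_smult)

end

lemma quotient_spaceI: "vectorspace F V \<Longrightarrow> submodule F W V \<Longrightarrow> quotient_space F V W"
  by (simp add: quotient_space_def quotient_space_axioms_def vectorspace_def)

lemma quotient_vectorspace: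
  assumes "vectorspace F V" "submodule F W V"
  shows "vectorspace F (quotient_module V W)"
  using assms quotient_space.Q_module[OF quotient_spaceI[OF assms]]
  by (simp add: vectorspace_def)

lemma linear_mapI:
  assumes "vectorspace F V" "vectorspace F V'" "T \<in> LinearCombinations.module_hom F V V'"
  shows "linear_map F V V' T"
  using assms by (simp add: linear_map_def mod_hom_def mod_hom_axioms_def vectorspace_def)

lemma quotient_fin_dim:
  assumes V: "vectorspace F V" and W: "submodule F W V" and fd: "vectorspace.fin_dim F V"
  shows "vectorspace.fin_dim F (quotient_module V W)"
proof -
  interpret quotient_space F V W by (rule quotient_spaceI[OF V W])
  interpret linear_map F V Q proj
    by (intro linear_mapI V quotient_vectorspace W proj_hom)
  show ?thesis by (rule surj_fin_dim[OF fd]) (simp add: Q_carrier)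
qed

text \<open>\<open>T\<close> descends to the quotients: \<open>ker\<close> makes the induced map
  well defined and injective, \<open>surj\<close> makes it onto. The instance of interest is the
  inclusion of eAe into A, which becomes bijective only modulo commutators.\<close>

lemma quotient_dim_eq:
  assumes V: "vectorspace F V" and W: "submodule F W V" and fd: "vectorspace.fin_dim F V"
    and V': "vectorspace F V'" and W': "submodule F W' V'"
    and T: "T \<in> LinearCombinations.module_hom F V V'"
    and ker: "\<And>x. x \<in> carrier V \<Longrightarrow> T x \<in> W' \<longleftrightarrow> x \<in> W"
    and surj: "\<And>y. y \<in> carrier V' \<Longrightarrow> \<exists>x\<in>carrier V. T x \<ominus>\<^bsub>V'\<^esub> y \<in> W'"
  shows "vectorspace.dim F (quotient_module V W) = vectorspace.dim F (quotient_module V' W')"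
proof -
  interpret A: quotient_space F V W by (rule quotient_spaceI[OF V W])
  interpret B: quotient_space F V' W' by (rule quotient_spaceI[OF V' W'])
  interpret T: linear_map F V V' T by (rule linear_mapI[OF V V' T])
  have T_eq: "B.proj (T x) = B.proj (T y) \<longleftrightarrow> A.proj x = A.proj y"
    if "x \<in> carrier V" "y \<in> carrier V" for x y
    using that A.proj_eq_iff[of x y] B.proj_eq_iff[of "T x" "T y"] ker[of "x \<ominus>\<^bsub>V\<^esub> y"]
    by (simp add: T.T_minus)
  \<comment> \<open>The choice of the representative is immaterial by \<open>T_eq\<close>.\<close>
  define S where "S X = B.proj (T (SOME x. x \<in> carrier V \<and> A.proj x = X))" for X
  have S: "S (A.proj x) = B.proj (T x)" if "x \<in> carrier V" for x
  proof -
    have "(SOME z. z \<in> carrier V \<and> A.proj z = A.proj x) \<in> carrier V \<and>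
        A.proj (SOME z. z \<in> carrier V \<and> A.proj z = A.proj x) = A.proj x"
      by (rule someI[of "\<lambda>z. z \<in> carrier V \<and> A.proj z = A.proj x" x]) (simp add: that)
    then show ?thesis
      unfolding S_def using T_eq that by blast
  qed
  have "S \<in> LinearCombinations.module_hom F A.Q B.Q"
    by (auto simp: LinearCombinations.module_hom_def A.Q_carrier B.Q_carrier A.Q_add B.Q_add
        A.Q_smult B.Q_smult S)
  then interpret S: linear_map F A.Q B.Q S
    by (intro linear_mapI quotient_vectorspace V W V' W')
  show ?thesis
  proof (rule S.dim_eq)
    show "vectorspace.fin_dim F A.Q"
      by (rule quotient_fin_dim[OF V W fd])
    show "inj_on S (carrier A.Q)"
      by (auto simp: inj_on_def A.Q_carrier S T_eq)
    show "S ` carrier A.Q = carrier B.Q"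
    proof
      show "S ` carrier A.Q \<subseteq> carrier B.Q"
        by (auto simp: A.Q_carrier B.Q_carrier S)
      show "carrier B.Q \<subseteq> S ` carrier A.Q"
      proof
        fix Y assume "Y \<in> carrier B.Q"
        then obtain y where y: "y \<in> carrier V'" "Y = B.proj y"
          by (auto simp: B.Q_carrier)
        then obtain x where x: "x \<in> carrier V" "T x \<ominus>\<^bsub>V'\<^esub> y \<in> W'"
          using surj by blast
        then have "Y = S (A.proj x)"
          using y B.proj_eq_iff[of "T x" y] by (simp add: S)
        then show "Y \<in> S ` carrier A.Q"
          using x by (auto simp: A.Q_carrier)
      qed
    qed
  qed
qed

section \<open>Spaces of dimension two\<close>

lemma (in vectorspace) lincomb_two:
  assumes "u \<in> carrier V" "v \<in> carrier V" "u \<noteq> v" "a \<in> {u, v} \<rightarrow> carrier K"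
  shows "lincomb a {u, v} = a u \<odot>\<^bsub>V\<^esub> u \<oplus>\<^bsub>V\<^esub> a v \<odot>\<^bsub>V\<^esub> v"
proof -
  have "lincomb a {u, v} = a u \<odot>\<^bsub>V\<^esub> u \<oplus>\<^bsub>V\<^esub> lincomb a {v}"
    using lincomb_insert2[of "{v}" a u] assms by auto
  also have "lincomb a {v} = a v \<odot>\<^bsub>V\<^esub> v \<oplus>\<^bsub>V\<^esub> lincomb a {}"
    using lincomb_insert2[of "{}" a v] assms by auto
  finally show ?thesis using assms by simp
qed

lemma (in vectorspace) dim_eq_2I:
  assumes u: "u \<in> carrier V" and v: "v \<in> carrier V"
    and indep: "\<And>a b. a \<in> carrier K \<Longrightarrow> b \<in> carrier K \<Longrightarrow>
      a \<odot>\<^bsub>V\<^esub> u \<oplus>\<^bsub>V\<^esub> b \<odot>\<^bsub>V\<^esub> v = \<zero>\<^bsub>V\<^esub> \<Longrightarrow> a = \<zero>\<^bsub>K\<^esub> \<and> b = \<zero>\<^bsub>K\<^esub>"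
    and gen: "\<And>x. x \<in> carrier V \<Longrightarrow> \<exists>a\<in>carrier K. \<exists>b\<in>carrier K. x = a \<odot>\<^bsub>V\<^esub> u \<oplus>\<^bsub>V\<^esub> b \<odot>\<^bsub>V\<^esub> v"
  shows "dim = 2"
proof -
  have uv: "u \<noteq> v"
  proof
    assume "u = v"
    then have "\<one>\<^bsub>K\<^esub> \<odot>\<^bsub>V\<^esub> u \<oplus>\<^bsub>V\<^esub> (\<ominus>\<^bsub>K\<^esub> \<one>\<^bsub>K\<^esub>) \<odot>\<^bsub>V\<^esub> v = \<zero>\<^bsub>V\<^esub>"
      using u by (simp add: smult_l_minus M.r_neg)
    then show False using indep[of "\<one>\<^bsub>K\<^esub>" "\<ominus>\<^bsub>K\<^esub> \<one>\<^bsub>K\<^esub>"] by simp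
  qed
  have "lin_indpt {u, v}"
  proof (rule finite_lin_indpt2)
    fix a assume a: "a \<in> {u, v} \<rightarrow> carrier K" "lincomb a {u, v} = \<zero>\<^bsub>V\<^esub>"
    then show "\<forall>x\<in>{u, v}. a x = \<zero>\<^bsub>K\<^esub>"
      using lincomb_two[OF u v uv a(1)] indep[of "a u" "a v"] by auto
  qed (use u v in auto)
  moreover have "carrier V \<subseteq> span {u, v}"
  proof
    fix x assume "x \<in> carrier V"
    then obtain a b where ab: "a \<in> carrier K" "b \<in> carrier K" "x = a \<odot>\<^bsub>V\<^esub> u \<oplus>\<^bsub>V\<^esub> b \<odot>\<^bsub>V\<^esub> v"
      using gen by blast
    let ?c = "\<lambda>y. if y = u then a else b"
    have "x = lincomb ?c {u, v}"
      using lincomb_two[OF u v uv, of ?c] ab uv by auto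
    moreover have "?c \<in> {u, v} \<rightarrow> carrier K"
      using ab by auto
    ultimately show "x \<in> span {u, v}"
      unfolding span_def by blast
  qed
  ultimately have "basis {u, v}"
    unfolding basis_def using u v span_closed[of "{u, v}"] by blast
  then have "dim = card {u, v}"
    by (intro dim_basis) auto
  then show ?thesis using uv by simp
qed

text \<open>Any vector outside the line through \<open>u\<close> completes it to a basis. This is
  applied to the class of 1 in A/K(A).\<close>

lemma (in vectorspace) dim_eq_2E:
  assumes fd: "fin_dim" and dim: "dim = 2" and u: "u \<in> carrier V" "u \<noteq> \<zero>\<^bsub>V\<^esub>"
  obtains v where "v \<in> carrier V" "\<And>a. a \<in> carrier K \<Longrightarrow> v \<noteq> a \<odot>\<^bsub>V\<^esub> u"
    and "\<And>x. x \<in> carrier V \<Longrightarrow> \<exists>a\<in>carrier K. \<exists>b\<in>carrier K. x = a \<odot>\<^bsub>V\<^esub> u \<oplus>\<^bsub>V\<^esub> b \<odot>\<^bsub>V\<^esub> v"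
proof -
  have indep_u: "lin_indpt {u}"
    using lin_dep_iff_in_span[of "{}" u] u span_empty finite_lin_indpt2[of "{}"] by auto
  have "\<not> gen_set {u}"
    using gen_ge_dim[of "{u}"] dim u by auto
  then obtain v where v: "v \<in> carrier V" "v \<notin> span {u}"
    using span_closed[of "{u}"] u by blast
  then have vu: "v \<noteq> u"
    using span_self[OF u(1)] by auto
  have "lin_indpt {u, v}"
    using lin_dep_iff_in_span[of "{u}" v] u v indep_u vu by (simp add: insert_commute)
  then have "basis {u, v}"
    by (intro dim_li_is_basis[OF fd]) (use u v vu dim in auto)
  then have gen: "span {u, v} = carrier V"
    by (simp add: basis_def)
  show thesis
  proof (rule that[OF v(1)])
    show "v \<noteq> a \<odot>\<^bsub>V\<^esub> u" if "a \<in> carrier K" for a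
      using submodule.smult_closed[OF span_is_submodule[of "{u}"] that span_self[OF u(1)]] u v(2)
      by auto
    fix x assume "x \<in> carrier V"
    then obtain c where c: "c \<in> {u, v} \<rightarrow> carrier K" "x = lincomb c {u, v}"
      using gen finite_in_span[of "{u, v}" x] u v by auto
    then have "x = c u \<odot>\<^bsub>V\<^esub> u \<oplus>\<^bsub>V\<^esub> c v \<odot>\<^bsub>V\<^esub> v"
      using lincomb_two[of u v c] u v vu by auto
    then show "\<exists>a\<in>carrier K. \<exists>b\<in>carrier K. x = a \<odot>\<^bsub>V\<^esub> u \<oplus>\<^bsub>V\<^esub> b \<odot>\<^bsub>V\<^esub> v"
      using c by blast
  qed
qed

section \<open>A strictly monotone measure on subspaces\<close>

text \<open>For a subspace of a finite-dimensional space this is its dimension. Counting independent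
  vectors inside \<open>W\<close> keeps everything in the ambient space: no subspace has to be
  turned into a vector space of its own.\<close>

definition (in vectorspace) rank :: "'c set \<Rightarrow> nat" where
  "rank W = Max (card ` {S. S \<subseteq> W \<and> lin_indpt S})"

lemma (in vectorspace)
  assumes fd: "fin_dim" and W: "W \<subseteq> carrier V"
  shows rank_ge: "S \<subseteq> W \<Longrightarrow> lin_indpt S \<Longrightarrow> card S \<le> rank W"
    and rank_attained: "\<exists>S\<subseteq>W. lin_indpt S \<and> finite S \<and> card S = rank W"
    and rank_le_dim: "rank W \<le> dim"
proof -
  let ?C = "card ` {S. S \<subseteq> W \<and> lin_indpt S}"
  have sub: "?C \<subseteq> {..dim}"
    using li_le_dim[OF fd] W by auto
  then have fin: "finite ?C"
    using finite_subset by blast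
  show "S \<subseteq> W \<Longrightarrow> lin_indpt S \<Longrightarrow> card S \<le> rank W"
    unfolding rank_def by (intro Max_ge fin) auto
  have "{} \<in> {S. S \<subseteq> W \<and> lin_indpt S}"
    using finite_lin_indpt2[of "{}"] by auto
  then have "card ({} :: 'c set) \<in> ?C"
    by (rule imageI)
  then have "rank W \<in> ?C"
    unfolding rank_def by (intro Max_in fin) auto
  then show "\<exists>S\<subseteq>W. lin_indpt S \<and> finite S \<and> card S = rank W" "rank W \<le> dim"
    using sub li_le_dim(1)[OF fd] W by auto
qed

lemma (in vectorspace) rank_mono:
  assumes "fin_dim" "W \<subseteq> W'" "W' \<subseteq> carrier V"
  shows "rank W \<le> rank W'"
proof -
  have "W \<subseteq> carrier V" using assms by simp
  then obtain S where "S \<subseteq> W" "lin_indpt S" "card S = rank W"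
    using rank_attained[OF assms(1)] by blast
  then show ?thesis
    using rank_ge[OF assms(1,3), of S] assms(2) by simp
qed

text \<open>A largest independent set of the subspace W spans nothing outside W, so it stays
  independent when a vector of W' outside W is added.\<close>

lemma (in vectorspace) rank_strict_mono:
  assumes fd: "fin_dim" and W: "submodule K W V" "W \<subset> W'" "W' \<subseteq> carrier V"
  shows "rank W < rank W'"
proof -
  obtain S where S: "S \<subseteq> W" "lin_indpt S" "finite S" "card S = rank W"
    using rank_attained[OF fd, of W] W by blast
  obtain w where w: "w \<in> W'" "w \<notin> W" using W by blast
  have "span S \<subseteq> W"
    using span_is_subset[OF S(1) W(1)] by simp
  then have "w \<notin> span S" using w by blast
  then have "lin_indpt (insert w S)"
    using lin_dep_iff_in_span[of S w] S W w by auto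
  then have "card (insert w S) \<le> rank W'"
    using rank_ge[OF fd W(3)] S w W by (simp add: subset_iff psubset_eq)
  moreover have "card (insert w S) = Suc (card S)"
    using S(1,3) w(2) by (intro card_insert_disjoint) auto
  ultimately show ?thesis using S by simp
qed

section \<open>Local rings\<close>

text \<open>This is the form of locality that Fitting's lemma delivers. The usual one, that nonunits
  are closed under addition, is derived as \<open>nonunit_add\<close>.\<close>

locale nil_local_ring = ring R for R (structure) +
  assumes nontrivial: "\<one> \<noteq> \<zero>"
    and nonunit_nilpotent: "\<lbrakk>b \<in> carrier R; b \<notin> Units R\<rbrakk> \<Longrightarrow> \<exists>n::nat. b [^] n = \<zero>"

text \<open>Iterating the equation gives v = v j^k for every k.\<close>

lemma (in ring) nilpotent_fixes_zero:
  fixes n :: nat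
  assumes "v \<in> carrier R" "j \<in> carrier R" "v \<otimes> j = v" "j [^] n = \<zero>"
  shows "v = \<zero>"
proof -
  have "v \<otimes> j [^] k = v" for k :: nat
    by (induction k) (use assms in \<open>auto simp flip: m_assoc\<close>)
  then show ?thesis using assms by (metis r_null)
qed

lemma (in ring) last_nonzero_power:
  fixes n :: nat
  assumes "\<one> \<noteq> \<zero>" "x [^] n = \<zero>"
  obtains m :: nat where "x [^] m \<noteq> \<zero>" "x [^] Suc m = \<zero>"
proof -
  have "x [^] (0::nat) \<noteq> \<zero>" using assms(1) by simp
  then show thesis
    using exists_least_lemma[of "\<lambda>n::nat. x [^] n = \<zero>"] assms(2) that by blast
qed

text \<open>Let x^m be the last nonzero power. From x z = 1 follows x^m = x^m (x z) = x^(m+1) z = 0,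
  and symmetrically on the other side.\<close>

lemma (in ring) nilpotent_no_right_inverse:
  fixes n :: nat
  assumes "\<one> \<noteq> \<zero>" "x \<in> carrier R" "z \<in> carrier R" "x [^] n = \<zero>"
  shows "x \<otimes> z \<noteq> \<one>" "z \<otimes> x \<noteq> \<one>"
proof -
  obtain m :: nat where m: "x [^] m \<noteq> \<zero>" "x [^] Suc m = \<zero>"
    using last_nonzero_power[OF assms(1,4)] by blast
  show "x \<otimes> z \<noteq> \<one>"
  proof
    assume "x \<otimes> z = \<one>"
    then have "x [^] m = x [^] m \<otimes> (x \<otimes> z)" using assms by simp
    also have "\<dots> = x [^] Suc m \<otimes> z" using assms by (simp add: m_assoc)
    finally show False using m assms by simp
  qed
  show "z \<otimes> x \<noteq> \<one>"
  proof
    assume "z \<otimes> x = \<one>"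
    then have "x [^] m = (z \<otimes> x) \<otimes> x [^] m" using assms by simp
    also have "\<dots> = z \<otimes> x [^] Suc m" using assms nat_pow_Suc2[of x m] by (simp add: m_assoc)
    finally show False using m assms by simp
  qed
qed

text \<open>One-sided inverses suffice: if b z = 1, then z has the left inverse b, so it is not
  nilpotent and has a right inverse y in turn. Then b = y, and z is a two-sided inverse of
  b.\<close>

lemma (in ring) nil_local_ringI:
  assumes "\<one> \<noteq> \<zero>"
    and "\<And>b. b \<in> carrier R \<Longrightarrow> (\<exists>n::nat. b [^] n = \<zero>) \<or> (\<exists>z\<in>carrier R. b \<otimes> z = \<one>)"
  shows "nil_local_ring R"
proof unfold_locales
  fix b assume b: "b \<in> carrier R" "b \<notin> Units R"
  show "\<exists>n::nat. b [^] n = \<zero>"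
  proof (rule ccontr)
    assume "\<not> ?thesis"
    then obtain z where z: "z \<in> carrier R" "b \<otimes> z = \<one>" using assms(2) b by blast
    then have "\<not> (\<exists>n::nat. z [^] n = \<zero>)"
      using nilpotent_no_right_inverse(2)[OF assms(1) z(1) b(1)] by blast
    then obtain y where y: "y \<in> carrier R" "z \<otimes> y = \<one>" using assms(2) z by blast
    have "b = b \<otimes> (z \<otimes> y)" using y b by simp
    also have "\<dots> = (b \<otimes> z) \<otimes> y" by (rule m_assoc[OF b(1) z(1) y(1), symmetric])
    also have "\<dots> = y" using z y by simp
    finally show False using b z y by (auto simp: Units_def)
  qed
qed (rule assms(1))

context nil_local_ring
begin

lemma nonunit_mult:
  assumes "x \<in> carrier R" "y \<in> carrier R" "x \<notin> Units R"
  shows "x \<otimes> y \<notin> Units R" "y \<otimes> x \<notin> Units R"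
proof -
  obtain n :: nat where n: "x [^] n = \<zero>" using nonunit_nilpotent assms by blast
  show "x \<otimes> y \<notin> Units R"
  proof
    assume u: "x \<otimes> y \<in> Units R"
    then have "x \<otimes> (y \<otimes> inv (x \<otimes> y)) = \<one>" using assms by (simp flip: m_assoc)
    then show False
      using nilpotent_no_right_inverse(1)[OF nontrivial assms(1) _ n] u assms by simp
  qed
  show "y \<otimes> x \<notin> Units R"
  proof
    assume u: "y \<otimes> x \<in> Units R"
    then have "(inv (y \<otimes> x) \<otimes> y) \<otimes> x = \<one>" using assms by (simp add: m_assoc)
    then show False
      using nilpotent_no_right_inverse(2)[OF nontrivial assms(1) _ n] u assms by simp
  qed
qed

text \<open>Otherwise 1 - x is nilpotent as well. If x^m is the last nonzero power of x, then x^m (1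
  - x) = x^m, against \<open>nilpotent_fixes_zero\<close>.\<close>

lemma unit_one_minus:
  assumes "x \<in> carrier R" "x \<notin> Units R"
  shows "\<one> \<ominus> x \<in> Units R"
proof (rule ccontr)
  assume "\<one> \<ominus> x \<notin> Units R"
  then obtain k :: nat where k: "(\<one> \<ominus> x) [^] k = \<zero>" using nonunit_nilpotent assms by blast
  obtain n :: nat where "x [^] n = \<zero>" using nonunit_nilpotent assms by blast
  then obtain m :: nat where m: "x [^] m \<noteq> \<zero>" "x [^] Suc m = \<zero>"
    using last_nonzero_power[OF nontrivial] by blast
  have "x [^] m \<otimes> (\<one> \<ominus> x) = x [^] m"
    using assms m by (simp add: a_minus_def r_distr r_minus)
  then show False
    using nilpotent_fixes_zero[of "x [^] m" "\<one> \<ominus> x" k] k m assms by simp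
qed

text \<open>If the sum is a unit, rescale it to 1. The summands are then some nonunit x' and 1 - x',
  and the latter is a unit by \<open>unit_one_minus\<close>.\<close>

lemma nonunit_add:
  assumes "x \<in> carrier R" "y \<in> carrier R" "x \<notin> Units R" "y \<notin> Units R"
  shows "x \<oplus> y \<notin> Units R"
proof
  assume u: "x \<oplus> y \<in> Units R"
  let ?i = "inv (x \<oplus> y)"
  have i: "?i \<in> carrier R" using u by simp
  have "?i \<otimes> x \<oplus> ?i \<otimes> y = \<one>" using u i assms by (simp flip: r_distr)
  then have "\<one> \<ominus> ?i \<otimes> x = ?i \<otimes> y"
    using i assms by (metis a_minus_def add.inv_solve_right' a_comm m_closed one_closed)
  then show False
    using unit_one_minus[of "?i \<otimes> x"] nonunit_mult i assms by simp
qed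

lemma zero_nonunit: "\<zero> \<notin> Units R"
  using nontrivial by (auto simp: Units_def)

end

section \<open>Corner algebras\<close>

text \<open>Only the carrier and the unit of the record change, so sums, products and scalar
  multiples in eAe are literally those of A.\<close>

definition corner :: "('f, 'a, 's) module_scheme \<Rightarrow> 'a \<Rightarrow> ('f, 'a, 's) module_scheme" where
  "corner A e = A\<lparr>carrier := (\<lambda>x. e \<otimes>\<^bsub>A\<^esub> x \<otimes>\<^bsub>A\<^esub> e) ` carrier A, one := e\<rparr>"

lemma corner_simps [simp]:
  "mult (corner A e) = mult A" "add (corner A e) = add A" "zero (corner A e) = zero A"
  "one (corner A e) = e" "smult (corner A e) = smult A"
  by (simp_all add: corner_def)

context assoc_algebra
begin

lemma smult_one_mult:
  assumes "c \<in> carrier F" "x \<in> carrier A"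
  shows "(c \<odot> \<one>) \<otimes> x = c \<odot> x" "x \<otimes> (c \<odot> \<one>) = c \<odot> x"
  using assms smult_mult_left[of c \<one> x] smult_mult_right[of c x \<one>] by simp_all

end

locale idempotent_algebra = assoc_algebra F A for F and A (structure) +
  fixes e
  assumes e_closed [simp]: "e \<in> carrier A" and e_idem [simp]: "e \<otimes> e = e"
begin

abbreviation C where "C \<equiv> corner A e"

lemma C_iff: "x \<in> carrier C \<longleftrightarrow> x \<in> carrier A \<and> e \<otimes> x = x \<and> x \<otimes> e = x"
proof
  assume "x \<in> carrier C"
  then obtain y where y: "y \<in> carrier A" "x = e \<otimes> y \<otimes> e"
    by (auto simp: corner_def)
  have "e \<otimes> x = (e \<otimes> e) \<otimes> y \<otimes> e" "x \<otimes> e = e \<otimes> y \<otimes> (e \<otimes> e)"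
    using y by (simp_all only: m_assoc e_closed m_closed)
  then show "x \<in> carrier A \<and> e \<otimes> x = x \<and> x \<otimes> e = x"
    using y by simp
qed (force simp: corner_def)

lemma C_closed: "x \<in> carrier C \<Longrightarrow> x \<in> carrier A"
  and C_left: "x \<in> carrier C \<Longrightarrow> e \<otimes> x = x"
  and C_right: "x \<in> carrier C \<Longrightarrow> x \<otimes> e = x"
  by (simp_all add: C_iff)

lemma e_left [simp]: "x \<in> carrier A \<Longrightarrow> e \<otimes> (e \<otimes> x) = e \<otimes> x"
  by (simp flip: m_assoc)

lemma C_I: "x \<in> carrier A \<Longrightarrow> e \<otimes> (x \<otimes> e) \<in> carrier C"
  by (simp add: C_iff m_assoc)

lemma C_algebra: "assoc_algebra F C"
proof -
  have assoc: "e \<otimes> (x \<otimes> y) = x \<otimes> y"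
    if "x \<in> carrier A" "y \<in> carrier A" "e \<otimes> x = x" for x y
    using that m_assoc[of e x y] by simp
  interpret C: ring C
  proof (rule ringI)
    show "abelian_group C"
    proof (rule abelian_groupI)
      fix x assume x: "x \<in> carrier C"
      then show "\<exists>y\<in>carrier C. y \<oplus>\<^bsub>C\<^esub> x = \<zero>\<^bsub>C\<^esub>"
        by (intro bexI[of _ "\<ominus> x"]) (auto simp: C_iff l_neg l_minus r_minus)
    qed (auto simp: C_iff r_distr l_distr a_ac)
    show "monoid C"
      by (rule monoidI) (auto simp: C_iff m_assoc assoc)
  qed (auto simp: C_iff r_distr l_distr)
  have "module F C"
    by (rule moduleI)
      (auto simp: C_iff smult_mult_left smult_mult_right smult_l_distr smult_r_distr smult_assoc1
        intro: R.is_cring C.abelian_group_axioms)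
  then show ?thesis
    by (intro assoc_algebra.intro)
      (auto simp: vectorspace_def assoc_algebra_axioms_def C_iff smult_mult_left smult_mult_right
        intro: C.ring_axioms field_axioms)
qed

sublocale C: assoc_algebra F C by (rule C_algebra)

text \<open>Negation is not a field of the record but depends on the carrier, so the two versions
  are compared by uniqueness of negatives.\<close>

lemma C_inv: "x \<in> carrier C \<Longrightarrow> \<ominus>\<^bsub>C\<^esub> x = \<ominus> x"
  by (rule C.minus_equality) (auto simp: C_iff l_neg l_minus r_minus)

lemma C_minus: "x \<in> carrier C \<Longrightarrow> y \<in> carrier C \<Longrightarrow> x \<ominus>\<^bsub>C\<^esub> y = x \<ominus> y"
  by (simp add: a_minus_def C_inv)

text \<open>The factor \<open>e\<close> matters for n = 0 only, where the power in eAe is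
  \<open>e\<close> and the power in A is 1.\<close>

lemma C_pow: "b \<in> carrier C \<Longrightarrow> b [^]\<^bsub>C\<^esub> (n::nat) = e \<otimes> b [^] n"
  by (induction n) (auto simp: C_closed m_assoc)

lemma C_fin_dim:
  assumes "fin_dim"
  shows "C.fin_dim"
proof -
  interpret T: linear_map F A C "\<lambda>x. e \<otimes> x \<otimes> e"
    by (intro linear_mapI vectorspace_axioms C.vectorspace_axioms)
      (auto simp: LinearCombinations.module_hom_def C_iff m_assoc r_distr l_distr
        smult_mult_left smult_mult_right)
  show ?thesis
    by (rule T.surj_fin_dim[OF assms]) (simp add: corner_def)
qed

end

section \<open>Primitive idempotents\<close>

text \<open>Negatives and scalar multiples come for free, as products with -1 and with c 1.\<close>

definition right_ideal :: "('a, 'm) ring_scheme \<Rightarrow> 'a set \<Rightarrow> bool" where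
  "right_ideal A I \<longleftrightarrow> I \<subseteq> carrier A \<and> \<zero>\<^bsub>A\<^esub> \<in> I \<and> (\<forall>x\<in>I. \<forall>y\<in>I. x \<oplus>\<^bsub>A\<^esub> y \<in> I) \<and>
    (\<forall>x\<in>I. \<forall>a\<in>carrier A. x \<otimes>\<^bsub>A\<^esub> a \<in> I)"

lemma right_idealI:
  assumes "I \<subseteq> carrier A" "\<zero>\<^bsub>A\<^esub> \<in> I" "\<And>x y. x \<in> I \<Longrightarrow> y \<in> I \<Longrightarrow> x \<oplus>\<^bsub>A\<^esub> y \<in> I"
    "\<And>x a. x \<in> I \<Longrightarrow> a \<in> carrier A \<Longrightarrow> x \<otimes>\<^bsub>A\<^esub> a \<in> I"
  shows "right_ideal A I"
  using assms by (auto simp: right_ideal_def)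

lemma right_ideal_add:
  "right_ideal A I \<Longrightarrow> x \<in> I \<Longrightarrow> y \<in> I \<Longrightarrow> x \<oplus>\<^bsub>A\<^esub> y \<in> I"
  by (simp add: right_ideal_def)

lemma right_ideal_mult:
  "right_ideal A I \<Longrightarrow> x \<in> I \<Longrightarrow> a \<in> carrier A \<Longrightarrow> x \<otimes>\<^bsub>A\<^esub> a \<in> I"
  by (simp add: right_ideal_def)

context assoc_algebra
begin

lemma right_ideal_submodule:
  assumes "right_ideal A I"
  shows "submodule F I A"
proof
  fix c v assume "c \<in> carrier F" "v \<in> I"
  then have "v \<otimes> (c \<odot> \<one>) \<in> I" "v \<in> carrier A"
    using assms by (auto simp: right_ideal_def)
  then show "c \<odot> v \<in> I"
    using \<open>c \<in> carrier F\<close> by (simp add: smult_one_mult)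
qed (use assms in \<open>auto simp: right_ideal_def\<close>)

lemma right_ideal_minus:
  assumes "right_ideal A I" "x \<in> I" "y \<in> I"
  shows "x \<ominus> y \<in> I"
proof -
  have "y \<otimes> (\<ominus> \<one>) \<in> I" "y \<in> carrier A" using assms by (auto simp: right_ideal_def)
  then have "\<ominus> y \<in> I" by (simp add: r_minus)
  then show ?thesis using assms by (auto simp: right_ideal_def a_minus_def)
qed

lemma right_ideal_image:
  assumes "c \<in> carrier A"
  shows "right_ideal A ((\<lambda>x. c \<otimes> x) ` carrier A)"
proof (rule right_idealI)
  fix x y assume "x \<in> (\<lambda>x. c \<otimes> x) ` carrier A" "y \<in> (\<lambda>x. c \<otimes> x) ` carrier A"
  then obtain x' y' where "x' \<in> carrier A" "y' \<in> carrier A" "x = c \<otimes> x'" "y = c \<otimes> y'"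
    by auto
  then show "x \<oplus> y \<in> (\<lambda>x. c \<otimes> x) ` carrier A"
    using assms by (auto intro!: image_eqI[of _ _ "x' \<oplus> y'"] simp: r_distr)
next
  fix x a assume "x \<in> (\<lambda>x. c \<otimes> x) ` carrier A" "a \<in> carrier A"
  then obtain x' where "x' \<in> carrier A" "x = c \<otimes> x'" by auto
  then show "x \<otimes> a \<in> (\<lambda>x. c \<otimes> x) ` carrier A"
    using assms \<open>a \<in> carrier A\<close> by (auto intro!: image_eqI[of _ _ "x' \<otimes> a"] simp: m_assoc)
next
  show "\<zero> \<in> (\<lambda>x. c \<otimes> x) ` carrier A"
    using assms by (auto intro!: image_eqI[of _ _ \<zero>])
qed (use assms in auto)

lemma right_ideal_annihilator:
  assumes "c \<in> carrier A"
  shows "right_ideal A {x \<in> carrier A. c \<otimes> x = \<zero>}"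
  using assms by (intro right_idealI) (auto simp: r_distr simp flip: m_assoc)

text \<open>
  Fitting's lemma for left multiplication by \<open>b\<close>: the exponent minimizes the sum of the
  dimension of the image and the codimension of the kernel.
\<close>

lemma stable_power:
  assumes fd: "fin_dim" and b: "b \<in> carrier A"
  obtains n :: nat where "n > 0"
    and "\<And>x. x \<in> carrier A \<Longrightarrow> \<exists>y\<in>carrier A. b [^] n \<otimes> x = b [^] n \<otimes> (b [^] n \<otimes> y)"
    and "\<And>x. x \<in> carrier A \<Longrightarrow> b [^] n \<otimes> (b [^] n \<otimes> x) = \<zero> \<Longrightarrow> b [^] n \<otimes> x = \<zero>"
proof -
  define im where "im n = (\<lambda>x. b [^] n \<otimes> x) ` carrier A" for n :: nat
  define ann where "ann n = {x \<in> carrier A. b [^] n \<otimes> x = \<zero>}" for n :: nat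
  let ?f = "\<lambda>n. rank (im n) + (dim - rank (ann n))"
  obtain n where n: "n > 0" "\<And>m. m > 0 \<Longrightarrow> ?f n \<le> ?f m"
    using ex_has_least_nat[of "\<lambda>n::nat. n > 0" 1 ?f] by auto
  have bn: "b [^] n \<in> carrier A" using b by simp
  have pow: "b [^] (n + n) = b [^] n \<otimes> b [^] n" using b by (simp add: nat_pow_mult)
  have im: "im (n + n) \<subseteq> im n"
    using bn by (auto simp: im_def pow m_assoc)
  have ann: "ann n \<subseteq> ann (n + n)"
    using bn by (auto simp: ann_def pow m_assoc)
  have right: "right_ideal A (im (n + n))" "right_ideal A (ann n)"
    unfolding im_def ann_def using b by (auto intro!: right_ideal_image right_ideal_annihilator)
  have carr: "im n \<subseteq> carrier A" "ann (n + n) \<subseteq> carrier A" "ann n \<subseteq> carrier A"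
    using bn by (auto simp: im_def ann_def)
  \<comment> \<open>Passing from n to 2n shrinks the image and enlarges the annihilator, so neither
    summand of \<open>?f\<close> can grow. By minimality both stay the same.\<close>
  have le: "?f n \<le> ?f (n + n)" using n by simp
  have r1: "rank (im (n + n)) \<le> rank (im n)" by (rule rank_mono[OF fd im carr(1)])
  have r2: "rank (ann n) \<le> rank (ann (n + n))" by (rule rank_mono[OF fd ann carr(2)])
  \<comment> \<open>This keeps the truncated subtraction in \<open>?f\<close> exact.\<close>
  have r3: "rank (ann (n + n)) \<le> dim" by (rule rank_le_dim[OF fd carr(2)])
  have "im (n + n) = im n"
  proof (rule ccontr)
    assume "im (n + n) \<noteq> im n"
    then have "rank (im (n + n)) < rank (im n)"
      using im by (intro rank_strict_mono[OF fd right_ideal_submodule[OF right(1)] _ carr(1)]) auto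
    then show False using le r2 r3 by linarith
  qed
  moreover have "ann (n + n) = ann n"
  proof (rule ccontr)
    assume "ann (n + n) \<noteq> ann n"
    then have "rank (ann n) < rank (ann (n + n))"
      using ann by (intro rank_strict_mono[OF fd right_ideal_submodule[OF right(2)] _ carr(2)]) auto
    then show False using le r1 r3 by linarith
  qed
  ultimately show thesis
  proof (intro that[OF n(1)])
    fix x assume eq: "im (n + n) = im n" and x: "x \<in> carrier A"
    then have "b [^] n \<otimes> x \<in> im (n + n)" unfolding eq by (auto simp: im_def)
    then show "\<exists>y\<in>carrier A. b [^] n \<otimes> x = b [^] n \<otimes> (b [^] n \<otimes> y)"
      using bn by (auto simp: im_def pow m_assoc)
  next
    fix x assume eq: "ann (n + n) = ann n" and x: "x \<in> carrier A"
      "b [^] n \<otimes> (b [^] n \<otimes> x) = \<zero>"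
    have "x \<in> ann (n + n)" using x bn by (auto simp: ann_def pow m_assoc)
    then show "b [^] n \<otimes> x = \<zero>" unfolding eq by (simp add: ann_def)
  qed
qed

text \<open>Under \<open>im\<close> and \<open>ker\<close>, A is the direct sum of cA and the
  annihilator of c, and c is bijective on cA. With c = c c y, the element c y is the projection onto
  cA along the annihilator.\<close>

lemma idempotent_in_stable_power:
  assumes c: "c \<in> carrier A" "c \<noteq> \<zero>"
    and im: "\<And>x. x \<in> carrier A \<Longrightarrow> \<exists>y\<in>carrier A. c \<otimes> x = c \<otimes> (c \<otimes> y)"
    and ker: "\<And>x. x \<in> carrier A \<Longrightarrow> c \<otimes> (c \<otimes> x) = \<zero> \<Longrightarrow> c \<otimes> x = \<zero>"
  obtains y where "y \<in> carrier A" "c \<otimes> y \<noteq> \<zero>" "(c \<otimes> y) \<otimes> (c \<otimes> y) = c \<otimes> y"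
proof -
  obtain y where y: "y \<in> carrier A" "c \<otimes> \<one> = c \<otimes> (c \<otimes> y)" using im one_closed by blast
  then have cy: "c \<otimes> (c \<otimes> y) = c" using c by simp
  \<comment> \<open>The difference of (c y)(c y) and c y has a left factor c, so by
    \<open>ker\<close> it may be tested after one more multiplication by c, where c c y = c
    applies.\<close>
  have "c \<otimes> (c \<otimes> (y \<otimes> (c \<otimes> y) \<ominus> y)) = c \<otimes> (c \<otimes> y) \<otimes> (c \<otimes> y) \<ominus> c \<otimes> (c \<otimes> y)"
    using c y(1) by (simp add: a_minus_def r_distr r_minus m_assoc)
  also have "\<dots> = \<zero>"
    using c by (simp add: cy a_minus_def r_neg)
  finally have "c \<otimes> (y \<otimes> (c \<otimes> y) \<ominus> y) = \<zero>"
    using ker[of "y \<otimes> (c \<otimes> y) \<ominus> y"] c y by simp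
  then have "c \<otimes> (y \<otimes> (c \<otimes> y)) \<ominus> c \<otimes> y = \<zero>"
    using c y by (simp add: a_minus_def r_distr r_minus)
  then have "(c \<otimes> y) \<otimes> (c \<otimes> y) = c \<otimes> y"
    using c y by (simp add: m_assoc)
  moreover have "c \<otimes> y \<noteq> \<zero>" using cy c by auto
  ultimately show thesis using that y by blast
qed

lemma ex_local_idempotent:
  assumes fd: "fin_dim" and nz: "\<one> \<noteq> \<zero>"
  obtains e where "e \<in> carrier A" "e \<otimes> e = e" "nil_local_ring (corner A e)"
proof -
  let ?P = "\<lambda>e. e \<in> carrier A \<and> e \<otimes> e = e \<and> e \<noteq> \<zero>"
  let ?im = "\<lambda>e. (\<lambda>x. e \<otimes> x) ` carrier A"
  obtain e where e: "?P e" and min: "\<And>u. ?P u \<Longrightarrow> rank (?im e) \<le> rank (?im u)"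
    using ex_has_least_nat[of ?P \<one> "\<lambda>e. rank (?im e)"] nz by auto
  interpret idempotent_algebra F A e
    using e by unfold_locales auto
  have "nil_local_ring C"
  proof (rule C.nil_local_ringI)
    show "\<one>\<^bsub>C\<^esub> \<noteq> \<zero>\<^bsub>C\<^esub>" using e by simp
    fix b assume b: "b \<in> carrier C"
    have bA: "b \<in> carrier A" using b by (rule C_closed)
    obtain n :: nat where n: "n > 0"
      "\<And>x. x \<in> carrier A \<Longrightarrow> \<exists>y\<in>carrier A. b [^] n \<otimes> x = b [^] n \<otimes> (b [^] n \<otimes> y)"
      "\<And>x. x \<in> carrier A \<Longrightarrow> b [^] n \<otimes> (b [^] n \<otimes> x) = \<zero> \<Longrightarrow> b [^] n \<otimes> x = \<zero>"
      by (rule stable_power[OF fd bA]) (rule that)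
    show "(\<exists>n::nat. b [^]\<^bsub>C\<^esub> n = \<zero>\<^bsub>C\<^esub>) \<or> (\<exists>z\<in>carrier C. b \<otimes>\<^bsub>C\<^esub> z = \<one>\<^bsub>C\<^esub>)"
    proof (cases "b [^] n = \<zero>")
      case True
      then show ?thesis using C_pow[OF b, of n] by auto
    next
      case False
      obtain y where y: "y \<in> carrier A" "b [^] n \<otimes> y \<noteq> \<zero>"
        "(b [^] n \<otimes> y) \<otimes> (b [^] n \<otimes> y) = b [^] n \<otimes> y"
        by (rule idempotent_in_stable_power[OF nat_pow_closed[OF bA] False])
          (erule n(2), erule (1) n(3), rule that)
      let ?u = "b [^] n \<otimes> y"
      \<comment> \<open>As n > 0, a factor b splits off on the left of u = b^n y. It gives e u = u,
        and later the right inverse of b.\<close>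
      obtain k where k: "n = Suc k" using n(1) gr0_conv_Suc by auto
      have bn: "b [^] n = b \<otimes> b [^] k" by (simp only: k nat_pow_Suc2[OF bA])
      then have eu: "e \<otimes> ?u = ?u"
        using b bA y by (simp add: C_left flip: m_assoc)
      have sub: "?im ?u \<subseteq> ?im e"
      proof
        fix z assume "z \<in> ?im ?u"
        then obtain x where "x \<in> carrier A" "z = ?u \<otimes> x" by auto
        then have "z = e \<otimes> z" "z \<in> carrier A" using eu bA y m_assoc[of e ?u x] by auto
        then show "z \<in> ?im e" by blast
      qed
      \<comment> \<open>Minimality of e applies to the idempotent u, so the inclusion of uA in eA is
        an equality and e lies in uA.\<close>
      have "rank (?im e) \<le> rank (?im ?u)"
        using min[of ?u] y bA by auto
      then have "?im ?u = ?im e"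
        using rank_strict_mono[OF fd right_ideal_submodule[OF right_ideal_image], of ?u "?im e"]
          sub bA y by fastforce
      moreover have "e \<in> ?im e" using e by (intro image_eqI[of _ _ e]) auto
      ultimately obtain z where z: "z \<in> carrier A" "e = ?u \<otimes> z" by auto
      \<comment> \<open>From e = u z = b (b^k y z); the factors e on both sides move b^k y z into
        eAe.\<close>
      let ?z = "e \<otimes> (b [^] k \<otimes> y \<otimes> z \<otimes> e)"
      have "b \<otimes> ?z = (b \<otimes> e) \<otimes> (b [^] k \<otimes> y \<otimes> z \<otimes> e)"
        using bA y z by (simp only: m_assoc e_closed m_closed nat_pow_closed)
      also have "\<dots> = (?u \<otimes> z) \<otimes> e"
        using bA y(1) z(1) C_right[OF b] by (simp add: bn m_assoc)
      also have "\<dots> = e" using z by (metis e_idem)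
      finally have "b \<otimes> ?z = e" .
      moreover have "?z \<in> carrier C" using bA y z by (intro C_I) auto
      ultimately show ?thesis by auto
    qed
  qed
  then show thesis using that e by blast
qed

text \<open>A candidate of greatest rank is maximal because \<open>rank\<close> is strictly monotone
  on subspaces.\<close>

lemma ex_maximal_right_ideal:
  assumes fd: "fin_dim" and I: "right_ideal A I" "I \<subseteq> J" "J \<subseteq> carrier A" "I \<noteq> J"
  obtains M where "right_ideal A M" "I \<subseteq> M" "M \<subset> J"
    and "\<And>N. right_ideal A N \<Longrightarrow> M \<subseteq> N \<Longrightarrow> N \<subset> J \<Longrightarrow> N = M"
proof -
  let ?P = "\<lambda>M. right_ideal A M \<and> I \<subseteq> M \<and> M \<subset> J"
  have "\<forall>M. ?P M \<longrightarrow> rank M < Suc dim"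
    using rank_le_dim[OF fd] I(3) by (auto simp: less_Suc_eq_le psubset_eq)
  moreover have "?P I" using I by auto
  ultimately obtain M where M: "?P M" "\<And>N. ?P N \<Longrightarrow> rank N \<le> rank M"
    using ex_has_greatest_nat[of ?P I rank "Suc dim"] by auto
  show thesis
  proof (rule that)
    fix N assume N: "right_ideal A N" "M \<subseteq> N" "N \<subset> J"
    then have "rank N \<le> rank M" using M(1) by (intro M(2)) blast
    moreover have "rank M < rank N" if "M \<noteq> N"
      using that M(1) N I(3)
      by (intro rank_strict_mono[OF fd right_ideal_submodule]) auto
    ultimately show "N = M" by auto
  qed (use M in auto)
qed

end

section \<open>Quotients of right ideals and simple modules\<close>

definition ideal_module :: "('a, 'm) ring_scheme \<Rightarrow> 'a set \<Rightarrow> ('a, 'a) module" where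
  "ideal_module A I = \<lparr>carrier = I, mult = mult A, one = one A, zero = zero A, add = add A,
     smult = (\<lambda>a x. x \<otimes>\<^bsub>A\<^esub> a)\<rparr>"

lemma ideal_module_simps [simp]:
  "carrier (ideal_module A I) = I" "zero (ideal_module A I) = zero A"
  "add (ideal_module A I) = add A" "a \<odot>\<^bsub>ideal_module A I\<^esub> x = x \<otimes>\<^bsub>A\<^esub> a"
  by (simp_all add: ideal_module_def)

text \<open>The qualified name is the notion that occurs in \<open>simple_module\<close>, a subgroup
  closed under the action of A. The unqualified \<open>submodule\<close> elsewhere refers to
  submodules over the scalars.\<close>

lemma submodule_facts:
  assumes "Module.submodule N A S"
  shows "N \<subseteq> carrier S" "\<zero>\<^bsub>S\<^esub> \<in> N" "\<lbrakk>x \<in> N; y \<in> N\<rbrakk> \<Longrightarrow> x \<oplus>\<^bsub>S\<^esub> y \<in> N"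
    "\<lbrakk>a \<in> carrier A; x \<in> N\<rbrakk> \<Longrightarrow> a \<odot>\<^bsub>S\<^esub> x \<in> N"
  using subgroup.subset[OF Module.submodule.axioms(1)[OF assms]]
    subgroup.one_closed[OF Module.submodule.axioms(1)[OF assms]]
    subgroup.m_closed[OF Module.submodule.axioms(1)[OF assms]]
    Module.submodule.smult_closed[OF assms]
  by auto

lemma right_module_submoduleI:
  assumes "right_module A S" "N \<subseteq> carrier S" "\<zero>\<^bsub>S\<^esub> \<in> N"
    and "\<And>x y. x \<in> N \<Longrightarrow> y \<in> N \<Longrightarrow> x \<oplus>\<^bsub>S\<^esub> y \<in> N"
    and act: "\<And>a x. a \<in> carrier A \<Longrightarrow> x \<in> N \<Longrightarrow> a \<odot>\<^bsub>S\<^esub> x \<in> N"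
  shows "Module.submodule N A S"
proof -
  interpret right_module A S by fact
  have "\<ominus>\<^bsub>S\<^esub> x \<in> N" if "x \<in> N" for x
  proof -
    have "x \<in> carrier S" using that assms(2) by blast
    then have "\<ominus>\<^bsub>S\<^esub> x = (\<ominus>\<^bsub>A\<^esub> \<one>\<^bsub>A\<^esub>) \<odot>\<^bsub>S\<^esub> x"
      using right_module_minus_act[OF assms(1), of x "\<one>\<^bsub>A\<^esub>"] act_one by simp
    then show ?thesis using act[OF _ that] by simp
  qed
  then show ?thesis
    using assms
    by (intro Module.submodule.intro M.add.subgroupI Module.submodule_axioms.intro) (auto simp flip: a_inv_def)
qed

lemma right_module_diff_act:
  assumes "right_module A S" "a \<in> carrier A" "b \<in> carrier A" "s \<in> carrier S"
  shows "(a \<ominus>\<^bsub>A\<^esub> b) \<odot>\<^bsub>S\<^esub> s = a \<odot>\<^bsub>S\<^esub> s \<ominus>\<^bsub>S\<^esub> b \<odot>\<^bsub>S\<^esub> s"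
proof -
  interpret right_module A S by fact
  show ?thesis
    using assms by (simp add: a_minus_def act_add_left right_module_minus_act[OF assms(1)])
qed

text \<open>The orbit of s is a submodule, and it contains s = s 1.\<close>

lemma simple_module_generated:
  assumes S: "simple_module A S" and s: "s \<in> carrier S" "s \<noteq> \<zero>\<^bsub>S\<^esub>" and t: "t \<in> carrier S"
  shows "\<exists>a\<in>carrier A. t = a \<odot>\<^bsub>S\<^esub> s"
proof -
  have mod: "right_module A S" using S by (simp add: simple_module_def)
  interpret right_module A S by fact
  let ?N = "(\<lambda>a. a \<odot>\<^bsub>S\<^esub> s) ` carrier A"
  have "Module.submodule ?N A S"
  proof (rule right_module_submoduleI[OF mod])
    show "\<zero>\<^bsub>S\<^esub> \<in> ?N"
      using right_module_zero_act[OF mod s(1)] by (intro image_eqI[of _ _ "\<zero>\<^bsub>A\<^esub>"]) auto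
    fix x assume "x \<in> ?N"
    then obtain a where a: "a \<in> carrier A" "x = a \<odot>\<^bsub>S\<^esub> s" by auto
    {
      fix y assume "y \<in> ?N"
      then obtain b where "b \<in> carrier A" "y = b \<odot>\<^bsub>S\<^esub> s" by auto
      then show "x \<oplus>\<^bsub>S\<^esub> y \<in> ?N"
        using a s by (intro image_eqI[of _ _ "a \<oplus>\<^bsub>A\<^esub> b"]) (auto simp: act_add_left)
    next
      fix b assume "b \<in> carrier A"
      then show "b \<odot>\<^bsub>S\<^esub> x \<in> ?N"
        using a s by (intro image_eqI[of _ _ "a \<otimes>\<^bsub>A\<^esub> b"]) (auto simp: act_assoc)
    }
  qed (use s act_closed in auto)
  moreover have "s \<in> ?N"
    using act_one[OF s(1)] by (intro image_eqI[of _ _ "\<one>\<^bsub>A\<^esub>"]) auto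
  ultimately have "?N = carrier S"
    using S s by (auto simp: simple_module_def)
  then show ?thesis using t by auto
qed

section \<open>Quotients of right ideals, realized in the universe\<close>

context assoc_algebra
begin

lemma minus_minus_cancel:
  assumes "x \<in> carrier A" "y \<in> carrier A" "z \<in> carrier A"
  shows "(x \<ominus> y) \<oplus> (y \<ominus> z) = x \<ominus> z"
  using assms by (simp add: a_minus_def a_assoc r_neg1)

lemma add_minus_add_cancel:
  assumes "x \<in> carrier A" "y \<in> carrier A" "z \<in> carrier A"
  shows "(x \<oplus> z) \<ominus> (y \<oplus> z) = x \<ominus> y"
proof -
  have "(x \<oplus> z) \<ominus> (y \<oplus> z) = x \<oplus> (z \<oplus> (\<ominus> z \<oplus> \<ominus> y))"
    using assms by (simp add: a_minus_def minus_add a_ac)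
  then show ?thesis using assms by (simp add: a_minus_def r_neg2)
qed

lemma right_ideal_module:
  assumes "right_ideal A I"
  shows "right_module A (ideal_module A I)"
proof -
  have I: "x \<in> carrier A" if "x \<in> I" for x using that assms by (auto simp: right_ideal_def)
  interpret I: abelian_group "ideal_module A I"
  proof (rule abelian_groupI)
    fix x assume x: "x \<in> carrier (ideal_module A I)"
    have "\<zero> \<ominus> x \<in> I"
      using right_ideal_minus[OF assms, of \<zero> x] x assms by (auto simp: right_ideal_def)
    then have "\<ominus> x \<in> I" using I x by (simp add: a_minus_def)
    then show "\<exists>y\<in>carrier (ideal_module A I). y \<oplus>\<^bsub>ideal_module A I\<^esub> x = \<zero>\<^bsub>ideal_module A I\<^esub>"
      using I x by (intro bexI[of _ "\<ominus> x"]) (auto simp: l_neg)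
  qed (use assms I in \<open>auto simp: right_ideal_def a_ac\<close>)
  show ?thesis
    using assms by unfold_locales (auto simp: right_ideal_def l_distr r_distr m_assoc I)
qed

lemma ex_quotient_module:
  assumes emb: "carrier A \<lesssim> (UNIV :: 'u set)"
    and I: "right_ideal A I" and M: "right_ideal A M" "M \<subseteq> I"
  obtains S :: "('c, 'u) module" and p
  where "right_module A S" "p \<in> Hom A (ideal_module A I) S" "p ` I = carrier S"
    "\<And>x. x \<in> I \<Longrightarrow> p x = \<zero>\<^bsub>S\<^esub> \<longleftrightarrow> x \<in> M"
proof -
  obtain f :: "'c \<Rightarrow> 'u" where f: "inj_on f (carrier A)"
    using emb by (auto simp: lepoll_def)
  \<comment> \<open>The predicate depends only on the coset of x, hence so does the chosen element
    (\<open>r_eq\<close>). Followed by the injection \<open>f\<close> it encodes I / M.\<close>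
  define r where "r x = (SOME y. y \<in> I \<and> x \<ominus> y \<in> M)" for x
  have IA: "x \<in> carrier A" if "x \<in> I" for x using I that by (auto simp: right_ideal_def)
  have M0: "\<zero> \<in> M"
    using M by (simp add: right_ideal_def)
  have Madd: "x \<oplus> y \<in> M" if "x \<in> M" "y \<in> M" for x y
    using M that by (auto simp: right_ideal_def)
  have r: "r x \<in> I" "x \<ominus> r x \<in> M" if "x \<in> I" for x
  proof -
    have "r x \<in> I \<and> x \<ominus> r x \<in> M"
      unfolding r_def
      by (rule someI[of "\<lambda>y. y \<in> I \<and> x \<ominus> y \<in> M" x])
        (use that M0 IA in \<open>simp add: a_minus_def r_neg\<close>)
    then show "r x \<in> I" "x \<ominus> r x \<in> M" by auto
  qed
  have r_eq: "r x = r y \<longleftrightarrow> x \<ominus> y \<in> M" if xy: "x \<in> I" "y \<in> I" for x y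
  proof
    assume "r x = r y"
    then have "(x \<ominus> r x) \<ominus> (y \<ominus> r x) \<in> M"
      using right_ideal_minus[OF M(1) r(2)[OF xy(1)] r(2)[OF xy(2)]] by simp
    moreover have "(x \<ominus> r x) \<ominus> (y \<ominus> r x) = x \<ominus> y"
      using add_minus_add_cancel[of x y "\<ominus> r x"] IA r xy by (simp add: a_minus_def)
    ultimately show "x \<ominus> y \<in> M" by simp
  next
    assume d: "x \<ominus> y \<in> M"
    have "\<zero> \<ominus> (x \<ominus> y) \<in> M"
      using right_ideal_minus[OF M(1) M0 d] .
    then have d': "y \<ominus> x \<in> M"
      using IA xy by (simp add: a_minus_def minus_add a_comm)
    have "(z \<in> I \<and> x \<ominus> z \<in> M) \<longleftrightarrow> (z \<in> I \<and> y \<ominus> z \<in> M)" for z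
      using Madd[OF d, of "y \<ominus> z"] Madd[OF d', of "x \<ominus> z"]
        minus_minus_cancel[of x y z] minus_minus_cancel[of y x z] IA xy by auto
    then show "r x = r y" unfolding r_def by simp
  qed
  define q where "q x = f (r x)" for x
  have q_eq: "q x = q y \<longleftrightarrow> x \<ominus> y \<in> M" if "x \<in> I" "y \<in> I" for x y
    using inj_on_eq_iff[OF f, of "r x" "r y"] r_eq IA r that by (simp add: q_def)
  interpret I: right_module A "ideal_module A I" by (rule right_ideal_module[OF I])
  interpret q: module_congruence A "ideal_module A I" q
  proof
    fix x y z assume *: "x \<in> carrier (ideal_module A I)" "y \<in> carrier (ideal_module A I)"
      "z \<in> carrier (ideal_module A I)" "q x = q y"
    then show "q (x \<oplus>\<^bsub>ideal_module A I\<^esub> z) = q (y \<oplus>\<^bsub>ideal_module A I\<^esub> z)"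
      using I q_eq[of x y] q_eq[of "x \<oplus> z" "y \<oplus> z"] add_minus_add_cancel[of x y z] IA
      by (auto simp: right_ideal_def)
  next
    fix x y a assume *: "x \<in> carrier (ideal_module A I)" "y \<in> carrier (ideal_module A I)"
      "a \<in> carrier A" "q x = q y"
    then have "(x \<ominus> y) \<otimes> a \<in> M" using q_eq[of x y] M by (auto simp: right_ideal_def)
    moreover have "(x \<ominus> y) \<otimes> a = x \<otimes> a \<ominus> y \<otimes> a"
      using * IA by (simp add: a_minus_def l_distr l_minus)
    ultimately show "q (a \<odot>\<^bsub>ideal_module A I\<^esub> x) = q (a \<odot>\<^bsub>ideal_module A I\<^esub> y)"
      using * I q_eq[of "x \<otimes> a" "y \<otimes> a"] by (auto simp: right_ideal_def)
  qed
  show thesis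
  proof (rule that)
    show "right_module A (image_module q (ideal_module A I))" by (rule q.right_module_image)
    show "restrict q I \<in> Hom A (ideal_module A I) (image_module q (ideal_module A I))"
      using q.image_Hom by simp
    show "restrict q I ` I = carrier (image_module q (ideal_module A I))"
      by (auto simp: q.image_carrier)
    fix x assume "x \<in> I"
    moreover have "\<zero> \<in> I" using I by (simp add: right_ideal_def)
    ultimately show "restrict q I x = \<zero>\<^bsub>image_module q (ideal_module A I)\<^esub> \<longleftrightarrow> x \<in> M"
      using q_eq[of x \<zero>] IA by (simp add: q.image_zero a_minus_def)
  qed
qed

lemma quotient_hom_eq_iff:
  assumes "right_module A S" "right_ideal A I" "p \<in> Hom A (ideal_module A I) S"
    "\<And>x. x \<in> I \<Longrightarrow> p x = \<zero>\<^bsub>S\<^esub> \<longleftrightarrow> x \<in> M" "x \<in> I" "y \<in> I"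
  shows "p x = p y \<longleftrightarrow> x \<ominus> y \<in> M"
proof -
  interpret S: right_module A S by fact
  have IA: "x \<in> carrier A" if "x \<in> I" for x using assms(2) that by (auto simp: right_ideal_def)
  have d: "x \<ominus> y \<in> I" by (rule right_ideal_minus[OF assms(2,5,6)])
  have "p (x \<ominus> y) \<oplus>\<^bsub>S\<^esub> p y = p ((x \<ominus> y) \<oplus> y)"
    using Hom_add[OF assms(3), of "x \<ominus> y" y] d assms by simp
  also have "(x \<ominus> y) \<oplus> y = x"
    using minus_minus_cancel[of x y \<zero>] IA assms by (simp add: a_minus_def)
  finally have "p (x \<ominus> y) \<oplus>\<^bsub>S\<^esub> p y = p x" .
  then have "p x = p y \<longleftrightarrow> p (x \<ominus> y) = \<zero>\<^bsub>S\<^esub>"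
    using S.add.l_cancel_one'[of "p y" "p (x \<ominus> y)"] Hom_closed[OF assms(3)] d assms(6) by auto
  then show ?thesis using assms d by simp
qed

lemma ex_module_copy:
  assumes emb: "carrier A \<lesssim> (UNIV :: 'u set)" and I: "right_ideal A I"
  obtains S :: "('c, 'u) module" and p
  where "right_module A S" "p \<in> Hom A (ideal_module A I) S" "p ` I = carrier S" "inj_on p I"
proof -
  have zero: "right_ideal A {\<zero>}" by (rule right_idealI) auto
  have sub: "{\<zero>} \<subseteq> I" using I by (simp add: right_ideal_def)
  obtain S :: "('c, 'u) module" and p where S: "right_module A S"
    and p: "p \<in> Hom A (ideal_module A I) S" "p ` I = carrier S"
      "\<And>x. x \<in> I \<Longrightarrow> p x = \<zero>\<^bsub>S\<^esub> \<longleftrightarrow> x \<in> {\<zero>}"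
    by (rule ex_quotient_module[OF emb I zero sub]) (rule that)
  have IA: "x \<in> carrier A" if "x \<in> I" for x using I that by (auto simp: right_ideal_def)
  have "inj_on p I"
  proof (rule inj_onI)
    fix x y assume "x \<in> I" "y \<in> I" "p x = p y"
    then show "x = y" using quotient_hom_eq_iff[OF S I p(1,3), of x y] IA by simp
  qed
  then show thesis using that S p by blast
qed

text \<open>Submodules of I / M pull back to right ideals between M and I, and by \<open>max\<close>
  only these two exist.\<close>

lemma simple_quotient:
  assumes emb: "carrier A \<lesssim> (UNIV :: 'u set)"
    and I: "right_ideal A I" and M: "right_ideal A M" "M \<subset> I"
    and max: "\<And>N. right_ideal A N \<Longrightarrow> M \<subseteq> N \<Longrightarrow> N \<subset> I \<Longrightarrow> N = M"
  obtains S :: "('c, 'u) module" and p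
  where "simple_module A S" "p \<in> Hom A (ideal_module A I) S" "p ` I = carrier S"
    "\<And>x. x \<in> I \<Longrightarrow> p x = \<zero>\<^bsub>S\<^esub> \<longleftrightarrow> x \<in> M"
proof -
  obtain S :: "('c, 'u) module" and p where S: "right_module A S"
    and p: "p \<in> Hom A (ideal_module A I) S" "p ` I = carrier S"
      "\<And>x. x \<in> I \<Longrightarrow> p x = \<zero>\<^bsub>S\<^esub> \<longleftrightarrow> x \<in> M"
    by (rule ex_quotient_module[OF emb I M(1)]) (use M in auto)
  have IA: "I \<subseteq> carrier A" using I by (auto simp: right_ideal_def)
  have p0: "p \<zero> = \<zero>\<^bsub>S\<^esub>" using p(3)[of \<zero>] I M by (auto simp: right_ideal_def)
  have "simple_module A S"
    unfolding simple_module_def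
  proof (intro conjI allI impI)
    show "carrier S \<noteq> {\<zero>\<^bsub>S\<^esub>}" using p M by force
    fix N assume N: "Module.submodule N A S"
    let ?N = "{x \<in> I. p x \<in> N}"
    have "right_ideal A ?N"
    proof (rule right_idealI)
      show "\<zero> \<in> ?N" using p0 submodule_facts(2)[OF N] I by (simp add: right_ideal_def)
      show "x \<oplus> y \<in> ?N" if "x \<in> ?N" "y \<in> ?N" for x y
        using that Hom_add[OF p(1), of x y] submodule_facts(3)[OF N] I by (simp add: right_ideal_def)
      show "x \<otimes> a \<in> ?N" if "x \<in> ?N" "a \<in> carrier A" for x a
        using that Hom_act[OF p(1), of a x] submodule_facts(4)[OF N] I by (simp add: right_ideal_def)
    qed (use IA in auto)
    moreover have "M \<subseteq> ?N"
    proof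
      fix x assume "x \<in> M"
      then have "x \<in> I" "p x = \<zero>\<^bsub>S\<^esub>" using M p(3) by auto
      then show "x \<in> ?N" using submodule_facts(2)[OF N] by simp
    qed
    ultimately have "?N = I \<or> ?N = M" using max[of ?N] by blast
    then show "N = {\<zero>\<^bsub>S\<^esub>} \<or> N = carrier S"
    proof
      assume "?N = I"
      then have "p ` I \<subseteq> N" by auto
      then have "carrier S \<subseteq> N" unfolding p(2) .
      then show ?thesis using submodule_facts(1)[OF N] by blast
    next
      assume eq: "?N = M"
      have "s = \<zero>\<^bsub>S\<^esub>" if "s \<in> N" for s
      proof -
        obtain x where x: "x \<in> I" "s = p x"
          using \<open>s \<in> N\<close> submodule_facts(1)[OF N] p(2) by blast
        then have "x \<in> ?N" using that by simp
        then have "x \<in> M" unfolding eq .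
        then show ?thesis using p(3) x by simp
      qed
      then show ?thesis using submodule_facts(2)[OF N] by blast
    qed
  qed (rule S)
  then show thesis using that p by blast
qed

end

section \<open>Counting simple modules\<close>

lemma Iso_refl: "right_module A S \<Longrightarrow> Iso A S S \<noteq> {}"
  using Hom_id[of A S] by (auto simp: Iso_def bij_betw_def inj_on_def)

text \<open>From left to right, reflexivity does it: T belongs to its own class, which is the only
  class and therefore also that of S.\<close>

lemma num_simple_modules_eq_1_iff:
  "num_simple_modules TYPE('u) A = 1 \<longleftrightarrow> (\<exists>S :: ('a, 'u) module. simple_module A S) \<and>
    (\<forall>(S :: ('a, 'u) module) (T :: ('a, 'u) module). simple_module A S \<and> simple_module A T \<longrightarrow> Iso A S T \<noteq> {})"
  (is "_ \<longleftrightarrow> ?ex \<and> ?iso")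
proof -
  let ?X = "{S :: ('a, 'u) module. simple_module A S}"
  let ?r = "{(S, T). simple_module A S \<and> simple_module A T \<and> Iso A S T \<noteq> {}} :: (('a, 'u) module \<times> _) set"
  show ?thesis
  proof
    assume "num_simple_modules TYPE('u) A = 1"
    then obtain c where c: "?X // ?r = {c}"
      by (auto simp: num_simple_modules_def card_1_singleton_iff)
    then have cl: "?r `` {S} = c" if "simple_module A S" for S
      using that quotientI[of S ?X ?r] by auto
    have ex: "?X \<noteq> {}" using c by (auto simp: quotient_def)
    have iso: "Iso A S T \<noteq> {}"
      if "simple_module A S" "simple_module A T" for S T :: "('a, 'u) module"
    proof -
      have "T \<in> ?r `` {T}" using that Iso_refl[of A T] by (simp add: simple_module_def)
      then have "T \<in> ?r `` {S}" using cl[OF that(1)] cl[OF that(2)] by blast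
      then show ?thesis by simp
    qed
    show "?ex \<and> ?iso"
    proof (intro conjI allI impI)
      show ?ex using ex by simp
      show "Iso A S T \<noteq> {}" if "simple_module A S \<and> simple_module A T" for S T :: "('a, 'u) module"
        using that by (intro iso) simp_all
    qed
  next
    assume *: "?ex \<and> ?iso"
    have cl: "?r `` {S} = ?X" if S: "simple_module A S" for S :: "('a, 'u) module"
    proof (rule Set.set_eqI)
      fix T :: "('a, 'u) module"
      have "simple_module A T \<Longrightarrow> Iso A S T \<noteq> {}" using conjunct2[OF *] S by simp
      then show "T \<in> ?r `` {S} \<longleftrightarrow> T \<in> ?X" using S by auto
    qed
    have "?X // ?r = (\<lambda>S. ?r `` {S}) ` ?X"
      unfolding quotient_def by blast
    also have "\<dots> = (\<lambda>S. ?X) ` ?X"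
      by (intro image_cong refl cl) simp
    also have "\<dots> = {?X}" using conjunct1[OF *] by auto
    finally have "?X // ?r = {?X}" .
    then show "num_simple_modules TYPE('u) A = 1" by (simp add: num_simple_modules_def)
  qed
qed

section \<open>Local corners\<close>

context idempotent_algebra
begin

abbreviation eA where "eA \<equiv> (\<lambda>x. e \<otimes> x) ` carrier A"

lemma eA_iff: "x \<in> eA \<longleftrightarrow> x \<in> carrier A \<and> e \<otimes> x = x"
  by force

lemma eA_right_ideal: "right_ideal A eA"
  by (rule right_ideal_image) simp

lemma eA_mult: "x \<in> eA \<Longrightarrow> a \<in> carrier A \<Longrightarrow> x \<otimes> a \<otimes> e \<in> carrier C"
  by (auto simp: C_iff m_assoc)

lemma C_mult_eA: "b \<in> carrier C \<Longrightarrow> x \<in> eA \<Longrightarrow> b \<otimes> x \<in> eA"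
  using C_left[of b] C_closed[of b] by (auto simp: eA_iff simp flip: m_assoc)

end

locale local_corner = idempotent_algebra F A e for F and A (structure) and e +
  assumes C_local: "nil_local_ring C"
begin

interpretation L: nil_local_ring C by (rule C_local)

lemma e_nonzero: "e \<noteq> \<zero>"
  using L.nontrivial by simp

text \<open>The unique maximal right ideal properly inside eA. It is described by the products x a e
  in eAe, so that closure under addition is inherited from the nonunits of the local ring
  eAe.\<close>

definition eJ where "eJ = {x \<in> eA. \<forall>a\<in>carrier A. x \<otimes> a \<otimes> e \<notin> Units C}"

lemma eJ_right_ideal: "right_ideal A eJ"
proof (rule right_idealI)
  show "eJ \<subseteq> carrier A" by (auto simp: eJ_def)
  show "\<zero> \<in> eJ"
    using L.zero_nonunit by (auto simp: eJ_def intro!: image_eqI[of _ _ \<zero>])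
  show "x \<oplus> y \<in> eJ" if xy: "x \<in> eJ" "y \<in> eJ" for x y
  proof -
    have "x \<in> carrier A" "y \<in> carrier A" using xy by (auto simp: eJ_def)
    moreover have "(x \<otimes> a \<otimes> e) \<oplus> (y \<otimes> a \<otimes> e) \<notin> Units C" if "a \<in> carrier A" for a
      using L.nonunit_add[of "x \<otimes> a \<otimes> e" "y \<otimes> a \<otimes> e"] xy that eA_mult by (auto simp: eJ_def)
    moreover have "x \<oplus> y \<in> eA"
      using xy eA_right_ideal by (auto simp: eJ_def right_ideal_def)
    ultimately show ?thesis by (auto simp: eJ_def l_distr)
  qed
  show "x \<otimes> b \<in> eJ" if xb: "x \<in> eJ" "b \<in> carrier A" for x b
  proof -
    have "x \<in> carrier A" using xb by (auto simp: eJ_def)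
    moreover have "x \<otimes> b \<in> eA"
      using xb eA_right_ideal by (auto simp: eJ_def right_ideal_def)
    moreover have "x \<otimes> (b \<otimes> a) \<otimes> e \<notin> Units C" if "a \<in> carrier A" for a
      using xb that by (auto simp: eJ_def)
    ultimately show ?thesis using xb by (auto simp: eJ_def m_assoc)
  qed
qed

lemma eJ_less: "eJ \<subset> eA"
proof -
  have "e \<otimes> \<one> \<otimes> e \<in> Units C" using C.Units_one_closed by simp
  then have "e \<notin> eJ" unfolding eJ_def using one_closed by blast
  moreover have "e \<in> eA" by (simp add: eA_iff)
  ultimately show ?thesis by (auto simp: eJ_def)
qed

text \<open>An x outside \<open>eJ\<close> has some x a e invertible in eAe, so e itself lies in
  xA.\<close>

lemma eA_generated:
  assumes N: "right_ideal A N" and x: "x \<in> N" "x \<in> eA" "x \<notin> eJ"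
  shows "eA \<subseteq> N"
proof -
  obtain a where a: "a \<in> carrier A" "x \<otimes> a \<otimes> e \<in> Units C"
    using x by (auto simp: eJ_def)
  then obtain w where w: "w \<in> carrier C" "x \<otimes> a \<otimes> e \<otimes> w = e"
    using C.Units_r_inv_ex[of "x \<otimes> a \<otimes> e"] by auto
  have "x \<otimes> a \<otimes> e \<otimes> w \<in> N"
    by (intro right_ideal_mult[OF N] x a w C_closed e_closed)
  then have "e \<in> N" using w by simp
  then show ?thesis using N by (auto simp: right_ideal_def)
qed

lemma simple_top:
  assumes emb: "carrier A \<lesssim> (UNIV :: 'u set)"
  obtains S :: "('c, 'u) module" and p
  where "simple_module A S" "p \<in> Hom A (ideal_module A eA) S" "p ` eA = carrier S"
    "\<And>x. x \<in> eA \<Longrightarrow> p x = \<zero>\<^bsub>S\<^esub> \<longleftrightarrow> x \<in> eJ"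
proof -
  have "N = eJ" if "right_ideal A N" "eJ \<subseteq> N" "N \<subset> eA" for N
    using eA_generated[OF that(1)] that by blast
  then show thesis
    using simple_quotient[OF emb eA_right_ideal eJ_right_ideal eJ_less] that by metis
qed

text \<open>
  Left multiplication by an element of \<open>eAe\<close> induces an endomorphism of the simple module
  \<open>eA / eJ\<close>, which is a scalar.
\<close>

lemma residue_field:
  assumes emb: "carrier A \<lesssim> (UNIV :: 'u set)" and split: "splitting_field TYPE('u) F A"
    and b: "b \<in> carrier C"
  shows "\<exists>c\<in>carrier F. b \<ominus> c \<odot> e \<notin> Units C"
proof -
  obtain S :: "('c, 'u) module" and p where S: "simple_module A S"
    and p: "p \<in> Hom A (ideal_module A eA) S" "p ` eA = carrier S"
      "\<And>x. x \<in> eA \<Longrightarrow> p x = \<zero>\<^bsub>S\<^esub> \<longleftrightarrow> x \<in> eJ"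
    by (rule simple_top[OF emb]) (rule that)
  have mod: "right_module A S" using S by (simp add: simple_module_def)
  interpret S: right_module A S by fact
  have bA: "b \<in> carrier A" using b by (rule C_closed)
  note p_eq = quotient_hom_eq_iff[OF mod eA_right_ideal p(1,3)]
  have eA: "x \<in> carrier A" if "x \<in> eA" for x using that by auto
  define h where "h = (\<lambda>s\<in>carrier S. p (b \<otimes> inv_into eA p s))"
  have h: "h (p x) = p (b \<otimes> x)" if x: "x \<in> eA" for x
  proof -
    let ?y = "inv_into eA p (p x)"
    have y: "?y \<in> eA" "p ?y = p x"
      using x by (auto intro: inv_into_into f_inv_into_f)
    then have d: "?y \<ominus> x \<in> eJ" using p_eq[of ?y x] x by simp
    \<comment> \<open>Left multiplication by b preserves \<open>eJ\<close>, because b times a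
      nonunit of eAe is a nonunit. Hence \<open>h\<close> does not depend on the chosen
      preimage.\<close>
    have "b \<otimes> (?y \<ominus> x) \<in> eJ"
    proof -
      have "?y \<ominus> x \<in> eA" using d by (simp add: eJ_def)
      moreover have "b \<otimes> (?y \<ominus> x) \<otimes> a \<otimes> e \<notin> Units C" if "a \<in> carrier A" for a
      proof -
        have "(?y \<ominus> x) \<otimes> a \<otimes> e \<in> carrier C" "(?y \<ominus> x) \<otimes> a \<otimes> e \<notin> Units C"
          using d that eA_mult by (auto simp: eJ_def)
        then have "b \<otimes> ((?y \<ominus> x) \<otimes> a \<otimes> e) \<notin> Units C"
          using L.nonunit_mult(2) b by auto
        then show ?thesis using bA y eA x that by (simp add: m_assoc)
      qed
      ultimately show ?thesis using C_mult_eA[OF b] by (simp add: eJ_def)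
    qed
    then have "b \<otimes> ?y \<ominus> b \<otimes> x \<in> eJ"
      using bA y eA x by (simp add: a_minus_def r_distr r_minus)
    then have "p (b \<otimes> ?y) = p (b \<otimes> x)"
      using p_eq[of "b \<otimes> ?y" "b \<otimes> x"] C_mult_eA[OF b] x y by simp
    moreover have "p x \<in> carrier S" using p(2) x by auto
    ultimately show ?thesis by (simp add: h_def)
  qed
  have "h \<in> Hom A S S"
  proof (rule HomI)
    show "h \<in> extensional (carrier S)" by (simp add: h_def)
    fix s assume "s \<in> carrier S"
    then obtain x where x: "x \<in> eA" "s = p x" using p(2) by auto
    show "h s \<in> carrier S"
      using x h C_mult_eA[OF b x(1)] p(2) by auto
    show "h (a \<odot>\<^bsub>S\<^esub> s) = a \<odot>\<^bsub>S\<^esub> h s" if a: "a \<in> carrier A" for a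
    proof -
      have xa: "x \<otimes> a \<in> eA" using eA_right_ideal x a by (auto simp: right_ideal_def)
      have "h (a \<odot>\<^bsub>S\<^esub> s) = h (p (x \<otimes> a))" using Hom_act[OF p(1) a, of x] x by simp
      also have "\<dots> = p ((b \<otimes> x) \<otimes> a)" using h[OF xa] x eA bA a by (simp add: m_assoc)
      also have "\<dots> = a \<odot>\<^bsub>S\<^esub> p (b \<otimes> x)"
        using Hom_act[OF p(1) a, of "b \<otimes> x"] C_mult_eA[OF b x(1)] by simp
      finally show ?thesis using h x by simp
    qed
    show "h (s \<oplus>\<^bsub>S\<^esub> t) = h s \<oplus>\<^bsub>S\<^esub> h t" if "t \<in> carrier S" for t
    proof -
      obtain y where y: "y \<in> eA" "t = p y" using \<open>t \<in> carrier S\<close> p(2) by auto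
      have xy: "x \<oplus> y \<in> eA" using eA_right_ideal x y by (auto simp: right_ideal_def)
      have "h (s \<oplus>\<^bsub>S\<^esub> t) = h (p (x \<oplus> y))" using Hom_add[OF p(1), of x y] x y by simp
      also have "\<dots> = p (b \<otimes> x \<oplus> b \<otimes> y)" using h[OF xy] x y eA bA by (simp add: r_distr)
      also have "\<dots> = p (b \<otimes> x) \<oplus>\<^bsub>S\<^esub> p (b \<otimes> y)"
        using Hom_add[OF p(1), of "b \<otimes> x" "b \<otimes> y"] C_mult_eA[OF b] x y by simp
      finally show ?thesis using h x y by simp
    qed
  qed
  moreover have "bij_betw (\<lambda>c. \<lambda>x\<in>carrier S. (c \<odot> \<one>) \<odot>\<^bsub>S\<^esub> x) (carrier F) (Hom A S S)"
    using split S by (simp add: splitting_field_def)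
  ultimately obtain c where c: "c \<in> carrier F" "h = (\<lambda>x\<in>carrier S. (c \<odot> \<one>) \<odot>\<^bsub>S\<^esub> x)"
    by (auto simp: bij_betw_def)
  have e: "e \<in> eA" by (simp add: eA_iff)
  have ce: "c \<odot> e \<in> eA" using c by (simp add: eA_iff smult_mult_right)
  have "p e \<in> carrier S" using e p(2) by auto
  \<comment> \<open>Evaluated at the generator e, the equality of \<open>h\<close> with the scalar c
    says that b e - c e lies in \<open>eJ\<close>; the instance a = 1 of the definition of
    \<open>eJ\<close> then makes b - c e a nonunit.\<close>
  then have "p (b \<otimes> e) = (c \<odot> \<one>) \<odot>\<^bsub>S\<^esub> p e" using h[OF e] c by simp
  also have "\<dots> = p (e \<otimes> (c \<odot> \<one>))" using Hom_act[OF p(1), of "c \<odot> \<one>" e] e c by simp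
  also have "\<dots> = p (c \<odot> e)" using c by (simp add: smult_one_mult)
  finally have "b \<otimes> e \<ominus> c \<odot> e \<in> eJ"
    using p_eq[of "b \<otimes> e" "c \<odot> e"] C_mult_eA[OF b e] ce by simp
  then have "(b \<otimes> e \<ominus> c \<odot> e) \<otimes> \<one> \<otimes> e \<notin> Units C"
    unfolding eJ_def using one_closed by blast
  moreover have "(b \<otimes> e \<ominus> c \<odot> e) \<otimes> \<one> \<otimes> e = b \<ominus> c \<odot> e"
    using bA c C_right[OF b] by (simp add: a_minus_def l_distr l_minus smult_mult_left)
  ultimately show ?thesis using c by auto
qed

end

section \<open>Full idempotents\<close>

text \<open>Finite sums of elements x e y, built one term at a time, so that rule induction is
  induction on the number of terms.\<close>

inductive_set two_sided_ideal :: "('a, 'm) ring_scheme \<Rightarrow> 'a \<Rightarrow> 'a set"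
  for A :: "('a, 'm) ring_scheme" and e :: 'a where
  zero: "\<zero>\<^bsub>A\<^esub> \<in> two_sided_ideal A e"
| add: "\<lbrakk>x \<in> carrier A; y \<in> carrier A; z \<in> two_sided_ideal A e\<rbrakk>
    \<Longrightarrow> x \<otimes>\<^bsub>A\<^esub> e \<otimes>\<^bsub>A\<^esub> y \<oplus>\<^bsub>A\<^esub> z \<in> two_sided_ideal A e"

context idempotent_algebra
begin

abbreviation AeA where "AeA \<equiv> two_sided_ideal A e"

lemma AeA_closed: "z \<in> AeA \<Longrightarrow> z \<in> carrier A"
  by (induction rule: two_sided_ideal.induct) auto

lemma AeA_right_ideal: "right_ideal A AeA"
proof (rule right_idealI)
  fix z assume z: "z \<in> AeA"
  show "z \<oplus> w \<in> AeA" if w: "w \<in> AeA" for w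
    using z
  proof induction
    case (add x y z)
    have "x \<otimes> e \<otimes> y \<oplus> (z \<oplus> w) \<in> AeA"
      by (rule two_sided_ideal.add) (use add in auto)
    then show ?case using add AeA_closed w by (simp add: a_assoc)
  qed (use w AeA_closed in auto)
  show "z \<otimes> a \<in> AeA" if a: "a \<in> carrier A" for a
    using z
  proof induction
    case (add x y z)
    have "x \<otimes> e \<otimes> (y \<otimes> a) \<oplus> z \<otimes> a \<in> AeA"
      by (rule two_sided_ideal.add) (use add a in auto)
    then show ?case using add AeA_closed a by (simp add: l_distr m_assoc)
  qed (use a two_sided_ideal.zero in auto)
qed (auto intro: AeA_closed two_sided_ideal.zero)

lemma mult_e_in_AeA: "x \<in> carrier A \<Longrightarrow> x \<otimes> e \<in> AeA"
  using two_sided_ideal.add[of x A \<one> \<zero> e, OF _ _ two_sided_ideal.zero] by simp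

text \<open>Fullness lets any a = 1 a be written as a finite sum of elements x e y. The later
  consequences of fullness are all drawn by this induction.\<close>

lemma full_induct [consumes 2, case_names zero add]:
  assumes "\<one> \<in> AeA" "a \<in> carrier A"
    and "P \<zero>"
    and "\<And>x y z. \<lbrakk>x \<in> carrier A; y \<in> carrier A; z \<in> carrier A; P z\<rbrakk> \<Longrightarrow> P (x \<otimes> e \<otimes> y \<oplus> z)"
  shows "P a"
proof -
  have "\<one> \<otimes> a \<in> AeA" by (rule right_ideal_mult[OF AeA_right_ideal assms(1,2)])
  then have "a \<in> AeA" using assms(2) by simp
  then show ?thesis
    by induction (use assms(3,4) AeA_closed in auto)
qed

text \<open>Take A / M for a maximal right ideal M above AeA: it is killed by e because A e lies in
  AeA.\<close>

lemma ex_simple_annihilated: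
  assumes emb: "carrier A \<lesssim> (UNIV :: 'u set)" and fd: "fin_dim" and not_full: "\<one> \<notin> AeA"
  obtains S :: "('c, 'u) module" where "simple_module A S"
    "\<And>s. s \<in> carrier S \<Longrightarrow> e \<odot>\<^bsub>S\<^esub> s = \<zero>\<^bsub>S\<^esub>"
proof -
  have ne: "AeA \<noteq> carrier A" using not_full by auto
  have A: "right_ideal A (carrier A)" by (rule right_idealI) auto
  obtain M where M: "right_ideal A M" "AeA \<subseteq> M" "M \<subset> carrier A"
    "\<And>N. right_ideal A N \<Longrightarrow> M \<subseteq> N \<Longrightarrow> N \<subset> carrier A \<Longrightarrow> N = M"
    by (rule ex_maximal_right_ideal[OF fd AeA_right_ideal _ subset_refl ne])
      (use AeA_closed in auto)
  obtain S :: "('c, 'u) module" and p where S: "simple_module A S"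
    and p: "p \<in> Hom A (ideal_module A (carrier A)) S" "p ` carrier A = carrier S"
      "\<And>x. x \<in> carrier A \<Longrightarrow> p x = \<zero>\<^bsub>S\<^esub> \<longleftrightarrow> x \<in> M"
    by (rule simple_quotient[OF emb A M(1,3)]) (erule (2) M(4), rule that)
  show thesis
  proof (rule that[OF S])
    fix s assume "s \<in> carrier S"
    then obtain x where x: "x \<in> carrier A" "s = p x" using p(2) by auto
    then have "e \<odot>\<^bsub>S\<^esub> s = p (x \<otimes> e)" using Hom_act[OF p(1), of e x] by simp
    also have "\<dots> = \<zero>\<^bsub>S\<^esub>" using p(3)[of "x \<otimes> e"] mult_e_in_AeA[of x] M(2) x by auto
    finally show "e \<odot>\<^bsub>S\<^esub> s = \<zero>\<^bsub>S\<^esub>" .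
  qed
qed

end

text \<open>Each simple module contains a nonzero vector fixed by e, and such a vector generates it.
  Two of them, s and s', have the same annihilator, so s a |-> s' a is an isomorphism.\<close>

lemma (in local_corner) simple_modules_isomorphic:
  assumes full: "\<one> \<in> AeA" and S: "simple_module A S" and S': "simple_module A S'"
  shows "Iso A S S' \<noteq> {}"
proof -
  interpret L: nil_local_ring C by (rule C_local)
  have mod: "right_module A S" "right_module A S'"
    using S S' by (simp_all add: simple_module_def)
  have fixed: "\<exists>s\<in>carrier T. s \<noteq> \<zero>\<^bsub>T\<^esub> \<and> e \<odot>\<^bsub>T\<^esub> s = s" if T: "simple_module A T"
    for T :: "('c, 'x) module"
  proof -
    have modT: "right_module A T" using T by (simp add: simple_module_def)
    interpret T: right_module A T by (rule modT)
    obtain t where t: "t \<in> carrier T" "t \<noteq> \<zero>\<^bsub>T\<^esub>"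
      using T T.M.zero_closed by (auto simp: simple_module_def)
    \<comment> \<open>Otherwise t x e y = 0 for all x and y, so t A = 0 by fullness and t = t 1 =
      0.\<close>
    have "\<exists>x\<in>carrier A. e \<odot>\<^bsub>T\<^esub> (x \<odot>\<^bsub>T\<^esub> t) \<noteq> \<zero>\<^bsub>T\<^esub>"
    proof (rule ccontr)
      assume *: "\<not> ?thesis"
      have "a \<odot>\<^bsub>T\<^esub> t = \<zero>\<^bsub>T\<^esub>" if "a \<in> carrier A" for a
        using full that
      proof (induction rule: full_induct)
        case zero
        then show ?case using right_module_zero_act[OF modT t(1)] .
      next
        case (add x y z)
        then have "(x \<otimes> e \<otimes> y) \<odot>\<^bsub>T\<^esub> t = y \<odot>\<^bsub>T\<^esub> (e \<odot>\<^bsub>T\<^esub> (x \<odot>\<^bsub>T\<^esub> t))"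
          using t by (simp add: T.act_assoc T.act_closed)
        then show ?case
          using add * t right_module_act_zero[OF modT] by (simp add: T.act_add_left T.act_closed)
      qed
      then show False using t T.act_one by force
    qed
    then obtain x where x: "x \<in> carrier A" "e \<odot>\<^bsub>T\<^esub> (x \<odot>\<^bsub>T\<^esub> t) \<noteq> \<zero>\<^bsub>T\<^esub>" by auto
    let ?s = "e \<odot>\<^bsub>T\<^esub> (x \<odot>\<^bsub>T\<^esub> t)"
    have "e \<odot>\<^bsub>T\<^esub> ?s = ?s"
      using T.act_assoc[of e e "x \<odot>\<^bsub>T\<^esub> t"] x t by (simp add: T.act_closed)
    then show ?thesis using x t T.act_closed by (intro bexI[of _ ?s]) auto
  qed
  obtain s where s: "s \<in> carrier S" "s \<noteq> \<zero>\<^bsub>S\<^esub>" "e \<odot>\<^bsub>S\<^esub> s = s"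
    using fixed[OF S] by auto
  obtain s' where s': "s' \<in> carrier S'" "s' \<noteq> \<zero>\<^bsub>S'\<^esub>" "e \<odot>\<^bsub>S'\<^esub> s' = s'"
    using fixed[OF S'] by auto
  \<comment> \<open>the annihilators of \<open>s\<close> and \<open>s'\<close> agree, since \<open>eAe\<close> is local\<close>
  have ann: "a \<odot>\<^bsub>T'\<^esub> t' = \<zero>\<^bsub>T'\<^esub>"
    if T: "right_module A T" "t \<in> carrier T" "t \<noteq> \<zero>\<^bsub>T\<^esub>" "e \<odot>\<^bsub>T\<^esub> t = t"
      and T': "simple_module A T'" "t' \<in> carrier T'" "t' \<noteq> \<zero>\<^bsub>T'\<^esub>" "e \<odot>\<^bsub>T'\<^esub> t' = t'"
      and a: "a \<in> carrier A" "a \<odot>\<^bsub>T\<^esub> t = \<zero>\<^bsub>T\<^esub>"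
    for T :: "('c, 'x) module" and T' :: "('c, 'y) module" and t t' a
  proof (rule ccontr)
    assume nz: "a \<odot>\<^bsub>T'\<^esub> t' \<noteq> \<zero>\<^bsub>T'\<^esub>"
    have modT': "right_module A T'" using T' by (simp add: simple_module_def)
    interpret T: right_module A T by fact
    interpret T': right_module A T' by fact
    obtain b where b: "b \<in> carrier A" "t' = b \<odot>\<^bsub>T'\<^esub> (a \<odot>\<^bsub>T'\<^esub> t')"
      using simple_module_generated[OF T'(1) T'.act_closed[OF a(1) T'(2)] nz T'(2)] by auto
    \<comment> \<open>From t' = t' a b it follows that u = e a b e fixes t', while it kills t. Then
      e - u kills t' and is a nonunit, so u = e - (e - u) is a unit of the local ring eAe. But a
      unit cannot kill t.\<close>
    define u where "u = e \<otimes> (a \<otimes> b \<otimes> e)"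
    have u: "u \<in> carrier C" unfolding u_def using a b by (intro C_I) auto
    have uA: "u \<in> carrier A" using u by (rule C_closed)
    have ut': "u \<odot>\<^bsub>T'\<^esub> t' = t'"
      using a b T' by (simp add: u_def T'.act_assoc T'.act_closed flip: b(2))
    have ut: "u \<odot>\<^bsub>T\<^esub> t = \<zero>\<^bsub>T\<^esub>"
      using a b T right_module_act_zero[OF T(1)] by (simp add: u_def T.act_assoc T.act_closed)
    have "e \<ominus> u \<in> carrier C" using u C_minus[of e u] C.minus_closed[of e u] C.one_closed by simp
    moreover have "e \<ominus> u \<notin> Units C"
    proof
      assume "e \<ominus> u \<in> Units C"
      then obtain w where w: "w \<in> carrier C" "(e \<ominus> u) \<otimes> w = e"
        using C.Units_r_inv_ex[of "e \<ominus> u"] by auto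
      have "e \<odot>\<^bsub>T'\<^esub> t' = w \<odot>\<^bsub>T'\<^esub> ((e \<ominus> u) \<odot>\<^bsub>T'\<^esub> t')"
        using w uA C_closed T'(2) T'.act_assoc[of "e \<ominus> u" w t'] by simp
      also have "(e \<ominus> u) \<odot>\<^bsub>T'\<^esub> t' = \<zero>\<^bsub>T'\<^esub>"
        using right_module_diff_act[OF modT' e_closed uA T'(2)] ut' T'
        by (simp add: a_minus_def T'.M.r_neg)
      finally show False
        using T' right_module_act_zero[OF modT'] w C_closed by simp
    qed
    ultimately have "e \<ominus> (e \<ominus> u) \<in> Units C"
      using L.unit_one_minus[of "e \<ominus> u"] C_minus[of e "e \<ominus> u"] C.one_closed by simp
    moreover have "e \<ominus> (e \<ominus> u) = u"
      using uA by (simp add: a_minus_def minus_add r_neg2 r_neg1)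
    ultimately have "u \<in> Units C" by simp
    then obtain w where w: "w \<in> carrier C" "u \<otimes> w = e"
      using C.Units_r_inv_ex[of u] by auto
    have "t = (u \<otimes> w) \<odot>\<^bsub>T\<^esub> t" using w T by simp
    also have "\<dots> = w \<odot>\<^bsub>T\<^esub> (u \<odot>\<^bsub>T\<^esub> t)" using T.act_assoc[of u w t] uA w C_closed T by simp
    also have "\<dots> = \<zero>\<^bsub>T\<^esub>" using ut w C_closed right_module_act_zero[OF T(1)] by simp
    finally show False using T by simp
  qed
  interpret S: right_module A S by (rule mod)
  interpret S': right_module A S' by (rule mod)
  have ann_iff: "a \<odot>\<^bsub>S\<^esub> s = \<zero>\<^bsub>S\<^esub> \<longleftrightarrow> a \<odot>\<^bsub>S'\<^esub> s' = \<zero>\<^bsub>S'\<^esub>" if "a \<in> carrier A" for a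
    using ann[OF mod(1) s S' s' that] ann[OF mod(2) s' S s that] by blast
  have eq_iff: "a \<odot>\<^bsub>S\<^esub> s = b \<odot>\<^bsub>S\<^esub> s \<longleftrightarrow> a \<odot>\<^bsub>S'\<^esub> s' = b \<odot>\<^bsub>S'\<^esub> s'"
    if "a \<in> carrier A" "b \<in> carrier A" for a b
    using ann_iff[of "a \<ominus> b"] right_module_diff_act[OF mod(1) that s(1)]
      right_module_diff_act[OF mod(2) that s'(1)] that s s'
    by (simp add: S.act_closed S'.act_closed)
  define f where "f = (\<lambda>t\<in>carrier S. (SOME a. a \<in> carrier A \<and> t = a \<odot>\<^bsub>S\<^esub> s) \<odot>\<^bsub>S'\<^esub> s')"
  have f: "f (a \<odot>\<^bsub>S\<^esub> s) = a \<odot>\<^bsub>S'\<^esub> s'" if "a \<in> carrier A" for a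
  proof -
    let ?b = "SOME b. b \<in> carrier A \<and> a \<odot>\<^bsub>S\<^esub> s = b \<odot>\<^bsub>S\<^esub> s"
    have "?b \<in> carrier A \<and> a \<odot>\<^bsub>S\<^esub> s = ?b \<odot>\<^bsub>S\<^esub> s"
      by (rule someI[of "\<lambda>b. b \<in> carrier A \<and> a \<odot>\<^bsub>S\<^esub> s = b \<odot>\<^bsub>S\<^esub> s" a]) (simp add: that)
    then have "a \<odot>\<^bsub>S'\<^esub> s' = ?b \<odot>\<^bsub>S'\<^esub> s'" using eq_iff[of a ?b] that by simp
    then show ?thesis using that s by (simp add: f_def S.act_closed)
  qed
  have gen: "\<exists>a\<in>carrier A. t = a \<odot>\<^bsub>S\<^esub> s" if "t \<in> carrier S" for t
    by (rule simple_module_generated[OF S s(1,2) that])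
  have "f \<in> Hom A S S'"
  proof (rule HomI)
    show "f \<in> extensional (carrier S)" by (simp add: f_def)
    fix t assume "t \<in> carrier S"
    then obtain a where a: "a \<in> carrier A" "t = a \<odot>\<^bsub>S\<^esub> s" using gen by auto
    show "f t \<in> carrier S'" using f a s' by (simp add: S'.act_closed)
    show "f (b \<odot>\<^bsub>S\<^esub> t) = b \<odot>\<^bsub>S'\<^esub> f t" if "b \<in> carrier A" for b
      using f[of "a \<otimes> b"] f[of a] a s s' that by (simp add: S.act_assoc S'.act_assoc)
    show "f (t \<oplus>\<^bsub>S\<^esub> t') = f t \<oplus>\<^bsub>S'\<^esub> f t'" if "t' \<in> carrier S" for t'
    proof -
      obtain b where b: "b \<in> carrier A" "t' = b \<odot>\<^bsub>S\<^esub> s" using gen[OF \<open>t' \<in> carrier S\<close>] by auto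
      then show ?thesis
        using f[of "a \<oplus> b"] f[of a] f[of b] a s s' by (simp add: S.act_add_left S'.act_add_left)
    qed
  qed
  moreover have "bij_betw f (carrier S) (carrier S')"
  proof (rule bij_betw_imageI)
    show "inj_on f (carrier S)"
    proof (rule inj_onI)
      fix t t' assume *: "t \<in> carrier S" "t' \<in> carrier S" "f t = f t'"
      then obtain a b where "a \<in> carrier A" "t = a \<odot>\<^bsub>S\<^esub> s" "b \<in> carrier A" "t' = b \<odot>\<^bsub>S\<^esub> s"
        using gen by meson
      then show "t = t'" using * f eq_iff by simp
    qed
    show "f ` carrier S = carrier S'"
    proof
      show "f ` carrier S \<subseteq> carrier S'" using Hom_closed[OF \<open>f \<in> Hom A S S'\<close>] by blast
      show "carrier S' \<subseteq> f ` carrier S"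
      proof
        fix t assume "t \<in> carrier S'"
        then obtain a where a: "a \<in> carrier A" "t = a \<odot>\<^bsub>S'\<^esub> s'"
          using simple_module_generated[OF S' s'(1,2)] by auto
        then have "t = f (a \<odot>\<^bsub>S\<^esub> s)" using f by simp
        then show "t \<in> f ` carrier S" using a s S.act_closed by blast
      qed
    qed
  qed
  ultimately show ?thesis by (auto simp: Iso_def)
qed

lemma (in local_corner) full_if_unique_simple:
  assumes emb: "carrier A \<lesssim> (UNIV :: 'u set)" and fd: "fin_dim"
    and iso: "\<And>(S :: ('c, 'u) module) (T :: ('c, 'u) module). simple_module A S \<Longrightarrow> simple_module A T \<Longrightarrow> Iso A S T \<noteq> {}"
  shows "\<one> \<in> AeA"
proof (rule ccontr)
  assume "\<one> \<notin> AeA"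
  then obtain T :: "('c, 'u) module" where T: "simple_module A T"
    "\<And>t. t \<in> carrier T \<Longrightarrow> e \<odot>\<^bsub>T\<^esub> t = \<zero>\<^bsub>T\<^esub>"
    using ex_simple_annihilated[OF emb fd] by blast
  obtain S :: "('c, 'u) module" and p where S: "simple_module A S"
    and p: "p \<in> Hom A (ideal_module A eA) S" "p ` eA = carrier S"
      "\<And>x. x \<in> eA \<Longrightarrow> p x = \<zero>\<^bsub>S\<^esub> \<longleftrightarrow> x \<in> eJ"
    by (rule simple_top[OF emb]) (rule that)
  obtain f where f: "f \<in> Hom A S T" "bij_betw f (carrier S) (carrier T)"
    using iso[OF S T(1)] by (auto simp: Iso_def)
  have mod: "right_module A S" "right_module A T" using S T by (simp_all add: simple_module_def)
  interpret S: right_module A S by (rule mod)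
  have zero: "e \<odot>\<^bsub>S\<^esub> s = \<zero>\<^bsub>S\<^esub>" if "s \<in> carrier S" for s
  proof -
    have "f (e \<odot>\<^bsub>S\<^esub> s) = f \<zero>\<^bsub>S\<^esub>"
      using Hom_act[OF f(1), of e s] Hom_zero[OF mod f(1)] T(2) Hom_closed[OF f(1) that] that by simp
    then show ?thesis
      using f(2) that S.act_closed[of e s] S.M.zero_closed by (auto simp: bij_betw_def inj_on_def)
  qed
  \<comment> \<open>If e kills eA / eJ, every x a e lies in \<open>eJ\<close> and is a nonunit. So
    all of eA would be \<open>eJ\<close>.\<close>
  have "x \<in> eJ" if x: "x \<in> eA" for x
  proof (rule ccontr)
    assume xJ: "x \<notin> eJ"
    then obtain a where a: "a \<in> carrier A" "x \<otimes> a \<otimes> e \<in> Units C"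
      using x by (auto simp: eJ_def)
    have xa: "x \<otimes> a \<in> eA" by (rule right_ideal_mult[OF eA_right_ideal x a(1)])
    have xae: "x \<otimes> a \<otimes> e \<in> eA" by (rule right_ideal_mult[OF eA_right_ideal xa e_closed])
    have "p (x \<otimes> a \<otimes> e) = \<zero>\<^bsub>S\<^esub>"
      using Hom_act[OF p(1), of e "x \<otimes> a"] xa zero p(2) by auto
    then have "(x \<otimes> a \<otimes> e) \<otimes> \<one> \<otimes> e \<notin> Units C"
      using p(3)[OF xae] by (auto simp: eJ_def)
    then show False using a x by (auto simp: m_assoc eA_iff)
  qed
  then show False using eJ_less by blast
qed

section \<open>The trace modulo commutators\<close>

context assoc_algebra
begin

abbreviation K where "K \<equiv> commutator_space F A"

lemma K_span: "K = span {x \<otimes> y \<ominus> y \<otimes> x | x y. x \<in> carrier A \<and> y \<in> carrier A}"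
  by (simp add: commutator_space_def)

lemma commutators_closed: "{x \<otimes> y \<ominus> y \<otimes> x | x y. x \<in> carrier A \<and> y \<in> carrier A} \<subseteq> carrier A"
  by auto

lemma K_submodule: "submodule F K A"
  unfolding K_span by (rule span_is_submodule[OF commutators_closed])

lemma commutator_in_K: "x \<in> carrier A \<Longrightarrow> y \<in> carrier A \<Longrightarrow> x \<otimes> y \<ominus> y \<otimes> x \<in> K"
  unfolding K_span using in_own_span[OF commutators_closed] by blast

lemma K_least:
  assumes "submodule F N A" "\<And>x y. x \<in> carrier A \<Longrightarrow> y \<in> carrier A \<Longrightarrow> x \<otimes> y \<ominus> y \<otimes> x \<in> N"
  shows "K \<subseteq> N"
  unfolding K_span by (rule span_is_subset[OF _ assms(1)]) (use assms(2) in auto)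

lemma quotient_space_K: "quotient_space F A K"
  by (rule quotient_spaceI[OF vectorspace_axioms K_submodule])

lemma commutator_codim_commutative:
  assumes fd: "fin_dim" and comm: "\<And>a b. a \<in> carrier A \<Longrightarrow> b \<in> carrier A \<Longrightarrow> a \<otimes> b = b \<otimes> a"
  shows "commutator_codim F A = dim"
proof -
  have sub0: "submodule F {\<zero>} A" by unfold_locales auto
  have "K \<subseteq> {\<zero>}"
    by (rule K_least[OF sub0]) (simp add: comm)
  then have K0: "K = {\<zero>}" using submodule.zero_closed[OF K_submodule] by blast
  interpret Q: quotient_space F A "{\<zero>}" by (rule quotient_spaceI[OF vectorspace_axioms sub0])
  interpret p: linear_map F A Q.Q Q.proj
    by (intro linear_mapI vectorspace_axioms quotient_vectorspace sub0 Q.proj_hom)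
  have "vectorspace.dim F A = vectorspace.dim F Q.Q"
    by (rule p.dim_eq[OF fd]) (auto simp: inj_on_def Q.proj_eq_iff Q.Q_carrier)
  then show ?thesis by (simp add: commutator_codim_def K0)
qed

lemma add_minus_add: "\<lbrakk>x \<in> carrier A; y \<in> carrier A; z \<in> carrier A; w \<in> carrier A\<rbrakk>
    \<Longrightarrow> (x \<oplus> y) \<ominus> (z \<oplus> w) = (x \<ominus> z) \<oplus> (y \<ominus> w)"
  by (simp add: a_minus_def minus_add a_ac)

end

context idempotent_algebra
begin

text \<open>
  If \<open>a\<close> is the sum of elements \<open>x\<^sub>i e y\<^sub>i\<close>, then \<open>t w\<close> is the sum of the \<open>e y\<^sub>i w x\<^sub>i e\<close>. For
  \<open>a = 1\<close> it inverts the map \<open>eAe/K(eAe) \<rightarrow> A/K(A)\<close> induced by the inclusion.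
\<close>

lemma ex_trace:
  assumes full: "\<one> \<in> AeA" and a: "a \<in> carrier A"
  shows "\<exists>t. t \<in> LinearCombinations.module_hom F A C \<and>
    (\<forall>u\<in>carrier A. \<forall>v\<in>carrier A. t (u \<otimes> e \<otimes> v) \<ominus> e \<otimes> v \<otimes> a \<otimes> u \<otimes> e \<in> C.K)"
  using full a
proof (induction rule: full_induct)
  case zero
  interpret KC: quotient_space F C C.K by (rule C.quotient_space_K)
  show ?case
    by (rule exI[of _ "\<lambda>_. \<zero>"])
      (use KC.W_zero in \<open>auto simp: LinearCombinations.module_hom_def a_minus_def C_iff\<close>)
next
  case (add x y z)
  interpret KC: quotient_space F C C.K by (rule C.quotient_space_K)
  obtain t where t: "t \<in> LinearCombinations.module_hom F A C"
    and tK: "\<And>u v. u \<in> carrier A \<Longrightarrow> v \<in> carrier A \<Longrightarrow>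
      t (u \<otimes> e \<otimes> v) \<ominus> e \<otimes> v \<otimes> z \<otimes> u \<otimes> e \<in> C.K"
    using add.IH by auto
  have tC: "t w \<in> carrier C" if "w \<in> carrier A" for w
    using module_hom_closed[OF t] that by auto
  have eC: "e \<otimes> w \<otimes> e \<in> carrier C" if "w \<in> carrier A" for w
    using that by (simp add: C_iff m_assoc)
  define t' where "t' w = e \<otimes> (y \<otimes> w \<otimes> x) \<otimes> e \<oplus> t w" for w
  have "t' \<in> LinearCombinations.module_hom F A C"
    unfolding LinearCombinations.module_hom_def
  proof (intro CollectI conjI allI impI)
    show "t' \<in> carrier A \<rightarrow> carrier C"
      using add.hyps C.a_closed[OF eC tC] by (auto simp: t'_def)
    show "t' (v \<oplus> w) = t' v \<oplus>\<^bsub>C\<^esub> t' w" if "v \<in> carrier A \<and> w \<in> carrier A" for v w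
      using that add.hyps tC C_closed module_hom_add[OF t, of v w]
      by (simp add: t'_def r_distr l_distr a_ac)
    show "t' (c \<odot> w) = c \<odot>\<^bsub>C\<^esub> t' w" if "c \<in> carrier F \<and> w \<in> carrier A" for c w
      using that add.hyps tC C_closed module_hom_smult[OF t, of c w]
      by (simp add: t'_def smult_mult_left smult_mult_right smult_r_distr)
  qed
  moreover have "t' (u \<otimes> e \<otimes> v) \<ominus> e \<otimes> v \<otimes> (x \<otimes> e \<otimes> y \<oplus> z) \<otimes> u \<otimes> e \<in> C.K"
    if uv: "u \<in> carrier A" "v \<in> carrier A" for u v
  proof -
    \<comment> \<open>The term x e y of a contributes e y (u e v) x e = g h to the trace, whereas e
      v (x e y) u e = h g is wanted. The difference is a commutator in eAe.\<close>
    let ?g = "e \<otimes> (y \<otimes> u) \<otimes> e" and ?h = "e \<otimes> (v \<otimes> x) \<otimes> e"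
    have gh: "?g \<in> carrier C" "?h \<in> carrier C" using uv add.hyps by (auto intro!: eC)
    have 1: "?g \<otimes> ?h = e \<otimes> (y \<otimes> (u \<otimes> e \<otimes> v) \<otimes> x) \<otimes> e"
      "?h \<otimes> ?g = e \<otimes> v \<otimes> (x \<otimes> e \<otimes> y) \<otimes> u \<otimes> e"
      using uv add.hyps by (simp_all add: m_assoc)
    have "t' (u \<otimes> e \<otimes> v) \<ominus> e \<otimes> v \<otimes> (x \<otimes> e \<otimes> y \<oplus> z) \<otimes> u \<otimes> e =
      (?g \<otimes> ?h \<oplus> t (u \<otimes> e \<otimes> v)) \<ominus> (?h \<otimes> ?g \<oplus> e \<otimes> v \<otimes> z \<otimes> u \<otimes> e)"
      unfolding 1 t'_def using uv add.hyps by (simp add: r_distr l_distr)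
    also have "\<dots> = (?g \<otimes> ?h \<ominus> ?h \<otimes> ?g) \<oplus> (t (u \<otimes> e \<otimes> v) \<ominus> e \<otimes> v \<otimes> z \<otimes> u \<otimes> e)"
      using uv add.hyps tC C_closed by (intro add_minus_add) auto
    also have "\<dots> \<in> C.K"
    proof -
      have "?g \<otimes> ?h \<ominus> ?h \<otimes> ?g \<in> C.K"
        using C.commutator_in_K[OF gh] C_minus C.m_closed[OF gh] C.m_closed[OF gh(2,1)] by simp
      then show ?thesis using KC.W_add tK[OF uv] by simp
    qed
    finally show ?thesis .
  qed
  ultimately show ?case by blast
qed

theorem commutator_codim_corner:
  assumes full: "\<one> \<in> AeA" and fd: "fin_dim"
  shows "commutator_codim F C = commutator_codim F A"
  unfolding commutator_codim_def
proof (rule quotient_dim_eq[where T = "\<lambda>x. x"])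
  interpret KC: quotient_space F C C.K by (rule C.quotient_space_K)
  interpret KA: quotient_space F A K by (rule quotient_space_K)
  show "vectorspace F C" "vectorspace F A" by unfold_locales
  show "submodule F C.K C" "submodule F K A" by (rule C.K_submodule K_submodule)+
  show "C.fin_dim" by (rule C_fin_dim[OF fd])
  show "(\<lambda>x. x) \<in> LinearCombinations.module_hom F C A"
    by (auto simp: LinearCombinations.module_hom_def C_closed)
  have CK: "C.K \<subseteq> K"
  proof -
    have "submodule F (K \<inter> carrier C) C"
      by unfold_locales (use KA.W_add KA.W_smult KA.W_zero C.smult_closed C.a_closed C.zero_closed in auto)
    then have "C.K \<subseteq> K \<inter> carrier C"
    proof (rule C.K_least)
      fix x y assume xy: "x \<in> carrier C" "y \<in> carrier C"
      then have "x \<otimes> y \<ominus> y \<otimes> x \<in> K" by (intro commutator_in_K C_closed)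
      then show "x \<otimes>\<^bsub>C\<^esub> y \<ominus>\<^bsub>C\<^esub> y \<otimes>\<^bsub>C\<^esub> x \<in> K \<inter> carrier C"
        using xy C.minus_closed[OF C.m_closed[OF xy] C.m_closed[OF xy(2,1)]]
          C_minus[OF C.m_closed[OF xy] C.m_closed[OF xy(2,1)]] by simp
    qed
    then show ?thesis by blast
  qed
  obtain t where t: "t \<in> LinearCombinations.module_hom F A C"
    and tK: "\<And>u v. u \<in> carrier A \<Longrightarrow> v \<in> carrier A \<Longrightarrow>
      t (u \<otimes> e \<otimes> v) \<ominus> e \<otimes> v \<otimes> \<one> \<otimes> u \<otimes> e \<in> C.K"
    using ex_trace[OF full one_closed] by auto
  interpret t: linear_map F A C t
    by (rule linear_mapI[OF vectorspace_axioms C.vectorspace_axioms t])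
  have tC: "t w \<in> carrier C" if "w \<in> carrier A" for w
    using module_hom_closed[OF t] that by auto
  have t_comm: "t (x \<otimes> y \<ominus> y \<otimes> x) \<in> C.K" if x: "x \<in> carrier A" and y: "y \<in> carrier A" for x y
    using full y
  proof (induction rule: full_induct)
    case zero
    then show ?case using x KC.W_zero t.f0_is_0 by (simp add: a_minus_def)
  next
    case (add u v z)
    \<comment> \<open>For y = u e v the products x y = (x u) e v and y x = u e (v x) both have trace
      e v x u e modulo K(eAe).\<close>
    let ?w = "e \<otimes> (v \<otimes> x \<otimes> u) \<otimes> e"
    have w: "?w \<in> carrier A" using add.hyps x by simp
    have "t ((x \<otimes> u) \<otimes> e \<otimes> v) \<ominus> ?w \<in> C.K" "t (u \<otimes> e \<otimes> (v \<otimes> x)) \<ominus> ?w \<in> C.K"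
      using tK[of "x \<otimes> u" v] tK[of u "v \<otimes> x"] add.hyps x by (simp_all add: m_assoc)
    then have "(t ((x \<otimes> u) \<otimes> e \<otimes> v) \<ominus> ?w) \<ominus>\<^bsub>C\<^esub> (t (u \<otimes> e \<otimes> (v \<otimes> x)) \<ominus> ?w) \<in> C.K"
      by (rule KC.W_minus)
    moreover have "(p \<ominus> ?w) \<ominus> (q \<ominus> ?w) = p \<ominus> q" if "p \<in> carrier A" "q \<in> carrier A" for p q
      using add_minus_add_cancel[of p q "\<ominus> ?w"] w that by (simp add: a_minus_def)
    ultimately have *: "t ((x \<otimes> u) \<otimes> e \<otimes> v) \<ominus> t (u \<otimes> e \<otimes> (v \<otimes> x)) \<in> C.K"
      using tC C_closed add.hyps x C_minus KC.W_closed
        \<open>t ((x \<otimes> u) \<otimes> e \<otimes> v) \<ominus> ?w \<in> C.K\<close> \<open>t (u \<otimes> e \<otimes> (v \<otimes> x)) \<ominus> ?w \<in> C.K\<close> by simp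
    have "x \<otimes> (u \<otimes> e \<otimes> v \<oplus> z) \<ominus> (u \<otimes> e \<otimes> v \<oplus> z) \<otimes> x =
      ((x \<otimes> u) \<otimes> e \<otimes> v \<ominus> u \<otimes> e \<otimes> (v \<otimes> x)) \<oplus> (x \<otimes> z \<ominus> z \<otimes> x)"
      using add_minus_add[of "x \<otimes> u \<otimes> e \<otimes> v" "x \<otimes> z" "u \<otimes> e \<otimes> (v \<otimes> x)" "z \<otimes> x"] add.hyps x
      by (simp add: r_distr l_distr m_assoc)
    then have "t (x \<otimes> (u \<otimes> e \<otimes> v \<oplus> z) \<ominus> (u \<otimes> e \<otimes> v \<oplus> z) \<otimes> x) =
      (t ((x \<otimes> u) \<otimes> e \<otimes> v) \<ominus>\<^bsub>C\<^esub> t (u \<otimes> e \<otimes> (v \<otimes> x))) \<oplus>\<^bsub>C\<^esub> t (x \<otimes> z \<ominus> z \<otimes> x)"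
      using add.hyps x by (simp add: t.f_add t.f_minus del: corner_simps)
    then show ?case
      using * add.IH KC.W_add C_minus tC add.hyps x by simp
  qed
  have "submodule F {w \<in> carrier A. t w \<in> C.K} A"
    by unfold_locales
      (use KC.W_zero KC.W_add KC.W_smult t.f_add t.f_smult t.f0_is_0 in \<open>auto\<close>)
  then have KA_t: "K \<subseteq> {w \<in> carrier A. t w \<in> C.K}"
    by (rule K_least) (use t_comm in auto)
  \<comment> \<open>The trace maps K(A) into K(eAe), and on eAe it is the identity modulo K(eAe), as
    one sees by writing x = x e e.\<close>
  show "x \<in> K \<longleftrightarrow> x \<in> C.K" if x: "x \<in> carrier C" for x
  proof
    assume "x \<in> K"
    then have "t x \<in> C.K" using KA_t by auto
    moreover have "t x \<ominus> x \<in> C.K"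
      using tK[of x e] x C_closed[OF x] by (simp add: C_left C_right m_assoc)
    ultimately have "t x \<ominus>\<^bsub>C\<^esub> (t x \<ominus>\<^bsub>C\<^esub> x) \<in> C.K"
      using KC.W_minus C_minus[OF tC x] C_closed[OF x] by simp
    moreover have "t x \<ominus>\<^bsub>C\<^esub> (t x \<ominus>\<^bsub>C\<^esub> x) = x"
      using C_closed[OF tC[OF C_closed[OF x]]] C_closed[OF x] C_minus[OF tC[OF C_closed[OF x]]] x
        C_minus[OF tC[OF C_closed[OF x]] x] C.minus_closed[OF tC[OF C_closed[OF x]] x]
      by (simp add: a_minus_def minus_add r_neg1 r_neg2)
    ultimately show "x \<in> C.K" by simp
  qed (use CK in auto)
  show "\<exists>x\<in>carrier C. x \<ominus> y \<in> K" if y: "y \<in> carrier A" for y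
    using full y
  proof (induction rule: full_induct)
    case zero
    then show ?case using KA.W_zero by (intro bexI[of _ \<zero>]) (auto simp: C_iff a_minus_def)
  next
    case (add x y z)
    then obtain b where b: "b \<in> carrier C" "b \<ominus> z \<in> K" by auto
    \<comment> \<open>Modulo K(A), x e y = (x e)(e y) agrees with (e y)(x e), which lies in
      eAe.\<close>
    have "(e \<otimes> y) \<otimes> (x \<otimes> e) \<ominus> (x \<otimes> e) \<otimes> (e \<otimes> y) \<in> K"
      using add.hyps by (intro commutator_in_K) auto
    then have "e \<otimes> (y \<otimes> x \<otimes> e) \<ominus> x \<otimes> e \<otimes> y \<in> K"
      using add.hyps by (simp add: m_assoc)
    then have "(e \<otimes> (y \<otimes> x \<otimes> e) \<oplus> b) \<ominus> (x \<otimes> e \<otimes> y \<oplus> z) \<in> K"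
      using add_minus_add[of "e \<otimes> (y \<otimes> x \<otimes> e)" b "x \<otimes> e \<otimes> y" z] add.hyps b C_closed KA.W_add by simp
    moreover have "e \<otimes> (y \<otimes> x \<otimes> e) \<oplus> b \<in> carrier C"
      using C.a_closed[OF C_I b(1)] add.hyps by simp
    ultimately show ?case by blast
  qed
qed

end

section \<open>Dual numbers\<close>

text \<open>Algebras with a basis 1, x where x^2 = 0. Being free of polynomials, the description is
  met by eAe as well as by F[X]/(X^2), and any two instances are isomorphic
  (\<open>dual_numbers_isomorphic\<close>).\<close>

locale dual_numbers = assoc_algebra F B for F and B (structure) +
  fixes x
  assumes x_closed [simp]: "x \<in> carrier B" and x_square [simp]: "x \<otimes> x = \<zero>"
    and repr: "b \<in> carrier B \<Longrightarrow> \<exists>\<alpha>\<in>carrier F. \<exists>\<beta>\<in>carrier F. b = \<alpha> \<odot> \<one> \<oplus> \<beta> \<odot> x"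
    and indep: "\<lbrakk>\<alpha> \<in> carrier F; \<beta> \<in> carrier F; \<alpha> \<odot> \<one> \<oplus> \<beta> \<odot> x = \<zero>\<rbrakk>
      \<Longrightarrow> \<alpha> = \<zero>\<^bsub>F\<^esub> \<and> \<beta> = \<zero>\<^bsub>F\<^esub>"
begin

definition el where "el \<alpha> \<beta> = \<alpha> \<odot> \<one> \<oplus> \<beta> \<odot> x"

lemma el_closed [simp]: "\<alpha> \<in> carrier F \<Longrightarrow> \<beta> \<in> carrier F \<Longrightarrow> el \<alpha> \<beta> \<in> carrier B"
  by (simp add: el_def)

lemma el_cases:
  assumes "b \<in> carrier B"
  obtains \<alpha> \<beta> where "\<alpha> \<in> carrier F" "\<beta> \<in> carrier F" "b = el \<alpha> \<beta>"
  using repr[OF assms] by (auto simp: el_def)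

lemma el_add:
  assumes "\<alpha> \<in> carrier F" "\<beta> \<in> carrier F" "\<gamma> \<in> carrier F" "\<delta> \<in> carrier F"
  shows "el \<alpha> \<beta> \<oplus> el \<gamma> \<delta> = el (\<alpha> \<oplus>\<^bsub>F\<^esub> \<gamma>) (\<beta> \<oplus>\<^bsub>F\<^esub> \<delta>)"
  using assms by (simp add: el_def smult_l_distr a_ac)

lemma el_smult:
  assumes "\<alpha> \<in> carrier F" "\<beta> \<in> carrier F" "c \<in> carrier F"
  shows "c \<odot> el \<alpha> \<beta> = el (c \<otimes>\<^bsub>F\<^esub> \<alpha>) (c \<otimes>\<^bsub>F\<^esub> \<beta>)"
  using assms by (simp add: el_def smult_r_distr smult_assoc1)

lemma el_mult:
  assumes "\<alpha> \<in> carrier F" "\<beta> \<in> carrier F" "\<gamma> \<in> carrier F" "\<delta> \<in> carrier F"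
  shows "el \<alpha> \<beta> \<otimes> el \<gamma> \<delta> = el (\<alpha> \<otimes>\<^bsub>F\<^esub> \<gamma>) (\<alpha> \<otimes>\<^bsub>F\<^esub> \<delta> \<oplus>\<^bsub>F\<^esub> \<beta> \<otimes>\<^bsub>F\<^esub> \<gamma>)"
proof -
  have "x \<otimes> (\<gamma> \<odot> \<one>) = \<gamma> \<odot> x" "x \<otimes> (\<delta> \<odot> x) = \<zero>"
    using assms by (simp_all add: smult_mult_right)
  then show ?thesis
    using assms
    by (simp add: el_def l_distr r_distr smult_mult_left smult_l_distr smult_r_distr
        smult_assoc1 a_ac)
qed

lemma el_one: "\<one> = el \<one>\<^bsub>F\<^esub> \<zero>\<^bsub>F\<^esub>"
  by (simp add: el_def)

lemma el_inj:
  assumes "\<alpha> \<in> carrier F" "\<beta> \<in> carrier F" "\<gamma> \<in> carrier F" "\<delta> \<in> carrier F"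
    "el \<alpha> \<beta> = el \<gamma> \<delta>"
  shows "\<alpha> = \<gamma> \<and> \<beta> = \<delta>"
proof -
  have neg: "el (\<ominus>\<^bsub>F\<^esub> \<gamma>) (\<ominus>\<^bsub>F\<^esub> \<delta>) \<oplus> el \<gamma> \<delta> = \<zero>"
    using assms by (simp add: el_add R.l_neg) (simp add: el_def)
  then have "el (\<ominus>\<^bsub>F\<^esub> \<gamma> \<oplus>\<^bsub>F\<^esub> \<alpha>) (\<ominus>\<^bsub>F\<^esub> \<delta> \<oplus>\<^bsub>F\<^esub> \<beta>) = \<zero>"
    using assms by (simp flip: el_add)
  then have "\<ominus>\<^bsub>F\<^esub> \<gamma> \<oplus>\<^bsub>F\<^esub> \<alpha> = \<zero>\<^bsub>F\<^esub>" "\<ominus>\<^bsub>F\<^esub> \<delta> \<oplus>\<^bsub>F\<^esub> \<beta> = \<zero>\<^bsub>F\<^esub>"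
    using indep[of "\<ominus>\<^bsub>F\<^esub> \<gamma> \<oplus>\<^bsub>F\<^esub> \<alpha>" "\<ominus>\<^bsub>F\<^esub> \<delta> \<oplus>\<^bsub>F\<^esub> \<beta>"] assms by (auto simp: el_def)
  then show ?thesis
    using assms R.minus_equality[of \<alpha> "\<ominus>\<^bsub>F\<^esub> \<gamma>"] R.minus_equality[of \<beta> "\<ominus>\<^bsub>F\<^esub> \<delta>"]
    by (metis R.add.inv_closed R.minus_equality R.minus_minus)
qed

lemma commute: "a \<in> carrier B \<Longrightarrow> b \<in> carrier B \<Longrightarrow> a \<otimes> b = b \<otimes> a"
  by (elim el_cases) (simp add: el_mult R.m_comm R.a_comm)

text \<open>For b = \<alpha> + \<beta> x this reads \<alpha>^2 = \<alpha> and 2 \<alpha> \<beta> =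
  \<beta>. Both \<alpha> = 0 and \<alpha> = 1 force \<beta> = 0, in every characteristic.\<close>

lemma idempotent_trivial:
  assumes "b \<in> carrier B" "b \<otimes> b = b"
  shows "b = \<zero> \<or> b = \<one>"
proof -
  obtain \<alpha> \<beta> where ab: "\<alpha> \<in> carrier F" "\<beta> \<in> carrier F" "b = el \<alpha> \<beta>"
    using el_cases assms by blast
  then have *: "\<alpha> \<otimes>\<^bsub>F\<^esub> \<alpha> = \<alpha>" "\<alpha> \<otimes>\<^bsub>F\<^esub> \<beta> \<oplus>\<^bsub>F\<^esub> \<beta> \<otimes>\<^bsub>F\<^esub> \<alpha> = \<beta>"
    using el_inj[of "\<alpha> \<otimes>\<^bsub>F\<^esub> \<alpha>" "\<alpha> \<otimes>\<^bsub>F\<^esub> \<beta> \<oplus>\<^bsub>F\<^esub> \<beta> \<otimes>\<^bsub>F\<^esub> \<alpha>" \<alpha> \<beta>] assms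
    by (simp_all add: el_mult)
  show ?thesis
  proof (cases "\<alpha> = \<zero>\<^bsub>F\<^esub>")
    case True
    then have "\<beta> = \<zero>\<^bsub>F\<^esub>" using * ab by simp
    then show ?thesis using ab True by (simp add: el_def)
  next
    case False
    then have "\<alpha> \<in> Units F" using ab field_Units by simp
    then have "\<alpha> = \<one>\<^bsub>F\<^esub>"
      using *(1) ab R.Units_l_cancel[of \<alpha> \<alpha> "\<one>\<^bsub>F\<^esub>"] by simp
    moreover from this have "\<beta> = \<zero>\<^bsub>F\<^esub>" using *(2) ab R.add.l_cancel_one'[of \<beta> \<beta>] by simp
    ultimately show ?thesis using ab by (simp add: el_one)
  qed
qed

text \<open>This places a copy of the regular B-module in the universe.\<close>

lemma dual_numbers_lepoll:
  assumes "infinite (UNIV :: 'u set)" "carrier F \<lesssim> (UNIV :: 'u set)"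
  shows "carrier B \<lesssim> (UNIV :: 'u set)"
proof -
  have "carrier B \<subseteq> (\<lambda>(\<alpha>, \<beta>). el \<alpha> \<beta>) ` (carrier F \<times> carrier F)"
    by (auto elim!: el_cases)
  then have "carrier B \<lesssim> carrier F \<times> carrier F"
    by (meson image_lepoll lepoll_trans subset_imp_lepoll)
  also have "\<dots> \<lesssim> (UNIV :: 'u set) \<times> (UNIV :: 'u set)"
    by (intro times_lepoll_mono assms)
  also have "\<dots> \<approx> (UNIV :: 'u set)"
    using card_of_Times_same_infinite[OF assms(1)]
    by (simp add: eqpoll_iff_card_of_ordIso)
  finally show ?thesis
    by (meson eqpoll_imp_lepoll lepoll_trans)
qed

end

definition algebra_isos ::
  "('f, 'r) ring_scheme \<Rightarrow> ('f, 'b, 's) module_scheme \<Rightarrow> ('f, 'c, 't) module_scheme \<Rightarrow> ('b \<Rightarrow> 'c) set"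
  where "algebra_isos F B B' = {g \<in> ring_hom B B'. bij_betw g (carrier B) (carrier B') \<and>
    (\<forall>c\<in>carrier F. \<forall>b\<in>carrier B. g (c \<odot>\<^bsub>B\<^esub> b) = c \<odot>\<^bsub>B'\<^esub> g b)}"

lemma dual_numbers_isomorphic:
  assumes "dual_numbers F B x" "dual_numbers F B' x'"
  shows "algebra_isos F B B' \<noteq> {}"
proof -
  interpret B: dual_numbers F B x by fact
  interpret B': dual_numbers F B' x' by fact
  define g where "g b = (case SOME (\<alpha>, \<beta>). \<alpha> \<in> carrier F \<and> \<beta> \<in> carrier F \<and> b = B.el \<alpha> \<beta>
    of (\<alpha>, \<beta>) \<Rightarrow> B'.el \<alpha> \<beta>)" for b
  have g: "g (B.el \<alpha> \<beta>) = B'.el \<alpha> \<beta>" if ab: "\<alpha> \<in> carrier F" "\<beta> \<in> carrier F" for \<alpha> \<beta>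
  proof -
    let ?P = "\<lambda>(\<gamma>, \<delta>). \<gamma> \<in> carrier F \<and> \<delta> \<in> carrier F \<and> B.el \<alpha> \<beta> = B.el \<gamma> \<delta>"
    have P: "?P (Eps ?P)" by (rule someI[of ?P "(\<alpha>, \<beta>)"]) (simp add: ab)
    obtain \<gamma> \<delta> where eps: "Eps ?P = (\<gamma>, \<delta>)" by (rule prod.exhaust)
    have *: "\<gamma> \<in> carrier F" "\<delta> \<in> carrier F" "B.el \<alpha> \<beta> = B.el \<gamma> \<delta>"
      using P unfolding eps by simp_all
    have "g (B.el \<alpha> \<beta>) = B'.el \<gamma> \<delta>" unfolding g_def eps by simp
    moreover have "\<alpha> = \<gamma> \<and> \<beta> = \<delta>" by (rule B.el_inj[OF ab *])
    ultimately show ?thesis by simp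
  qed
  have "g \<in> ring_hom B B'"
  proof (rule ring_hom_memI)
    fix b assume b: "b \<in> carrier B"
    show "g b \<in> carrier B'" using b by (elim B.el_cases) (simp add: g)
    fix c assume c: "c \<in> carrier B"
    show "g (b \<otimes>\<^bsub>B\<^esub> c) = g b \<otimes>\<^bsub>B'\<^esub> g c"
      using b c by (elim B.el_cases) (simp add: g B.el_mult B'.el_mult)
    show "g (b \<oplus>\<^bsub>B\<^esub> c) = g b \<oplus>\<^bsub>B'\<^esub> g c"
      using b c by (elim B.el_cases) (simp add: g B.el_add B'.el_add)
  qed (simp add: B.el_one B'.el_one g)
  moreover have "bij_betw g (carrier B) (carrier B')"
  proof (rule bij_betw_imageI)
    show "inj_on g (carrier B)"
    proof (rule inj_onI)
      fix b c assume bc: "b \<in> carrier B" "c \<in> carrier B" "g b = g c"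
      obtain \<alpha> \<beta> where b: "\<alpha> \<in> carrier F" "\<beta> \<in> carrier F" "b = B.el \<alpha> \<beta>"
        by (rule B.el_cases[OF bc(1)])
      obtain \<gamma> \<delta> where c: "\<gamma> \<in> carrier F" "\<delta> \<in> carrier F" "c = B.el \<gamma> \<delta>"
        by (rule B.el_cases[OF bc(2)])
      have "B'.el \<alpha> \<beta> = B'.el \<gamma> \<delta>" using bc(3) b c by (simp add: g)
      then show "b = c" using B'.el_inj[OF b(1,2) c(1,2)] b c by simp
    qed
    show "g ` carrier B = carrier B'"
    proof
      show "carrier B' \<subseteq> g ` carrier B"
      proof
        fix b assume "b \<in> carrier B'"
        then obtain \<alpha> \<beta> where "\<alpha> \<in> carrier F" "\<beta> \<in> carrier F" "b = B'.el \<alpha> \<beta>"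
          by (rule B'.el_cases)
        then show "b \<in> g ` carrier B"
          by (intro image_eqI[of _ _ "B.el \<alpha> \<beta>"]) (simp_all add: g)
      qed
      show "g ` carrier B \<subseteq> carrier B'"
        by (auto elim!: B.el_cases simp: g)
    qed
  qed
  moreover have "g (c \<odot>\<^bsub>B\<^esub> b) = c \<odot>\<^bsub>B'\<^esub> g b" if "c \<in> carrier F" "b \<in> carrier B" for c b
    using that(2) by (elim B.el_cases) (simp add: g that(1) B.el_smult B'.el_smult)
  ultimately show ?thesis by (auto simp: algebra_isos_def)
qed

section \<open>Local algebras with two-dimensional commutator quotient\<close>

locale split_local_algebra = assoc_algebra F A + nil_local_ring A for F and A (structure) +
  assumes fd: "fin_dim"
    and residue: "b \<in> carrier A \<Longrightarrow> \<exists>c\<in>carrier F. b \<ominus> c \<odot> \<one> \<notin> Units A"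
begin

definition J where "J = {b \<in> carrier A. b \<notin> Units A}"

lemma J_closed: "b \<in> J \<Longrightarrow> b \<in> carrier A"
  by (simp add: J_def)

lemma J_right_ideal: "right_ideal A J"
  by (rule right_idealI) (auto simp: J_def zero_nonunit nonunit_add nonunit_mult)

lemma scalar_unit:
  assumes "c \<in> carrier F" "c \<noteq> \<zero>\<^bsub>F\<^esub>"
  shows "c \<odot> \<one> \<in> Units A"
proof -
  have c: "c \<in> Units F" using assms field_Units by simp
  let ?d = "inv\<^bsub>F\<^esub> c"
  have d: "?d \<in> carrier F" using c by simp
  have "(c \<odot> \<one>) \<otimes> (?d \<odot> \<one>) = \<one>" "(?d \<odot> \<one>) \<otimes> (c \<odot> \<one>) = \<one>"
    using assms c d by (simp_all add: smult_one_mult flip: smult_assoc1)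
  then show ?thesis using assms d by (auto simp: Units_def)
qed

lemma scalar_in_J: "c \<in> carrier F \<Longrightarrow> c \<odot> \<one> \<in> J \<Longrightarrow> c = \<zero>\<^bsub>F\<^esub>"
  using scalar_unit by (auto simp: J_def)

lemma scalar_decomp:
  assumes "b \<in> carrier A"
  obtains c j where "c \<in> carrier F" "j \<in> J" "b = c \<odot> \<one> \<oplus> j"
proof -
  obtain c where c: "c \<in> carrier F" "b \<ominus> c \<odot> \<one> \<in> J"
    using residue[OF assms] assms by (auto simp: J_def)
  moreover have "b = c \<odot> \<one> \<oplus> (b \<ominus> c \<odot> \<one>)"
    using assms c by (simp add: a_minus_def a_ac r_neg)
  ultimately show thesis using that by blast
qed

text \<open>Elements have the form c 1 + i with i in J by \<open>scalar_decomp\<close>. Scalars are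
  central, so [c 1 + i, d 1 + j] = [i, j], and commutators come from products in J.\<close>

lemma K_subset:
  assumes "right_ideal A R" and JJ: "\<And>i j. i \<in> J \<Longrightarrow> j \<in> J \<Longrightarrow> i \<otimes> j \<in> R"
  shows "K \<subseteq> R"
proof (rule K_least[OF right_ideal_submodule[OF assms(1)]])
  have scalar: "(c \<odot> \<one> \<oplus> i) \<otimes> y \<ominus> y \<otimes> (c \<odot> \<one> \<oplus> i) = i \<otimes> y \<ominus> y \<otimes> i"
    if "c \<in> carrier F" "i \<in> carrier A" "y \<in> carrier A" for c i y
    using that add_minus_add_cancel[of "i \<otimes> y" "y \<otimes> i" "c \<odot> y"]
    by (simp add: l_distr r_distr smult_one_mult a_comm)
  have scalar': "y \<otimes> (c \<odot> \<one> \<oplus> i) \<ominus> (c \<odot> \<one> \<oplus> i) \<otimes> y = y \<otimes> i \<ominus> i \<otimes> y"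
    if "c \<in> carrier F" "i \<in> carrier A" "y \<in> carrier A" for c i y
    using that add_minus_add_cancel[of "y \<otimes> i" "i \<otimes> y" "c \<odot> y"]
    by (simp add: l_distr r_distr smult_one_mult a_comm)
  fix x y assume "x \<in> carrier A" "y \<in> carrier A"
  then obtain c i d j where "c \<in> carrier F" "i \<in> J" "x = c \<odot> \<one> \<oplus> i"
    "d \<in> carrier F" "j \<in> J" "y = d \<odot> \<one> \<oplus> j"
    by (metis scalar_decomp)
  then have "x \<otimes> y \<ominus> y \<otimes> x = i \<otimes> j \<ominus> j \<otimes> i"
    using scalar[of c i y] scalar'[of d j i] J_closed \<open>y \<in> carrier A\<close> by simp
  then show "x \<otimes> y \<ominus> y \<otimes> x \<in> R"
    using JJ \<open>i \<in> J\<close> \<open>j \<in> J\<close> right_ideal_minus[OF assms(1)] by simp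
qed

lemma K_subset_J: "K \<subseteq> J"
  by (rule K_subset[OF J_right_ideal]) (auto intro: right_ideal_mult[OF J_right_ideal] J_closed)

lemma one_not_in_J: "\<one> \<notin> J"
  by (simp add: J_def)

text \<open>
  Nakayama's lemma: a maximal proper right subideal \<open>R\<close> of \<open>J\<close> contains \<open>J\<^sup>2\<close>.
\<close>

lemma J_eq_principal:
  assumes x: "x \<in> J" and gen: "\<And>b. b \<in> J \<Longrightarrow> \<exists>\<beta>\<in>carrier F. b \<ominus> \<beta> \<odot> x \<in> K"
  shows "J = (\<lambda>a. x \<otimes> a) ` carrier A"
proof (rule ccontr)
  assume ne: "J \<noteq> (\<lambda>a. x \<otimes> a) ` carrier A"
  have xA: "right_ideal A ((\<lambda>a. x \<otimes> a) ` carrier A)"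
    by (rule right_ideal_image[OF J_closed[OF x]])
  have sub: "(\<lambda>a. x \<otimes> a) ` carrier A \<subseteq> J"
    using right_ideal_mult[OF J_right_ideal x] by auto
  have JA: "J \<subseteq> carrier A" using J_closed by auto
  obtain R where R: "right_ideal A R" "(\<lambda>a. x \<otimes> a) ` carrier A \<subseteq> R" "R \<subset> J"
    "\<And>N. right_ideal A N \<Longrightarrow> R \<subseteq> N \<Longrightarrow> N \<subset> J \<Longrightarrow> N = R"
    by (rule ex_maximal_right_ideal[OF fd xA sub JA ne[symmetric]]) (rule that)
  have RA: "r \<in> carrier A" if "r \<in> R" for r using that R(3) JA by auto
  have R0: "\<zero> \<in> R" and Radd: "\<And>r s. r \<in> R \<Longrightarrow> s \<in> R \<Longrightarrow> r \<oplus> s \<in> R"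
    using R(1) by (auto simp: right_ideal_def)
  have J0: "\<zero> \<in> J" and Jadd: "\<And>r s. r \<in> J \<Longrightarrow> s \<in> J \<Longrightarrow> r \<oplus> s \<in> J"
    using J_right_ideal by (auto simp: right_ideal_def)
  have JJ: "v \<otimes> j \<in> R" if v: "v \<in> J" and j: "j \<in> J" for v j
  proof (cases "v \<in> R")
    case True
    then show ?thesis using right_ideal_mult[OF R(1)] J_closed[OF j] by simp
  next
    case False
    \<comment> \<open>This is v J + R, a right ideal between R and J. Once it is known to differ
      from J, maximality makes it R, so v J lies in R.\<close>
    let ?N = "{v \<otimes> i \<oplus> r | i r. i \<in> J \<and> r \<in> R}"
    have vA: "v \<in> carrier A" using v by (rule J_closed)
    have "right_ideal A ?N"
    proof (rule right_idealI)
      show "?N \<subseteq> carrier A" using vA J_closed RA by auto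
      show "\<zero> \<in> ?N" using J0 R0 vA by force
      show "y \<oplus> z \<in> ?N" if yz: "y \<in> ?N" "z \<in> ?N" for y z
      proof -
        obtain i r k s where *: "y = v \<otimes> i \<oplus> r" "i \<in> J" "r \<in> R" "z = v \<otimes> k \<oplus> s" "k \<in> J" "s \<in> R"
          using yz by auto
        then have "y \<oplus> z = v \<otimes> (i \<oplus> k) \<oplus> (r \<oplus> s)"
          using vA J_closed RA by (simp add: r_distr a_ac)
        then show ?thesis using * Jadd Radd by blast
      qed
      show "y \<otimes> a \<in> ?N" if ya: "y \<in> ?N" "a \<in> carrier A" for y a
      proof -
        obtain i r where *: "y = v \<otimes> i \<oplus> r" "i \<in> J" "r \<in> R" using ya by auto
        then have "y \<otimes> a = v \<otimes> (i \<otimes> a) \<oplus> r \<otimes> a"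
          using vA J_closed RA ya by (simp add: l_distr m_assoc)
        then show ?thesis
          using * ya right_ideal_mult[OF R(1)] right_ideal_mult[OF J_right_ideal] by blast
      qed
    qed
    moreover have "R \<subseteq> ?N"
    proof
      fix r assume "r \<in> R"
      then have "r = v \<otimes> \<zero> \<oplus> r" using vA RA by simp
      then show "r \<in> ?N" using J0 \<open>r \<in> R\<close> by blast
    qed
    moreover have "?N \<subseteq> J"
      using Jadd right_ideal_mult[OF J_right_ideal v] J_closed R(3) by auto
    moreover have "?N \<noteq> J"
    proof
      assume eq: "?N = J"
      have "v \<in> ?N" unfolding eq by (rule v)
      \<comment> \<open>If v J + R = J, then v = v i + r, so v (1 - i) = r lies in R, and v does too
        since 1 - i is a unit.\<close>
      then obtain i r where i: "i \<in> J" "r \<in> R" "v = v \<otimes> i \<oplus> r" by auto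
      have iA: "i \<in> carrier A" "i \<notin> Units A" using i by (auto simp: J_def)
      have unit: "\<one> \<ominus> i \<in> Units A" by (rule unit_one_minus[OF iA])
      have "v \<otimes> (\<one> \<ominus> i) = v \<ominus> v \<otimes> i"
        using vA iA by (simp add: a_minus_def r_distr r_minus)
      also have "\<dots> = r"
        using add_minus_add_cancel[of r \<zero> "v \<otimes> i"] i vA iA RA
        by (simp add: a_comm) (simp add: a_minus_def)
      finally have "v \<otimes> (\<one> \<ominus> i) \<in> R" using i by simp
      then have "v \<otimes> (\<one> \<ominus> i) \<otimes> inv (\<one> \<ominus> i) \<in> R"
        by (rule right_ideal_mult[OF R(1)]) (simp add: unit)
      then show False using False vA iA unit by (simp add: m_assoc)
    qed
    ultimately have "?N = R" using R(4)[of ?N] by blast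
    moreover have "v \<otimes> j \<oplus> \<zero> \<in> ?N" using j R0 by blast
    ultimately show ?thesis using vA J_closed[OF j] by simp
  qed
  \<comment> \<open>Since R contains J^2, it contains K. It also contains x, hence all of J, which
    lies in F x + K. This contradicts the choice of R.\<close>
  have "K \<subseteq> R" by (rule K_subset[OF R(1) JJ])
  have "b \<in> R" if b: "b \<in> J" for b
  proof -
    obtain \<beta> where \<beta>: "\<beta> \<in> carrier F" "b \<ominus> \<beta> \<odot> x \<in> R" using gen[OF b] \<open>K \<subseteq> R\<close> by auto
    have xA: "x \<in> carrier A" using x by (rule J_closed)
    have "x \<otimes> (\<beta> \<odot> \<one>) \<in> R" using R(2) \<beta> by auto
    then have "(b \<ominus> \<beta> \<odot> x) \<oplus> \<beta> \<odot> x \<in> R"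
      using Radd \<beta> xA by (simp add: smult_one_mult)
    then show ?thesis using b J_closed xA \<beta> by (simp add: a_minus_def a_assoc l_neg)
  qed
  then show False using R(3) by auto
qed

text \<open>A = F 1 + J and J = x A give b = c 1 + x a. Repeating this for a, one sees that b is a
  polynomial in x up to a remainder in x^n A, which vanishes for large n. The set \<open>D\<close>
  is left open so that it can be a centralizer.\<close>

lemma powers_generate:
  assumes x: "x \<in> J" "J = (\<lambda>a. x \<otimes> a) ` carrier A"
    and add: "\<And>a b. a \<in> D \<Longrightarrow> b \<in> D \<Longrightarrow> a \<oplus> b \<in> D"
    and pow: "\<And>c n. c \<in> carrier F \<Longrightarrow> c \<odot> x [^] (n::nat) \<in> D"
    and b: "b \<in> carrier A"
  shows "b \<in> D"
proof -
  have xA: "x \<in> carrier A" "x \<notin> Units A" using x by (auto simp: J_def)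
  have "\<exists>d\<in>D \<inter> carrier A. \<exists>b'\<in>carrier A. b = d \<oplus> x [^] n \<otimes> b'" for n :: nat
  proof (induction n)
    case 0
    have "\<zero>\<^bsub>F\<^esub> \<odot> x [^] (0::nat) \<in> D" by (rule pow) simp
    then have "\<zero> \<in> D" using xA by simp
    then show ?case using b by (intro bexI[of _ \<zero>] bexI[of _ b]) auto
  next
    case (Suc n)
    then obtain d b' where d: "d \<in> D" "d \<in> carrier A" "b' \<in> carrier A" "b = d \<oplus> x [^] n \<otimes> b'"
      by auto
    obtain c j where c: "c \<in> carrier F" "j \<in> J" "b' = c \<odot> \<one> \<oplus> j"
      by (rule scalar_decomp[OF d(3)])
    obtain a where a: "a \<in> carrier A" "j = x \<otimes> a" using c x by auto
    have "b = (d \<oplus> c \<odot> x [^] n) \<oplus> x [^] Suc n \<otimes> a"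
      using c a d xA by (simp add: r_distr m_assoc a_assoc smult_one_mult)
    moreover have "d \<oplus> c \<odot> x [^] n \<in> D \<inter> carrier A" using add d pow c xA by simp
    ultimately show ?case using a by blast
  qed
  moreover obtain n :: nat where "x [^] n = \<zero>" using nonunit_nilpotent xA by blast
  ultimately show ?thesis
    by (metis (no_types, lifting) IntD1 IntD2 l_null r_zero)
qed

theorem ex_dual_numbers:
  assumes codim: "commutator_codim F A = 2"
  shows "\<exists>x. dual_numbers F A x"
proof -
  interpret K: quotient_space F A K by (rule quotient_space_K)
  interpret Q: vectorspace F K.Q by (rule quotient_vectorspace[OF vectorspace_axioms K_submodule])
  have Qfd: "Q.fin_dim" by (rule quotient_fin_dim[OF vectorspace_axioms K_submodule fd])
  have proj1: "K.proj \<one> \<in> carrier K.Q" by (simp add: K.Q_carrier)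
  have dim2: "Q.dim = 2" using codim by (simp add: commutator_codim_def)
  have proj1_nonzero: "K.proj \<one> \<noteq> \<zero>\<^bsub>K.Q\<^esub>"
    using K.proj_eq_iff[of \<one> \<zero>] K_subset_J one_not_in_J
    by (auto simp: K.Q_zero a_minus_def)
  obtain v where v: "v \<in> carrier K.Q"
    "\<And>c. c \<in> carrier F \<Longrightarrow> v \<noteq> c \<odot>\<^bsub>K.Q\<^esub> K.proj \<one>"
    "\<And>q. q \<in> carrier K.Q \<Longrightarrow> \<exists>a\<in>carrier F. \<exists>b\<in>carrier F.
      q = a \<odot>\<^bsub>K.Q\<^esub> K.proj \<one> \<oplus>\<^bsub>K.Q\<^esub> b \<odot>\<^bsub>K.Q\<^esub> v"
    by (rule Q.dim_eq_2E[OF Qfd dim2 proj1 proj1_nonzero]) (rule that)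
  obtain y where y: "y \<in> carrier A" "v = K.proj y" using v(1) by (auto simp: K.Q_carrier)
  \<comment> \<open>The second basis vector of A/K is changed by a multiple of the first, the class
    of 1, so that its representative x lies in J.\<close>
  obtain c x where c: "c \<in> carrier F" and x: "x \<in> J" and yx: "y = c \<odot> \<one> \<oplus> x"
    by (rule scalar_decomp[OF y(1)])
  have xA: "x \<in> carrier A" using x by (rule J_closed)
  have x0: "x \<noteq> \<zero>"
    using v(2)[OF c] y c yx by (auto simp: K.Q_smult)
  have gen: "\<exists>\<beta>\<in>carrier F. b \<ominus> \<beta> \<odot> x \<in> K" if b: "b \<in> J" for b
  proof -
    have bA: "b \<in> carrier A" using b by (rule J_closed)
    obtain \<alpha> \<beta> where ab: "\<alpha> \<in> carrier F" "\<beta> \<in> carrier F"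
      "K.proj b = \<alpha> \<odot>\<^bsub>K.Q\<^esub> K.proj \<one> \<oplus>\<^bsub>K.Q\<^esub> \<beta> \<odot>\<^bsub>K.Q\<^esub> v"
      using v(3)[of "K.proj b"] bA by (auto simp: K.Q_carrier)
    \<comment> \<open>The coefficient of 1 in b modulo K, after y has been replaced by c 1 + x. It
      vanishes because b, x and K lie in J, while nonzero scalars are units.\<close>
    let ?\<gamma> = "\<alpha> \<oplus>\<^bsub>F\<^esub> \<beta> \<otimes>\<^bsub>F\<^esub> c"
    have "\<alpha> \<odot> \<one> \<oplus> \<beta> \<odot> y = ?\<gamma> \<odot> \<one> \<oplus> \<beta> \<odot> x"
      using ab c xA by (simp add: yx smult_r_distr smult_l_distr smult_assoc1 a_assoc)
    then have "K.proj b = K.proj (?\<gamma> \<odot> \<one> \<oplus> \<beta> \<odot> x)"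
      using ab y by (simp add: K.Q_smult K.Q_add)
    then have k: "b \<ominus> (?\<gamma> \<odot> \<one> \<oplus> \<beta> \<odot> x) \<in> K"
      using K.proj_eq_iff bA ab c xA by simp
    have "b \<ominus> \<beta> \<odot> x \<in> J"
      using right_ideal_minus[OF J_right_ideal b, of "\<beta> \<odot> x"]
        right_ideal_mult[OF J_right_ideal x, of "\<beta> \<odot> \<one>"] ab xA by (simp add: smult_one_mult)
    then have "(b \<ominus> \<beta> \<odot> x) \<ominus> (b \<ominus> (?\<gamma> \<odot> \<one> \<oplus> \<beta> \<odot> x)) \<in> J"
      using right_ideal_minus[OF J_right_ideal] k K_subset_J by blast
    moreover have "(b \<ominus> \<beta> \<odot> x) \<ominus> (b \<ominus> (?\<gamma> \<odot> \<one> \<oplus> \<beta> \<odot> x)) = ?\<gamma> \<odot> \<one>"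
    proof -
      have "b \<ominus> \<beta> \<odot> x = (b \<ominus> (?\<gamma> \<odot> \<one> \<oplus> \<beta> \<odot> x)) \<oplus> ?\<gamma> \<odot> \<one>"
        using bA ab c xA
        by (simp add: a_minus_def minus_add a_assoc)
          (simp add: a_comm[of "\<ominus> (\<beta> \<odot> x)"] l_neg flip: a_assoc)
      then show ?thesis
        using add_minus_add_cancel[of "?\<gamma> \<odot> \<one>" \<zero> "b \<ominus> (?\<gamma> \<odot> \<one> \<oplus> \<beta> \<odot> x)"] bA ab c xA
        by (simp add: a_comm) (simp add: a_minus_def)
    qed
    ultimately have "?\<gamma> = \<zero>\<^bsub>F\<^esub>" using scalar_in_J ab c by simp
    then show ?thesis using k ab xA by auto
  qed
  note J_eq = J_eq_principal[OF x gen]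
  have pow_comm: "x [^] n \<otimes> x = x \<otimes> x [^] n" for n :: nat
    using nat_pow_Suc2[OF xA, of n] by simp
  \<comment> \<open>Commutativity takes two rounds. Powers of x commute with x, so x commutes with
    everything; hence the powers are central, and they generate A.\<close>
  have x_central: "b \<otimes> x = x \<otimes> b" if b: "b \<in> carrier A" for b
  proof -
    have "b \<in> {b \<in> carrier A. b \<otimes> x = x \<otimes> b}"
      by (rule powers_generate[OF x J_eq _ _ b])
        (use xA pow_comm in \<open>auto simp: l_distr r_distr smult_mult_left smult_mult_right\<close>)
    then show ?thesis by simp
  qed
  have pow_central: "x [^] n \<otimes> a = a \<otimes> x [^] n" if a: "a \<in> carrier A" for a and n :: nat
    by (induction n) (use a xA x_central in \<open>auto simp: m_assoc simp flip: m_assoc[of a]\<close>)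
  have comm: "a \<otimes> b = b \<otimes> a" if a: "a \<in> carrier A" and b: "b \<in> carrier A" for a b
  proof -
    have "a \<in> {a \<in> carrier A. \<forall>b\<in>carrier A. a \<otimes> b = b \<otimes> a}"
      by (rule powers_generate[OF x J_eq _ _ a])
        (use xA pow_central in \<open>auto simp: l_distr r_distr smult_mult_left smult_mult_right\<close>)
    then show ?thesis using b by simp
  qed
  have sub0: "submodule F {\<zero>} A" by unfold_locales auto
  have K0: "K \<subseteq> {\<zero>}"
    by (rule K_least[OF sub0]) (simp add: comm)
  \<comment> \<open>As A is commutative, K is zero, and J is spanned by x itself rather than by x
    modulo K.\<close>
  have J_multiple: "\<exists>\<beta>\<in>carrier F. b = \<beta> \<odot> x" if b: "b \<in> J" for b
  proof -
    obtain \<beta> where "\<beta> \<in> carrier F" "b \<ominus> \<beta> \<odot> x = \<zero>" using gen[OF b] K0 by auto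
    then show ?thesis using J_closed[OF b] xA by auto
  qed
  have smult_x_zero: "\<beta> = \<zero>\<^bsub>F\<^esub>" if "\<beta> \<in> carrier F" "\<beta> \<odot> x = \<zero>" for \<beta>
  proof (rule ccontr)
    assume "\<beta> \<noteq> \<zero>\<^bsub>F\<^esub>"
    then have u: "\<beta> \<odot> \<one> \<in> Units A" using scalar_unit that by simp
    have "(\<beta> \<odot> \<one>) \<otimes> x = \<zero>" using that xA by (simp add: smult_one_mult)
    then have "inv (\<beta> \<odot> \<one>) \<otimes> (\<beta> \<odot> \<one>) \<otimes> x = \<zero>"
      using m_assoc[OF Units_inv_closed[OF u] Units_closed[OF u] xA] u by simp
    then show False using u xA x0 by simp
  qed
  have "x \<otimes> x = \<zero>"
  proof -
    have "x \<otimes> x \<in> J" by (rule right_ideal_mult[OF J_right_ideal x xA])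
    then obtain \<beta> where b: "\<beta> \<in> carrier F" "x \<otimes> x = \<beta> \<odot> x" using J_multiple by auto
    \<comment> \<open>Since x (\<beta> 1 - x) = 0 and x is not zero, \<beta> 1 - x is a nonunit. So
      \<beta> 1 lies in J, and \<beta> = 0.\<close>
    have "\<beta> \<odot> \<one> \<ominus> x \<notin> Units A"
    proof
      assume u: "\<beta> \<odot> \<one> \<ominus> x \<in> Units A"
      have "x \<otimes> (\<beta> \<odot> \<one> \<ominus> x) = \<zero>"
        using b xA by (simp add: a_minus_def r_distr r_minus smult_one_mult r_neg)
      then have "x \<otimes> (\<beta> \<odot> \<one> \<ominus> x) \<otimes> inv (\<beta> \<odot> \<one> \<ominus> x) = \<zero>" using u by simp
      then show False using u xA x0 Units_closed by (simp add: m_assoc)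
    qed
    then have "(\<beta> \<odot> \<one> \<ominus> x) \<oplus> x \<in> J"
      using J_right_ideal x b xA by (auto simp: right_ideal_def J_def)
    then have "\<beta> \<odot> \<one> \<in> J" using b xA by (simp add: a_minus_def a_assoc l_neg)
    then have "\<beta> = \<zero>\<^bsub>F\<^esub>" by (rule scalar_in_J[OF b(1)])
    then show ?thesis using b xA by simp
  qed
  moreover have "\<exists>\<alpha>\<in>carrier F. \<exists>\<beta>\<in>carrier F. b = \<alpha> \<odot> \<one> \<oplus> \<beta> \<odot> x" if b: "b \<in> carrier A" for b
    using scalar_decomp[OF b] J_multiple by metis
  moreover have "\<alpha> = \<zero>\<^bsub>F\<^esub> \<and> \<beta> = \<zero>\<^bsub>F\<^esub>"
    if ab: "\<alpha> \<in> carrier F" "\<beta> \<in> carrier F" "\<alpha> \<odot> \<one> \<oplus> \<beta> \<odot> x = \<zero>" for \<alpha> \<beta>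
  proof -
    have "\<beta> \<odot> x \<in> J"
      using right_ideal_mult[OF J_right_ideal x, of "\<beta> \<odot> \<one>"] ab xA by (simp add: smult_one_mult)
    moreover have "\<alpha> \<odot> \<one> = \<zero> \<ominus> \<beta> \<odot> x"
      using ab xA minus_equality[of "\<alpha> \<odot> \<one>" "\<beta> \<odot> x"] by (simp add: a_minus_def)
    ultimately have "\<alpha> \<odot> \<one> \<in> J"
      using right_ideal_minus[OF J_right_ideal, of \<zero>] J_right_ideal by (simp add: right_ideal_def)
    then have "\<alpha> = \<zero>\<^bsub>F\<^esub>" using scalar_in_J ab by simp
    then show ?thesis using smult_x_zero ab xA by simp
  qed
  ultimately have "dual_numbers F A x"
    using xA by unfold_locales auto
  then show ?thesis ..
qed

end

section \<open>The algebra \<open>F[X]/(X\<^sup>2)\<close>\<close>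

lemma (in assoc_algebra) quotient_algebra:
  assumes I: "ideal I A"
  shows "assoc_algebra F (quotient_module A I)" "submodule F I A"
    "x \<in> carrier A \<Longrightarrow> y \<in> carrier A \<Longrightarrow>
      (I +>\<^bsub>A\<^esub> x) \<otimes>\<^bsub>quotient_module A I\<^esub> (I +>\<^bsub>A\<^esub> y) = I +>\<^bsub>A\<^esub> (x \<otimes> y)"
proof -
  interpret I: ideal I A by (rule I)
  have "right_ideal A I"
    by (rule right_idealI) (use I.a_subset I.I_r_closed in auto)
  then show sub: "submodule F I A" by (rule right_ideal_submodule)
  interpret Q: quotient_space F A I by (rule quotient_spaceI[OF vectorspace_axioms sub])
  interpret Qv: vectorspace F Q.Q by (rule quotient_vectorspace[OF vectorspace_axioms sub])
  have mult: "Q.proj x \<otimes>\<^bsub>Q.Q\<^esub> Q.proj y = Q.proj (x \<otimes> y)"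
    if "x \<in> carrier A" "y \<in> carrier A" for x y
    using I.rcoset_mult_add[OF that] by (simp add: quotient_module_def)
  then show "x \<in> carrier A \<Longrightarrow> y \<in> carrier A \<Longrightarrow>
      (I +>\<^bsub>A\<^esub> x) \<otimes>\<^bsub>quotient_module A I\<^esub> (I +>\<^bsub>A\<^esub> y) = I +>\<^bsub>A\<^esub> (x \<otimes> y)" by simp
  have one: "\<one>\<^bsub>Q.Q\<^esub> = Q.proj \<one>" by (simp add: quotient_module_def)
  interpret Qr: ring Q.Q
  proof (rule ringI)
    show "abelian_group Q.Q" by (rule Qv.abelian_group_axioms)
    show "monoid Q.Q"
      by (rule monoidI) (auto simp: Q.Q_carrier mult one m_assoc)
  qed (auto simp: Q.Q_carrier mult Q.Q_add l_distr r_distr)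
  show "assoc_algebra F Q.Q"
    by unfold_locales
      (auto simp: Q.Q_carrier mult Q.Q_smult smult_mult_left smult_mult_right)
qed

text \<open>Membership in the ideal of X^2 is the vanishing of the two lowest coefficients
  (\<open>W_iff\<close>), so every class has exactly one representative \<alpha> + \<beta>
  X.\<close>

lemma poly_mod_X2_dual_numbers:
  fixes F :: "('f, 'r) ring_scheme"
  assumes "field F"
  shows "\<exists>x. dual_numbers F (poly_mod_X2 F) x"
proof -
  interpret F: field F by fact
  define P where "P = UP F"
  interpret P: UP_cring F P
    by unfold_locales (simp add: P_def)
  interpret PA: assoc_algebra F P
  proof unfold_locales
    fix c p q assume c: "c \<in> carrier F" and p: "p \<in> carrier P" and q: "q \<in> carrier P"
    show left: "(c \<odot>\<^bsub>P\<^esub> p) \<otimes>\<^bsub>P\<^esub> q = c \<odot>\<^bsub>P\<^esub> (p \<otimes>\<^bsub>P\<^esub> q)"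
      by (rule P.UP_smult_assoc2[OF c p q])
    show "p \<otimes>\<^bsub>P\<^esub> (c \<odot>\<^bsub>P\<^esub> q) = c \<odot>\<^bsub>P\<^esub> (p \<otimes>\<^bsub>P\<^esub> q)"
      using P.UP_smult_assoc2[OF c q p] P.m_comm[OF p q] P.m_comm[OF p P.UP_smult_closed[OF c q]]
      by simp
  qed
  define X2 where "X2 = monom P \<one>\<^bsub>F\<^esub> 2"
  define W where "W = PIdl\<^bsub>P\<^esub> X2"
  have X2: "X2 \<in> carrier P" by (simp add: X2_def)
  have low: "coeff P (X2 \<otimes>\<^bsub>P\<^esub> q) n = \<zero>\<^bsub>F\<^esub>" if q: "q \<in> carrier P" and n: "n < 2" for q n
  proof -
    have "coeff P (X2 \<otimes>\<^bsub>P\<^esub> q) n = (\<Oplus>\<^bsub>F\<^esub>i\<in>{..n}. coeff P X2 i \<otimes>\<^bsub>F\<^esub> coeff P q (n - i))"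
      by (rule P.coeff_mult[OF X2 q])
    also have "\<dots> = (\<Oplus>\<^bsub>F\<^esub>i\<in>{..n}. \<zero>\<^bsub>F\<^esub>)"
    proof (rule F.finsum_cong')
      fix i assume i: "i \<in> {..n}"
      then have "coeff P X2 i = \<zero>\<^bsub>F\<^esub>" using n by (simp add: X2_def)
      then show "coeff P X2 i \<otimes>\<^bsub>F\<^esub> coeff P q (n - i) = \<zero>\<^bsub>F\<^esub>"
        using P.coeff_closed[OF q] by simp
    qed auto
    finally show ?thesis by simp
  qed
  have W_iff: "p \<in> W \<longleftrightarrow> coeff P p 0 = \<zero>\<^bsub>F\<^esub> \<and> coeff P p 1 = \<zero>\<^bsub>F\<^esub>" if p: "p \<in> carrier P" for p
  proof
    assume "p \<in> W"
    then obtain q where "q \<in> carrier P" "p = X2 \<otimes>\<^bsub>P\<^esub> q"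
      using P.m_comm[OF _ X2] unfolding W_def cgenideal_def by blast
    then show "coeff P p 0 = \<zero>\<^bsub>F\<^esub> \<and> coeff P p 1 = \<zero>\<^bsub>F\<^esub>" using low by simp
  next
    assume zero: "coeff P p 0 = \<zero>\<^bsub>F\<^esub> \<and> coeff P p 1 = \<zero>\<^bsub>F\<^esub>"
    \<comment> \<open>The quotient of p by X^2: the coefficients move down by two places.\<close>
    define q where "q n = p (n + 2)" for n
    have pup: "p \<in> up F" using p by (simp add: P_def UP_def)
    then obtain m where m: "bound \<zero>\<^bsub>F\<^esub> m p" by blast
    have "q \<in> up F"
    proof
      show "q n \<in> carrier F" for n using pup by (simp add: q_def mem_upD)
      show "\<exists>n. bound \<zero>\<^bsub>F\<^esub> n q"
        using m by (intro exI[of _ m]) (auto simp: q_def bound_def)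
    qed
    then have q: "q \<in> carrier P" and qc: "coeff P q n = q n" for n
      by (simp_all add: P_def UP_def)
    have pc: "coeff P p n = p n" for n using pup by (simp add: P_def UP_def)
    have "p = X2 \<otimes>\<^bsub>P\<^esub> q"
    proof (rule P.up_eqI)
      fix n
      show "coeff P p n = coeff P (X2 \<otimes>\<^bsub>P\<^esub> q) n"
      proof (cases "n < 2")
        case True
        then have "n = 0 \<or> n = 1" by auto
        then show ?thesis using low[OF q True] zero by auto
      next
        case False
        then obtain k where k: "n = k + 2" by (metis add.commute le_Suc_ex not_less)
        have "coeff P (X2 \<otimes>\<^bsub>P\<^esub> q) n = \<one>\<^bsub>F\<^esub> \<otimes>\<^bsub>F\<^esub> coeff P q k"
          unfolding k X2_def by (rule P.coeff_monom_mult[OF F.one_closed q])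
        also have "\<dots> = coeff P p n"
          using P.coeff_closed[OF p, of n] by (simp add: qc pc q_def k)
        finally show ?thesis by simp
      qed
    qed (use p q X2 in auto)
    then show "p \<in> W" 
      using q P.m_comm[OF q X2] unfolding W_def cgenideal_def by (intro CollectI exI[of _ q]) simp
  qed
  have W_ideal: "ideal W P" unfolding W_def by (rule P.cgenideal_ideal[OF X2])
  have Q_def: "poly_mod_X2 F = quotient_module P W"
    by (simp add: poly_mod_X2_def P_def W_def X2_def)
  interpret Q: quotient_space F P W
    by (rule quotient_spaceI[OF PA.vectorspace_axioms PA.quotient_algebra(2)[OF W_ideal]])
  interpret QA: assoc_algebra F Q.Q by (rule PA.quotient_algebra(1)[OF W_ideal])
  have Q_one: "\<one>\<^bsub>Q.Q\<^esub> = Q.proj \<one>\<^bsub>P\<^esub>" by (simp add: quotient_module_def)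
  define X where "X = monom P \<one>\<^bsub>F\<^esub> 1"
  have X: "X \<in> carrier P" by (simp add: X_def)
  have el: "\<alpha> \<odot>\<^bsub>Q.Q\<^esub> \<one>\<^bsub>Q.Q\<^esub> \<oplus>\<^bsub>Q.Q\<^esub> \<beta> \<odot>\<^bsub>Q.Q\<^esub> Q.proj X =
      Q.proj (\<alpha> \<odot>\<^bsub>P\<^esub> \<one>\<^bsub>P\<^esub> \<oplus>\<^bsub>P\<^esub> \<beta> \<odot>\<^bsub>P\<^esub> X)" if "\<alpha> \<in> carrier F" "\<beta> \<in> carrier F" for \<alpha> \<beta>
    using that X by (simp add: Q_one Q.Q_smult Q.Q_add)
  have "dual_numbers F Q.Q (Q.proj X)"
  proof
    show "Q.proj X \<in> carrier Q.Q" using X by (simp add: Q.Q_carrier)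
    have "X \<otimes>\<^bsub>P\<^esub> X = X2"
      unfolding X_def X2_def
      using P.monom_mult[of "\<one>\<^bsub>F\<^esub>" "\<one>\<^bsub>F\<^esub>" 1 1] by (simp add: numeral_2_eq_2)
    moreover have "X2 \<ominus>\<^bsub>P\<^esub> \<zero>\<^bsub>P\<^esub> \<in> W"
      using W_iff[OF X2] X2 by (simp add: X2_def a_minus_def)
    ultimately show "Q.proj X \<otimes>\<^bsub>Q.Q\<^esub> Q.proj X = \<zero>\<^bsub>Q.Q\<^esub>"
      using PA.quotient_algebra(3)[OF W_ideal X X] Q.proj_eq_iff[OF X2 P.zero_closed]
      by (simp add: Q.Q_zero)
  next
    fix b assume "b \<in> carrier Q.Q"
    then obtain p where p: "p \<in> carrier P" "b = Q.proj p" by (auto simp: Q.Q_carrier)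
    let ?a = "coeff P p 0" and ?b = "coeff P p 1"
    have ab: "?a \<in> carrier F" "?b \<in> carrier F" using P.coeff_closed[OF p(1)] by auto
    let ?r = "?a \<odot>\<^bsub>P\<^esub> \<one>\<^bsub>P\<^esub> \<oplus>\<^bsub>P\<^esub> ?b \<odot>\<^bsub>P\<^esub> X"
    have r: "?r \<in> carrier P" using ab X by simp
    have "p \<ominus>\<^bsub>P\<^esub> ?r \<in> W"
    proof -
      have "coeff P (p \<ominus>\<^bsub>P\<^esub> ?r) n = coeff P p n \<oplus>\<^bsub>F\<^esub> (\<ominus>\<^bsub>F\<^esub> coeff P ?r n)" for n
        using P.coeff_add[OF p(1) P.a_inv_closed[OF r], of n] P.coeff_a_inv[OF r, of n]
        by (simp add: a_minus_def)
      moreover have "coeff P ?r 0 = ?a" "coeff P ?r 1 = ?b"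
        using ab X P.coeff_smult by (simp_all add: X_def)
      ultimately show ?thesis
        using W_iff[OF P.minus_closed[OF p(1) r]] ab by (simp add: F.r_neg)
    qed
    then have "b = Q.proj (?a \<odot>\<^bsub>P\<^esub> \<one>\<^bsub>P\<^esub> \<oplus>\<^bsub>P\<^esub> ?b \<odot>\<^bsub>P\<^esub> X)"
      using Q.proj_eq_iff[OF p(1) r] p by simp
    then show "\<exists>\<alpha>\<in>carrier F. \<exists>\<beta>\<in>carrier F.
        b = \<alpha> \<odot>\<^bsub>Q.Q\<^esub> \<one>\<^bsub>Q.Q\<^esub> \<oplus>\<^bsub>Q.Q\<^esub> \<beta> \<odot>\<^bsub>Q.Q\<^esub> Q.proj X"
      using ab el by (intro bexI[of _ ?a] bexI[of _ ?b]) auto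
  next
    fix \<alpha> \<beta> assume ab: "\<alpha> \<in> carrier F" "\<beta> \<in> carrier F"
      "\<alpha> \<odot>\<^bsub>Q.Q\<^esub> \<one>\<^bsub>Q.Q\<^esub> \<oplus>\<^bsub>Q.Q\<^esub> \<beta> \<odot>\<^bsub>Q.Q\<^esub> Q.proj X = \<zero>\<^bsub>Q.Q\<^esub>"
    let ?r = "\<alpha> \<odot>\<^bsub>P\<^esub> \<one>\<^bsub>P\<^esub> \<oplus>\<^bsub>P\<^esub> \<beta> \<odot>\<^bsub>P\<^esub> X"
    have r: "?r \<in> carrier P" using ab X by simp
    have "Q.proj ?r = Q.proj \<zero>\<^bsub>P\<^esub>" using ab el by (simp add: Q.Q_zero)
    then have "?r \<in> W" using Q.proj_eq_iff[OF r P.zero_closed] r by (simp add: a_minus_def)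
    then show "\<alpha> = \<zero>\<^bsub>F\<^esub> \<and> \<beta> = \<zero>\<^bsub>F\<^esub>" using W_iff[OF r] ab X by (simp add: X_def)
  qed
  then show ?thesis unfolding Q_def ..
qed

section \<open>Equivalences of module categories\<close>

lemma IsoI:
  assumes "f \<in> Hom A M N" "g \<in> Hom A N M" "\<And>x. x \<in> carrier M \<Longrightarrow> g (f x) = x"
    "\<And>y. y \<in> carrier N \<Longrightarrow> f (g y) = y"
  shows "f \<in> Iso A M N"
  unfolding Iso_def
proof (intro CollectI conjI bij_betw_byWitness[of _ g])
  show "f ` carrier M \<subseteq> carrier N" "g ` carrier N \<subseteq> carrier M"
    using Hom_closed[OF assms(1)] Hom_closed[OF assms(2)] by auto
qed (use assms in auto)

lemma Hom_sum:
  assumes "right_module A M" "right_module A N" "f \<in> Hom A M N" "g \<in> Hom A M N"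
  shows "(\<lambda>x\<in>carrier M. f x \<oplus>\<^bsub>N\<^esub> g x) \<in> Hom A M N"
proof -
  interpret M: right_module A M by fact
  interpret N: right_module A N by fact
  note c = Hom_closed[OF assms(3)] Hom_closed[OF assms(4)]
  show ?thesis
    by (rule HomI)
      (auto simp: c Hom_add[OF assms(3)] Hom_add[OF assms(4)] Hom_act[OF assms(3)]
        Hom_act[OF assms(4)] M.act_closed N.act_add_right N.M.a_ac)
qed

lemma (in assoc_algebra) Hom_scale:
  assumes "right_module A M" "right_module A N" "f \<in> Hom A M N" "c \<in> carrier F"
  shows "(\<lambda>x\<in>carrier M. (c \<odot> \<one>) \<odot>\<^bsub>N\<^esub> f x) \<in> Hom A M N"
proof -
  interpret M: right_module A M by fact
  interpret N: right_module A N by fact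
  have comm: "a \<odot>\<^bsub>N\<^esub> ((c \<odot> \<one>) \<odot>\<^bsub>N\<^esub> y) = (c \<odot> \<one>) \<odot>\<^bsub>N\<^esub> (a \<odot>\<^bsub>N\<^esub> y)"
    if "a \<in> carrier A" "y \<in> carrier N" for a y
    using N.act_assoc[of "c \<odot> \<one>" a y] N.act_assoc[of a "c \<odot> \<one>" y] that assms(4)
    by (simp add: smult_one_mult)
  note cl = Hom_closed[OF assms(3)]
  show ?thesis
    by (rule HomI)
      (auto simp: cl Hom_add[OF assms(3)] Hom_act[OF assms(3)] M.act_closed N.act_closed
        N.act_add_right comm assms(4))
qed

context
  fixes F :: "('f, 'r) ring_scheme" and A :: "('f, 'a, 's) module_scheme"
    and B :: "('f, 'b, 't) module_scheme"
    and S :: "('a, 'u) module \<Rightarrow> ('b, 'u) module" and S1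
  assumes A: "assoc_algebra F A" and B: "assoc_algebra F B"
    and S: "linear_functor F A B S S1"
    and faithful: "\<And>M N f g. \<lbrakk>right_module A M; right_module A N; f \<in> Hom A M N; g \<in> Hom A M N;
      S1 M N f = S1 M N g\<rbrakk> \<Longrightarrow> f = g"
    and full: "\<And>M N h. \<lbrakk>right_module A M; right_module A N; h \<in> Hom B (S M) (S N)\<rbrakk>
      \<Longrightarrow> \<exists>f\<in>Hom A M N. S1 M N f = h"
    and essentially_surjective: "\<And>N :: ('b, 'u) module. right_module B N \<Longrightarrow>
      \<exists>M. right_module A M \<and> Iso B (S M) N \<noteq> {}"
begin

interpretation A: assoc_algebra F A by (rule A)
interpretation B: assoc_algebra F B by (rule B)
interpretation S: linear_functor F A B S S1 by (rule S)

text \<open>For every N choose a module T N and mutually inverse maps E N : S (T N) -> N and E' N.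
  On morphisms, T lifts the conjugate of g by these maps along S. All functor laws are checked after
  applying S, which is faithful.\<close>

lemma fully_faithful_equivalence: "morita_equivalent TYPE('u) F A B"
proof -
  \<comment> \<open>Guarding the data by \<open>right_module B N\<close> makes it exist for every
    record N, as the three applications of \<open>choice\<close> demand.\<close>
  define inv_data where "inv_data N M E E' \<longleftrightarrow> (right_module B N \<longrightarrow>
      right_module A M \<and> E \<in> Hom B (S M) N \<and> E' \<in> Hom B N (S M) \<and>
      (\<forall>x\<in>carrier (S M). E' (E x) = x) \<and> (\<forall>y\<in>carrier N. E (E' y) = y))"
    for N :: "('b, 'u) module" and M :: "('a, 'u) module" and E E'
  have "\<forall>N. \<exists>M E E'. inv_data N M E E'"
  proof
    fix N :: "('b, 'u) module"
    show "\<exists>M E E'. inv_data N M E E'"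
    proof (cases "right_module B N")
      case True
      then obtain M E where M: "right_module A M" "E \<in> Iso B (S M) N"
        using essentially_surjective[OF True] by auto
      obtain E' where "E' \<in> Hom B N (S M)" "\<And>x. x \<in> carrier (S M) \<Longrightarrow> E' (E x) = x"
        "\<And>y. y \<in> carrier N \<Longrightarrow> E (E' y) = y"
        by (rule Iso_inverseE[OF S.obj[OF M(1)] True M(2)]) (rule that)
      then show ?thesis
        using M by (intro exI[of _ M] exI[of _ E] exI[of _ E']) (simp add: Iso_def inv_data_def)
    qed (simp add: inv_data_def)
  qed
  from choice[OF this] obtain T where "\<forall>N. \<exists>E E'. inv_data N (T N) E E'" by (rule exE)
  from choice[OF this] obtain E where "\<forall>N. \<exists>E'. inv_data N (T N) (E N) E'" by (rule exE)
  from choice[OF this] obtain E' where *: "\<forall>N. inv_data N (T N) (E N) (E' N)" by (rule exE)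
  have T: "right_module A (T N)" and E: "E N \<in> Hom B (S (T N)) N"
    and E': "E' N \<in> Hom B N (S (T N))" and E'E: "x \<in> carrier (S (T N)) \<Longrightarrow> E' N (E N x) = x"
    and EE': "y \<in> carrier N \<Longrightarrow> E N (E' N y) = y" if "right_module B N" for N x y
    using * that unfolding inv_data_def by auto
  note ST = S.obj[OF T]
  define lift where "lift M N h = (SOME f. f \<in> Hom A M N \<and> S1 M N f = h)" for M N h
  have lift: "lift M N h \<in> Hom A M N" "S1 M N (lift M N h) = h"
    if "right_module A M" "right_module A N" "h \<in> Hom B (S M) (S N)" for M N h
  proof -
    have "\<exists>f. f \<in> Hom A M N \<and> S1 M N f = h" using full[OF that] by auto
    from someI_ex[OF this] show "lift M N h \<in> Hom A M N" "S1 M N (lift M N h) = h"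
      unfolding lift_def by auto
  qed
  define k where "k N N' g = (\<lambda>x\<in>carrier (S (T N)). E' N' (g (E N x)))" for N N' g
  define T1 where "T1 N N' g = lift (T N) (T N') (k N N' g)" for N N' g
  have k: "k N N' g \<in> Hom B (S (T N)) (S (T N'))"
    if N: "right_module B N" "right_module B N'" and g: "g \<in> Hom B N N'" for N N' g
  proof -
    interpret ST: right_module B "S (T N)" by (rule ST[OF N(1)])
    note c = Hom_closed[OF E[OF N(1)]] Hom_closed[OF g] Hom_closed[OF E'[OF N(2)]]
    show ?thesis
      unfolding k_def
      by (rule HomI)
        (auto simp: c Hom_add[OF E[OF N(1)]] Hom_add[OF g] Hom_add[OF E'[OF N(2)]]
          Hom_act[OF E[OF N(1)]] Hom_act[OF g] Hom_act[OF E'[OF N(2)]] ST.act_closed)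
  qed
  have T1: "T1 N N' g \<in> Hom A (T N) (T N')" "S1 (T N) (T N') (T1 N N' g) = k N N' g"
    if "right_module B N" "right_module B N'" "g \<in> Hom B N N'" for N N' g
    unfolding T1_def using lift[OF T[OF that(1)] T[OF that(2)] k[OF that]] by auto
  have "linear_functor F B A T T1"
  proof (rule linear_functor.intro)
    show "right_module A (T M)" if "right_module B M" for M by (rule T[OF that])
    show "T1 M N f \<in> Hom A (T M) (T N)"
      if "right_module B M" "right_module B N" "f \<in> Hom B M N" for M N f
      by (rule T1(1)[OF that])
    show "T1 M M (\<lambda>x\<in>carrier M. x) = (\<lambda>x\<in>carrier (T M). x)" if M: "right_module B M" for M
    proof (rule faithful[OF T[OF M] T[OF M] T1(1)[OF M M Hom_id[OF M]] Hom_id[OF T[OF M]]])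
      have "k M M (\<lambda>x\<in>carrier M. x) = (\<lambda>x\<in>carrier (S (T M)). x)"
        by (auto simp: k_def fun_eq_iff E'E[OF M] Hom_closed[OF E[OF M]])
      then show "S1 (T M) (T M) (T1 M M (\<lambda>x\<in>carrier M. x)) = S1 (T M) (T M) (\<lambda>x\<in>carrier (T M). x)"
        using T1(2)[OF M M Hom_id[OF M]] S.map_id[OF T[OF M]] by simp
    qed
    show "T1 L N (compose (carrier L) g f) = compose (carrier (T L)) (T1 M N g) (T1 L M f)"
      if L: "right_module B L" and M: "right_module B M" and N: "right_module B N"
        and f: "f \<in> Hom B L M" and g: "g \<in> Hom B M N" for L M N f g
    proof -
      have gf: "compose (carrier L) g f \<in> Hom B L N" by (rule Hom_compose[OF L f g])
      note Tf = T1[OF L M f] and Tg = T1[OF M N g] and Tgf = T1[OF L N gf]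
      show ?thesis
      proof (rule faithful[OF T[OF L] T[OF N] Tgf(1) Hom_compose[OF T[OF L] Tf(1) Tg(1)]])
        have "k L N (compose (carrier L) g f) = compose (carrier (S (T L))) (k M N g) (k L M f)"
          using Hom_closed[OF E[OF L]] Hom_closed[OF f] Hom_closed[OF E'[OF M]]
          by (auto simp: k_def fun_eq_iff compose_def EE'[OF M])
        then show "S1 (T L) (T N) (T1 L N (compose (carrier L) g f)) =
            S1 (T L) (T N) (compose (carrier (T L)) (T1 M N g) (T1 L M f))"
          using S.map_comp[OF T[OF L] T[OF M] T[OF N] Tf(1) Tg(1)] Tf(2) Tg(2) Tgf(2) by simp
      qed
    qed
    show "T1 M N (\<lambda>x\<in>carrier M. f x \<oplus>\<^bsub>N\<^esub> g x) =
        (\<lambda>x\<in>carrier (T M). T1 M N f x \<oplus>\<^bsub>T N\<^esub> T1 M N g x)"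
      if M: "right_module B M" and N: "right_module B N"
        and f: "f \<in> Hom B M N" and g: "g \<in> Hom B M N" for M N f g
    proof -
      note Tf = T1[OF M N f] and Tg = T1[OF M N g] and Tfg = T1[OF M N Hom_sum[OF M N f g]]
      show ?thesis
      proof (rule faithful[OF T[OF M] T[OF N] Tfg(1) Hom_sum[OF T[OF M] T[OF N] Tf(1) Tg(1)]])
        have "k M N (\<lambda>x\<in>carrier M. f x \<oplus>\<^bsub>N\<^esub> g x) =
            (\<lambda>x\<in>carrier (S (T M)). k M N f x \<oplus>\<^bsub>S (T N)\<^esub> k M N g x)"
          using Hom_closed[OF E[OF M]] Hom_closed[OF f] Hom_closed[OF g]
          by (auto simp: k_def fun_eq_iff Hom_add[OF E'[OF N]])
        then show "S1 (T M) (T N) (T1 M N (\<lambda>x\<in>carrier M. f x \<oplus>\<^bsub>N\<^esub> g x)) =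
            S1 (T M) (T N) (\<lambda>x\<in>carrier (T M). T1 M N f x \<oplus>\<^bsub>T N\<^esub> T1 M N g x)"
          using S.map_add[OF T[OF M] T[OF N] Tf(1) Tg(1)] Tf(2) Tg(2) Tfg(2) by simp
      qed
    qed
    show "T1 M N (\<lambda>x\<in>carrier M. (c \<odot>\<^bsub>B\<^esub> \<one>\<^bsub>B\<^esub>) \<odot>\<^bsub>N\<^esub> f x) =
        (\<lambda>x\<in>carrier (T M). (c \<odot>\<^bsub>A\<^esub> \<one>\<^bsub>A\<^esub>) \<odot>\<^bsub>T N\<^esub> T1 M N f x)"
      if M: "right_module B M" and N: "right_module B N"
        and f: "f \<in> Hom B M N" and c: "c \<in> carrier F" for M N f c
    proof -
      note Tf = T1[OF M N f] and Tcf = T1[OF M N B.Hom_scale[OF M N f c]]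
      show ?thesis
      proof (rule faithful[OF T[OF M] T[OF N] Tcf(1) A.Hom_scale[OF T[OF M] T[OF N] Tf(1) c]])
        have "k M N (\<lambda>x\<in>carrier M. (c \<odot>\<^bsub>B\<^esub> \<one>\<^bsub>B\<^esub>) \<odot>\<^bsub>N\<^esub> f x) =
            (\<lambda>x\<in>carrier (S (T M)). (c \<odot>\<^bsub>B\<^esub> \<one>\<^bsub>B\<^esub>) \<odot>\<^bsub>S (T N)\<^esub> k M N f x)"
          using Hom_closed[OF E[OF M]] Hom_closed[OF f] c
          by (auto simp: k_def fun_eq_iff Hom_act[OF E'[OF N]])
        then show "S1 (T M) (T N) (T1 M N (\<lambda>x\<in>carrier M. (c \<odot>\<^bsub>B\<^esub> \<one>\<^bsub>B\<^esub>) \<odot>\<^bsub>N\<^esub> f x)) =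
            S1 (T M) (T N) (\<lambda>x\<in>carrier (T M). (c \<odot>\<^bsub>A\<^esub> \<one>\<^bsub>A\<^esub>) \<odot>\<^bsub>T N\<^esub> T1 M N f x)"
          using S.map_smult[OF T[OF M] T[OF N] Tf(1) c] Tf(2) Tcf(2) by simp
      qed
    qed
  qed
  moreover have "naturally_isomorphic B B (\<lambda>M. S (T M)) (\<lambda>M N f. S1 (T M) (T N) (T1 M N f))
      (\<lambda>M. M) (\<lambda>M N f. f)"
    unfolding naturally_isomorphic_def
  proof (intro exI[of _ E] conjI allI impI)
    fix M :: "('b, 'u) module" assume M: "right_module B M"
    show "E M \<in> Iso B (S (T M)) M"
      by (rule IsoI[OF E[OF M] E'[OF M] E'E[OF M] EE'[OF M]])
  next
    fix M N :: "('b, 'u) module" and f assume *: "right_module B M \<and> right_module B N \<and> f \<in> Hom B M N"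
    then have M: "right_module B M" and N: "right_module B N" and f: "f \<in> Hom B M N" by auto
    show "compose (carrier (S (T M))) (E N) (S1 (T M) (T N) (T1 M N f)) =
        compose (carrier (S (T M))) f (E M)"
      unfolding T1(2)[OF M N f]
      using Hom_closed[OF f] Hom_closed[OF E[OF M]]
      by (auto simp: k_def compose_def fun_eq_iff EE'[OF N])
  qed
  moreover have "naturally_isomorphic A A (\<lambda>M. T (S M)) (\<lambda>M N f. T1 (S M) (S N) (S1 M N f))
      (\<lambda>M. M) (\<lambda>M N f. f)"
  proof -
    \<comment> \<open>S is full, so E (S M) and E' (S M) lift to maps T (S M) -> M and back.
      Faithfulness makes the lifts inverse to each other and natural.\<close>
    define \<eta> where "\<eta> M = lift (T (S M)) M (E (S M))" for M
    define \<theta> where "\<theta> M = lift M (T (S M)) (E' (S M))" for M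
    have \<eta>: "\<eta> M \<in> Hom A (T (S M)) M" "S1 (T (S M)) M (\<eta> M) = E (S M)"
      if M: "right_module A M" for M
      unfolding \<eta>_def using lift[OF T[OF S.obj[OF M]] M E[OF S.obj[OF M]]] by auto
    have \<theta>: "\<theta> M \<in> Hom A M (T (S M))" "S1 M (T (S M)) (\<theta> M) = E' (S M)"
      if M: "right_module A M" for M
      unfolding \<theta>_def using lift[OF M T[OF S.obj[OF M]] E'[OF S.obj[OF M]]] by auto
    show ?thesis
      unfolding naturally_isomorphic_def
    proof (intro exI[of _ \<eta>] conjI allI impI)
      fix M :: "('a, 'u) module" assume M: "right_module A M"
      note SM = S.obj[OF M]
      note TSM = T[OF SM]
      have 1: "compose (carrier (T (S M))) (\<theta> M) (\<eta> M) = (\<lambda>x\<in>carrier (T (S M)). x)"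
      proof (rule faithful[OF TSM TSM Hom_compose[OF TSM \<eta>(1)[OF M] \<theta>(1)[OF M]] Hom_id[OF TSM]])
        have "compose (carrier (S (T (S M)))) (E' (S M)) (E (S M)) = (\<lambda>x\<in>carrier (S (T (S M))). x)"
          by (auto simp: compose_def fun_eq_iff E'E[OF SM])
        then show "S1 (T (S M)) (T (S M)) (compose (carrier (T (S M))) (\<theta> M) (\<eta> M)) =
            S1 (T (S M)) (T (S M)) (\<lambda>x\<in>carrier (T (S M)). x)"
          using S.map_comp[OF TSM M TSM \<eta>(1)[OF M] \<theta>(1)[OF M]] \<eta>(2)[OF M] \<theta>(2)[OF M]
            S.map_id[OF TSM] by simp
      qed
      have 2: "compose (carrier M) (\<eta> M) (\<theta> M) = (\<lambda>x\<in>carrier M. x)"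
      proof (rule faithful[OF M M Hom_compose[OF M \<theta>(1)[OF M] \<eta>(1)[OF M]] Hom_id[OF M]])
        have "compose (carrier (S M)) (E (S M)) (E' (S M)) = (\<lambda>x\<in>carrier (S M). x)"
          by (auto simp: compose_def fun_eq_iff EE'[OF SM])
        then show "S1 M M (compose (carrier M) (\<eta> M) (\<theta> M)) = S1 M M (\<lambda>x\<in>carrier M. x)"
          using S.map_comp[OF M TSM M \<theta>(1)[OF M] \<eta>(1)[OF M]] \<eta>(2)[OF M] \<theta>(2)[OF M]
            S.map_id[OF M] by simp
      qed
      show "\<eta> M \<in> Iso A (T (S M)) M"
      proof (rule IsoI[OF \<eta>(1)[OF M] \<theta>(1)[OF M]])
        show "\<theta> M (\<eta> M x) = x" if "x \<in> carrier (T (S M))" for x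
          using fun_cong[OF 1, of x] that by (simp add: compose_def)
        show "\<eta> M (\<theta> M x) = x" if "x \<in> carrier M" for x
          using fun_cong[OF 2, of x] that by (simp add: compose_def)
      qed
    next
      fix M N :: "('a, 'u) module" and f assume "right_module A M \<and> right_module A N \<and> f \<in> Hom A M N"
      then have M: "right_module A M" and N: "right_module A N" and f: "f \<in> Hom A M N" by auto
      note SM = S.obj[OF M] and SN = S.obj[OF N] and Sf = S.map[OF M N f]
      note TSM = T[OF SM] and TSN = T[OF SN] and TSf = T1[OF SM SN Sf]
      show "compose (carrier (T (S M))) (\<eta> N) (T1 (S M) (S N) (S1 M N f)) =
          compose (carrier (T (S M))) f (\<eta> M)"
      proof (rule faithful[OF TSM N Hom_compose[OF TSM TSf(1) \<eta>(1)[OF N]]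
            Hom_compose[OF TSM \<eta>(1)[OF M] f]])
        have "compose (carrier (S (T (S M)))) (E (S N)) (k (S M) (S N) (S1 M N f)) =
            compose (carrier (S (T (S M)))) (S1 M N f) (E (S M))"
          using Hom_closed[OF Sf] Hom_closed[OF E[OF SM]]
          by (auto simp: k_def compose_def fun_eq_iff EE'[OF SN])
        then show "S1 (T (S M)) N (compose (carrier (T (S M))) (\<eta> N) (T1 (S M) (S N) (S1 M N f))) =
            S1 (T (S M)) N (compose (carrier (T (S M))) f (\<eta> M))"
          using S.map_comp[OF TSM TSN N TSf(1) \<eta>(1)[OF N]] S.map_comp[OF TSM M N \<eta>(1)[OF M] f]
            TSf(2) \<eta>(2)[OF M] \<eta>(2)[OF N] by simp
      qed
    qed
  qed
  ultimately show ?thesis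
    unfolding morita_equivalent_def using S by blast
qed

end

section \<open>Faithfulness and fullness from the natural isomorphisms\<close>

lemma natural_iso_faithful:
  assumes iso: "naturally_isomorphic A A (\<lambda>M. T (S M)) (\<lambda>M N f. T1 (S M) (S N) (S1 M N f))
      (\<lambda>M. M) (\<lambda>M N f. f)"
    and M: "right_module A M" and N: "right_module A N"
    and f: "f \<in> Hom A M N" and g: "g \<in> Hom A M N" and eq: "S1 M N f = S1 M N g"
  shows "f = g"
proof -
  obtain \<eta> where \<eta>: "\<And>M. right_module A M \<Longrightarrow> \<eta> M \<in> Iso A (T (S M)) M"
    and nat: "\<And>M N f. right_module A M \<Longrightarrow> right_module A N \<Longrightarrow> f \<in> Hom A M N \<Longrightarrow>
      compose (carrier (T (S M))) (\<eta> N) (T1 (S M) (S N) (S1 M N f)) =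
      compose (carrier (T (S M))) f (\<eta> M)"
    using iso unfolding naturally_isomorphic_def by blast
  have "f x = g x" if x: "x \<in> carrier M" for x
  proof -
    \<comment> \<open>By naturality S f determines f on the image of \<eta> M, which is all of
      M.\<close>
    obtain y where y: "y \<in> carrier (T (S M))" "x = \<eta> M y"
      using \<eta>[OF M] x by (auto simp: Iso_def bij_betw_def)
    have "compose (carrier (T (S M))) f (\<eta> M) = compose (carrier (T (S M))) g (\<eta> M)"
      using nat[OF M N f] nat[OF M N g] eq by simp
    from fun_cong[OF this, of y] show ?thesis using y by (simp add: compose_def)
  qed
  then show ?thesis by (rule Hom_eqI[OF f g])
qed

text \<open>The preimage of f is the conjugate of S f by the isomorphisms \<epsilon> M and
  \<epsilon> N. Naturality of \<epsilon> gives S (T g) = S f, and S is faithful by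
  \<open>TS\<close>.\<close>

lemma natural_iso_full:
  assumes S: "linear_functor F A B S S1" and T: "linear_functor F B A T T1"
    and TS: "naturally_isomorphic A A (\<lambda>M. T (S M)) (\<lambda>M N f. T1 (S M) (S N) (S1 M N f))
      (\<lambda>M. M) (\<lambda>M N f. f)"
    and ST: "naturally_isomorphic B B (\<lambda>M. S (T M)) (\<lambda>M N f. S1 (T M) (T N) (T1 M N f))
      (\<lambda>M. M) (\<lambda>M N f. f)"
    and M: "right_module B M" and N: "right_module B N" and f: "f \<in> Hom A (T M) (T N)"
  shows "\<exists>g\<in>Hom B M N. T1 M N g = f"
proof -
  interpret S: linear_functor F A B S S1 by (rule S)
  interpret T: linear_functor F B A T T1 by (rule T)
  obtain \<epsilon> where \<epsilon>: "\<And>M. right_module B M \<Longrightarrow> \<epsilon> M \<in> Iso B (S (T M)) M"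
    and nat: "\<And>M N f. right_module B M \<Longrightarrow> right_module B N \<Longrightarrow> f \<in> Hom B M N \<Longrightarrow>
      compose (carrier (S (T M))) (\<epsilon> N) (S1 (T M) (T N) (T1 M N f)) =
      compose (carrier (S (T M))) f (\<epsilon> M)"
    using ST unfolding naturally_isomorphic_def by blast
  note TM = T.obj[OF M] and TN = T.obj[OF N]
  note STM = S.obj[OF TM] and STN = S.obj[OF TN] and Sf = S.map[OF TM TN f]
  obtain \<epsilon>' where \<epsilon>': "\<epsilon>' \<in> Hom B M (S (T M))" "\<And>x. x \<in> carrier (S (T M)) \<Longrightarrow> \<epsilon>' (\<epsilon> M x) = x"
    by (rule Iso_inverseE[OF STM M \<epsilon>[OF M]]) (rule that)
  have \<epsilon>N: "\<epsilon> N \<in> Hom B (S (T N)) N" using \<epsilon>[OF N] by (simp add: Iso_def)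
  have \<epsilon>M: "\<epsilon> M \<in> Hom B (S (T M)) M" using \<epsilon>[OF M] by (simp add: Iso_def)
  define g where "g = compose (carrier M) (\<epsilon> N) (compose (carrier M) (S1 (T M) (T N) f) \<epsilon>')"
  have g: "g \<in> Hom B M N"
    unfolding g_def by (rule Hom_compose[OF M Hom_compose[OF M \<epsilon>'(1) Sf] \<epsilon>N])
  have STg: "S1 (T M) (T N) (T1 M N g) \<in> Hom B (S (T M)) (S (T N))"
    by (rule S.map[OF TM TN T.map[OF M N g]])
  have "S1 (T M) (T N) (T1 M N g) = S1 (T M) (T N) f"
  proof (rule Hom_eqI[OF STg Sf])
    fix x assume x: "x \<in> carrier (S (T M))"
    have "\<epsilon> N (S1 (T M) (T N) (T1 M N g) x) = g (\<epsilon> M x)"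
      using fun_cong[OF nat[OF M N g], of x] x by (simp add: compose_def)
    also have "\<dots> = \<epsilon> N (S1 (T M) (T N) f x)"
      using x \<epsilon>' Hom_closed[OF \<epsilon>M] by (simp add: g_def compose_def)
    finally show "S1 (T M) (T N) (T1 M N g) x = S1 (T M) (T N) f x"
      using \<epsilon>[OF N] Hom_closed[OF STg x] Hom_closed[OF Sf x]
      by (auto simp: Iso_def bij_betw_def dest: inj_onD)
  qed
  then have "T1 M N g = f"
    by (rule natural_iso_faithful[of A T S T1 S1, OF TS TM TN T.map[OF M N g] f])
  then show ?thesis using g by blast
qed

section \<open>The equivalence given by a full idempotent\<close>

text \<open>The module M e. The map \<open>g\<close> is meant to be an isomorphism from B to eAe; it
  is built in so that the functor ends in B-modules directly.\<close>

definition corner_module ::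
  "('a, 'r) ring_scheme \<Rightarrow> 'a \<Rightarrow> ('b \<Rightarrow> 'a) \<Rightarrow> ('a, 'u) module \<Rightarrow> ('b, 'u) module" where
  "corner_module A e g M = \<lparr>carrier = {x \<in> carrier M. e \<odot>\<^bsub>M\<^esub> x = x}, mult = (\<lambda>u v. u),
     one = zero M, zero = zero M, add = add M, smult = (\<lambda>b x. g b \<odot>\<^bsub>M\<^esub> x)\<rparr>"

lemma corner_module_simps [simp]:
  "carrier (corner_module A e g M) = {x \<in> carrier M. e \<odot>\<^bsub>M\<^esub> x = x}"
  "zero (corner_module A e g M) = zero M" "add (corner_module A e g M) = add M"
  "b \<odot>\<^bsub>corner_module A e g M\<^esub> x = g b \<odot>\<^bsub>M\<^esub> x"
  by (simp_all add: corner_module_def)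

locale corner_equivalence = idempotent_algebra F A e + B: assoc_algebra F B
  for F :: "('f, 'r) ring_scheme" and A :: "('f, 'a, 's) module_scheme" (structure) and e
    and B :: "('f, 'b, 't) module_scheme" +
  fixes g :: "'b \<Rightarrow> 'a"
  assumes g_iso: "g \<in> algebra_isos F B (corner A e)" and full: "\<one> \<in> AeA"
begin

lemma g_C: "b \<in> carrier B \<Longrightarrow> g b \<in> carrier C"
  using g_iso by (auto simp: algebra_isos_def ring_hom_def)

lemma g_closed [simp]: "b \<in> carrier B \<Longrightarrow> g b \<in> carrier A"
  and g_left: "b \<in> carrier B \<Longrightarrow> e \<otimes> g b = g b"
  and g_right: "b \<in> carrier B \<Longrightarrow> g b \<otimes> e = g b"
  using g_C[of b] by (auto simp: C_iff)

lemma g_mult: "b \<in> carrier B \<Longrightarrow> c \<in> carrier B \<Longrightarrow> g (b \<otimes>\<^bsub>B\<^esub> c) = g b \<otimes> g c"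
  and g_add: "b \<in> carrier B \<Longrightarrow> c \<in> carrier B \<Longrightarrow> g (b \<oplus>\<^bsub>B\<^esub> c) = g b \<oplus> g c"
  and g_one: "g \<one>\<^bsub>B\<^esub> = e"
  and g_smult: "c' \<in> carrier F \<Longrightarrow> b \<in> carrier B \<Longrightarrow> g (c' \<odot>\<^bsub>B\<^esub> b) = c' \<odot> g b"
  using g_iso by (auto simp: algebra_isos_def ring_hom_def)

lemma g_surj: "c \<in> carrier C \<Longrightarrow> \<exists>b\<in>carrier B. c = g b"
  using g_iso by (auto simp: algebra_isos_def bij_betw_def)

lemma g_inj: "b \<in> carrier B \<Longrightarrow> c \<in> carrier B \<Longrightarrow> g b = g c \<Longrightarrow> b = c"
  using g_iso by (auto simp: algebra_isos_def bij_betw_def dest: inj_onD)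

abbreviation cm where "cm \<equiv> corner_module A e g"

lemma corner_right_module:
  assumes "right_module A M"
  shows "right_module B (cm M)"
proof -
  interpret M: right_module A M by fact
  have e_fix: "e \<odot>\<^bsub>M\<^esub> (\<ominus>\<^bsub>M\<^esub> x) = \<ominus>\<^bsub>M\<^esub> x" if "x \<in> carrier M" "e \<odot>\<^bsub>M\<^esub> x = x" for x
  proof -
    have "e \<odot>\<^bsub>M\<^esub> (\<ominus>\<^bsub>M\<^esub> x) \<oplus>\<^bsub>M\<^esub> x = e \<odot>\<^bsub>M\<^esub> (\<ominus>\<^bsub>M\<^esub> x \<oplus>\<^bsub>M\<^esub> x)"
      using that M.act_add_right[of e "\<ominus>\<^bsub>M\<^esub> x" x] by simp
    also have "\<dots> = \<zero>\<^bsub>M\<^esub>"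
      using that right_module_act_zero[OF assms] by (simp add: M.M.l_neg)
    finally show ?thesis
      using that M.M.minus_equality M.act_closed by (metis M.M.a_inv_closed e_closed)
  qed
  interpret cm: abelian_group "cm M"
  proof (rule abelian_groupI)
    fix x assume "x \<in> carrier (cm M)"
    then show "\<exists>y\<in>carrier (cm M). y \<oplus>\<^bsub>cm M\<^esub> x = \<zero>\<^bsub>cm M\<^esub>"
      by (intro bexI[of _ "\<ominus>\<^bsub>M\<^esub> x"]) (auto simp: M.M.l_neg e_fix)
  qed (auto simp: M.act_add_right M.M.a_ac right_module_act_zero[OF assms])
  have g_e: "e \<odot>\<^bsub>M\<^esub> (g b \<odot>\<^bsub>M\<^esub> x) = g b \<odot>\<^bsub>M\<^esub> x" if "b \<in> carrier B" "x \<in> carrier M" for b x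
    using M.act_assoc[of "g b" e x] that by (simp add: g_right)
  show ?thesis
    by unfold_locales
      (auto simp: M.act_closed g_e M.act_add_left M.act_add_right g_add g_mult M.act_assoc g_one)
qed

lemma Hom_corner:
  assumes "right_module A M" "right_module A N" "f \<in> Hom A M N"
  shows "restrict f (carrier (cm M)) \<in> Hom B (cm M) (cm N)"
proof -
  interpret cM: right_module B "cm M" by (rule corner_right_module[OF assms(1)])
  note cl = cM.act_closed cM.M.a_closed
  have "e \<odot>\<^bsub>N\<^esub> f x = f x" if "x \<in> carrier M" "e \<odot>\<^bsub>M\<^esub> x = x" for x
    using Hom_act[OF assms(3) e_closed that(1)] that(2) by simp
  then show ?thesis
    by (intro HomI)
      (use cl in \<open>auto simp: Hom_closed[OF assms(3)]
        Hom_add[OF assms(3)] Hom_act[OF assms(3)]\<close>)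
qed

lemma corner_linear_functor:
  "linear_functor F A B cm (\<lambda>M N f. restrict f (carrier (cm M)))"
proof (rule linear_functor.intro)
  fix M N :: "('a, 'u) module" and f c
  assume *: "right_module A M" "right_module A N" "f \<in> Hom A M N" "c \<in> carrier F"
  interpret N: right_module A N by (rule *(2))
  have "(c \<odot> \<one>) \<odot>\<^bsub>N\<^esub> f x = g (c \<odot>\<^bsub>B\<^esub> \<one>\<^bsub>B\<^esub>) \<odot>\<^bsub>N\<^esub> f x"
    if x: "x \<in> carrier M" "e \<odot>\<^bsub>M\<^esub> x = x" for x
  proof -
    have fx: "f x \<in> carrier N" "e \<odot>\<^bsub>N\<^esub> f x = f x"
      using Hom_closed[OF *(3) x(1)] Hom_act[OF *(3) e_closed x(1)] x by simp_all
    have "g (c \<odot>\<^bsub>B\<^esub> \<one>\<^bsub>B\<^esub>) = e \<otimes> (c \<odot> \<one>)"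
      using *(4) g_smult[of c "\<one>\<^bsub>B\<^esub>"] by (simp add: g_one smult_one_mult)
    then show ?thesis
      using N.act_assoc[of e "c \<odot> \<one>" "f x"] fx *(4) by simp
  qed
  then show "restrict (\<lambda>x\<in>carrier M. (c \<odot> \<one>) \<odot>\<^bsub>N\<^esub> f x) (carrier (cm M)) =
      (\<lambda>x\<in>carrier (cm M). (c \<odot>\<^bsub>B\<^esub> \<one>\<^bsub>B\<^esub>) \<odot>\<^bsub>cm N\<^esub> restrict f (carrier (cm M)) x)"
    by (auto simp: fun_eq_iff)
next
  fix L M N :: "('a, 'u) module" and f h
  assume *: "right_module A L" "right_module A M" "right_module A N"
    "f \<in> Hom A L M" "h \<in> Hom A M N"
  have "e \<odot>\<^bsub>M\<^esub> f x = f x" if "x \<in> carrier L" "e \<odot>\<^bsub>L\<^esub> x = x" for x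
    using Hom_act[OF *(4) e_closed that(1)] that(2) by simp
  then show "restrict (compose (carrier L) h f) (carrier (cm L)) =
      compose (carrier (cm L)) (restrict h (carrier (cm M))) (restrict f (carrier (cm L)))"
    using Hom_closed[OF *(4)] by (auto simp: fun_eq_iff compose_def)
qed (auto simp: corner_right_module Hom_corner fun_eq_iff simp del: corner_module_simps(1),
  auto)

text \<open>By fullness m = m 1 is a sum of elements (m x e) y, and the maps agree at each m x e in
  M e.\<close>

lemma corner_faithful:
  assumes M: "right_module A M" and N: "right_module A N" and f: "f \<in> Hom A M N"
    and f': "f' \<in> Hom A M N" and eq: "restrict f (carrier (cm M)) = restrict f' (carrier (cm M))"
  shows "f = f'"
proof (rule Hom_eqI[OF f f'])
  interpret M: right_module A M by fact
  interpret N: right_module A N by fact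
  fix m assume m: "m \<in> carrier M"
  have ee: "e \<odot>\<^bsub>M\<^esub> (e \<odot>\<^bsub>M\<^esub> x) = e \<odot>\<^bsub>M\<^esub> x" if "x \<in> carrier M" for x
    using M.act_assoc[of e e x] that by simp
  have eq': "f (e \<odot>\<^bsub>M\<^esub> x) = f' (e \<odot>\<^bsub>M\<^esub> x)" if "x \<in> carrier M" for x
    using fun_cong[OF eq, of "e \<odot>\<^bsub>M\<^esub> x"] that ee by (simp add: M.act_closed)
  have "f (a \<odot>\<^bsub>M\<^esub> m) = f' (a \<odot>\<^bsub>M\<^esub> m)" if "a \<in> carrier A" for a
    using full that
  proof (induction rule: full_induct)
    case zero
    then show ?case
      by (simp add: right_module_zero_act[OF M m] Hom_zero[OF M N f] Hom_zero[OF M N f'])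
  next
    case (add x y z)
    then show ?case
      using eq'[of "x \<odot>\<^bsub>M\<^esub> m"] m
      by (simp add: M.act_add_left M.act_assoc M.act_closed Hom_add[OF f] Hom_add[OF f']
          Hom_act[OF f] Hom_act[OF f'])
  qed
  from this[of \<one>] show "f m = f' m" using m by (simp add: M.act_one)
qed

text \<open>An extension of h must send a sum of elements u y with u in M e to the sum of the (h u)
  y. Rather than comparing different decompositions of m, the proof singles out f m by a relation
  \<open>P\<close> that no second value can satisfy.\<close>

lemma corner_full:
  assumes M: "right_module A M" and N: "right_module A N" and h: "h \<in> Hom B (cm M) (cm N)"
  shows "\<exists>f\<in>Hom A M N. restrict f (carrier (cm M)) = h"
proof -
  interpret M: right_module A M by fact
  interpret N: right_module A N by fact
  note cM = corner_right_module[OF M] and cN = corner_right_module[OF N]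
  have ee: "e \<odot>\<^bsub>M\<^esub> (e \<odot>\<^bsub>M\<^esub> x) = e \<odot>\<^bsub>M\<^esub> x" if "x \<in> carrier M" for x
    using M.act_assoc[of e e x] that by simp
  have hN: "h u \<in> carrier N" "e \<odot>\<^bsub>N\<^esub> h u = h u" if "u \<in> carrier M" "e \<odot>\<^bsub>M\<^esub> u = u" for u
    using Hom_closed[OF h, of u] that by auto
  have h_act: "h (e \<odot>\<^bsub>M\<^esub> (a \<odot>\<^bsub>M\<^esub> u)) = e \<odot>\<^bsub>N\<^esub> (a \<odot>\<^bsub>N\<^esub> h u)"
    if a: "a \<in> carrier A" and u: "u \<in> carrier M" "e \<odot>\<^bsub>M\<^esub> u = u" for a u
  proof -
    \<comment> \<open>As e fixes u, acting by a and then by e amounts to acting by e a e, an element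
      of eAe, and h respects these.\<close>
    obtain b where b: "b \<in> carrier B" "e \<otimes> (a \<otimes> e) = g b" using g_surj[OF C_I[OF a]] by auto
    have "h (g b \<odot>\<^bsub>M\<^esub> u) = g b \<odot>\<^bsub>N\<^esub> h u" using Hom_act[OF h b(1), of u] u by simp
    then show ?thesis
      unfolding b(2)[symmetric] using a u hN[OF u] by (simp add: M.act_assoc N.act_assoc)
  qed
  have h_add: "h (u \<oplus>\<^bsub>M\<^esub> v) = h u \<oplus>\<^bsub>N\<^esub> h v"
    if "u \<in> carrier M" "e \<odot>\<^bsub>M\<^esub> u = u" "v \<in> carrier M" "e \<odot>\<^bsub>M\<^esub> v = v" for u v
    using Hom_add[OF h, of u v] that by simp
  have h_zero: "h \<zero>\<^bsub>M\<^esub> = \<zero>\<^bsub>N\<^esub>" using Hom_zero[OF cM cN h] by simp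
  \<comment> \<open>as \<open>AeA = A\<close>, the value \<open>n = f m\<close> is determined by \<open>n b e = h (m b e)\<close> for all \<open>b\<close>\<close>
  define P where "P m n \<longleftrightarrow> n \<in> carrier N \<and>
    (\<forall>b\<in>carrier A. e \<odot>\<^bsub>N\<^esub> (b \<odot>\<^bsub>N\<^esub> n) = h (e \<odot>\<^bsub>M\<^esub> (b \<odot>\<^bsub>M\<^esub> m)))" for m n
  have unique: "n = n'" if "P m n" "P m n'" for m n n'
  proof -
    have n: "n \<in> carrier N" "n' \<in> carrier N" using that by (auto simp: P_def)
    have "a \<odot>\<^bsub>N\<^esub> n = a \<odot>\<^bsub>N\<^esub> n'" if "a \<in> carrier A" for a
      using full that
    proof (induction rule: full_induct)
      case zero
      then show ?case by (simp add: right_module_zero_act[OF N] n)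
    next
      case (add x y z)
      then have "e \<odot>\<^bsub>N\<^esub> (x \<odot>\<^bsub>N\<^esub> n) = e \<odot>\<^bsub>N\<^esub> (x \<odot>\<^bsub>N\<^esub> n')"
        using \<open>P m n\<close> \<open>P m n'\<close> by (simp add: P_def)
      then show ?case using add n by (simp add: N.act_add_left N.act_assoc N.act_closed)
    qed
    from this[of \<one>] show ?thesis using n by (simp add: N.act_one)
  qed
  have ex: "\<exists>n. P (a \<odot>\<^bsub>M\<^esub> m) n" if m: "m \<in> carrier M" and "a \<in> carrier A" for a m
    using full that(2)
  proof (induction rule: full_induct)
    case zero
    show ?case
      by (rule exI[of _ "\<zero>\<^bsub>N\<^esub>"])
        (simp add: P_def right_module_zero_act[OF M m] right_module_act_zero[OF M]
          right_module_act_zero[OF N] h_zero)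
  next
    case (add x y z)
    then obtain n where n: "P (z \<odot>\<^bsub>M\<^esub> m) n" by auto
    then have nN: "n \<in> carrier N" by (simp add: P_def)
    \<comment> \<open>The term x e y contributes u y with u = m x e, so the value grows by (h u)
      y.\<close>
    let ?u = "e \<odot>\<^bsub>M\<^esub> (x \<odot>\<^bsub>M\<^esub> m)"
    have u: "?u \<in> carrier M" "e \<odot>\<^bsub>M\<^esub> ?u = ?u" using m add ee by (simp_all add: M.act_closed)
    have "P ((x \<otimes> e \<otimes> y \<oplus> z) \<odot>\<^bsub>M\<^esub> m) (y \<odot>\<^bsub>N\<^esub> h ?u \<oplus>\<^bsub>N\<^esub> n)"
      unfolding P_def
    proof (intro conjI ballI)
      show "y \<odot>\<^bsub>N\<^esub> h ?u \<oplus>\<^bsub>N\<^esub> n \<in> carrier N"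
        using add nN hN[OF u] by (simp add: N.act_closed)
      fix b assume b: "b \<in> carrier A"
      have "(x \<otimes> e \<otimes> y \<oplus> z) \<odot>\<^bsub>M\<^esub> m = y \<odot>\<^bsub>M\<^esub> ?u \<oplus>\<^bsub>M\<^esub> z \<odot>\<^bsub>M\<^esub> m"
        using add m by (simp add: M.act_add_left M.act_assoc M.act_closed)
      then have "e \<odot>\<^bsub>M\<^esub> (b \<odot>\<^bsub>M\<^esub> ((x \<otimes> e \<otimes> y \<oplus> z) \<odot>\<^bsub>M\<^esub> m)) =
          e \<odot>\<^bsub>M\<^esub> ((y \<otimes> b) \<odot>\<^bsub>M\<^esub> ?u) \<oplus>\<^bsub>M\<^esub> e \<odot>\<^bsub>M\<^esub> (b \<odot>\<^bsub>M\<^esub> (z \<odot>\<^bsub>M\<^esub> m))"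
        using add m b u by (simp add: M.act_add_right M.act_assoc M.act_closed)
      then have "h (e \<odot>\<^bsub>M\<^esub> (b \<odot>\<^bsub>M\<^esub> ((x \<otimes> e \<otimes> y \<oplus> z) \<odot>\<^bsub>M\<^esub> m))) =
          h (e \<odot>\<^bsub>M\<^esub> ((y \<otimes> b) \<odot>\<^bsub>M\<^esub> ?u)) \<oplus>\<^bsub>N\<^esub> h (e \<odot>\<^bsub>M\<^esub> (b \<odot>\<^bsub>M\<^esub> (z \<odot>\<^bsub>M\<^esub> m)))"
        using h_add add m b u ee by (simp add: M.act_closed)
      also have "h (e \<odot>\<^bsub>M\<^esub> ((y \<otimes> b) \<odot>\<^bsub>M\<^esub> ?u)) = e \<odot>\<^bsub>N\<^esub> ((y \<otimes> b) \<odot>\<^bsub>N\<^esub> h ?u)"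
        by (rule h_act[OF _ u]) (use add b in auto)
      also have "h (e \<odot>\<^bsub>M\<^esub> (b \<odot>\<^bsub>M\<^esub> (z \<odot>\<^bsub>M\<^esub> m))) = e \<odot>\<^bsub>N\<^esub> (b \<odot>\<^bsub>N\<^esub> n)"
        using n b by (simp add: P_def)
      finally show "e \<odot>\<^bsub>N\<^esub> (b \<odot>\<^bsub>N\<^esub> (y \<odot>\<^bsub>N\<^esub> h ?u \<oplus>\<^bsub>N\<^esub> n)) =
          h (e \<odot>\<^bsub>M\<^esub> (b \<odot>\<^bsub>M\<^esub> ((x \<otimes> e \<otimes> y \<oplus> z) \<odot>\<^bsub>M\<^esub> m)))"
        using add b nN hN[OF u] by (simp add: N.act_add_right N.act_assoc N.act_closed)
    qed
    then show ?case by blast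
  qed
  define f where "f = (\<lambda>m\<in>carrier M. THE n. P m n)"
  have Pf: "P m (f m)" if m: "m \<in> carrier M" for m
  proof -
    have "\<exists>n. P m n" using ex[OF m one_closed] m by (simp add: M.act_one)
    then obtain n where n: "P m n" ..
    have "P m (THE n. P m n)"
      by (rule theI[of "P m", OF n]) (rule unique[OF _ n])
    then show ?thesis using m by (simp add: f_def)
  qed
  have fI: "f m = n" if "m \<in> carrier M" "P m n" for m n
    using unique Pf that by blast
  have fN: "f m \<in> carrier N" if "m \<in> carrier M" for m
    using Pf[OF that] by (simp add: P_def)
  have Pf': "e \<odot>\<^bsub>N\<^esub> (b \<odot>\<^bsub>N\<^esub> f m) = h (e \<odot>\<^bsub>M\<^esub> (b \<odot>\<^bsub>M\<^esub> m))"
    if "m \<in> carrier M" "b \<in> carrier A" for m b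
    using Pf[OF that(1)] that(2) by (simp add: P_def)
  have "f \<in> Hom A M N"
  proof (rule HomI)
    show "f \<in> extensional (carrier M)" by (simp add: f_def)
    fix m assume m: "m \<in> carrier M"
    then show "f m \<in> carrier N" by (rule fN)
    show "f (m \<oplus>\<^bsub>M\<^esub> m') = f m \<oplus>\<^bsub>N\<^esub> f m'" if m': "m' \<in> carrier M" for m'
      by (rule fI)
        (use m m' fN in \<open>auto simp: P_def N.act_add_right M.act_add_right N.act_closed M.act_closed
          Pf' h_add ee\<close>)
    show "f (a \<odot>\<^bsub>M\<^esub> m) = a \<odot>\<^bsub>N\<^esub> f m" if a: "a \<in> carrier A" for a
    proof (rule fI)
      show "P (a \<odot>\<^bsub>M\<^esub> m) (a \<odot>\<^bsub>N\<^esub> f m)"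
        unfolding P_def
      proof (intro conjI ballI)
        fix b assume "b \<in> carrier A"
        then show "e \<odot>\<^bsub>N\<^esub> (b \<odot>\<^bsub>N\<^esub> (a \<odot>\<^bsub>N\<^esub> f m)) = h (e \<odot>\<^bsub>M\<^esub> (b \<odot>\<^bsub>M\<^esub> (a \<odot>\<^bsub>M\<^esub> m)))"
          using Pf'[OF m, of "a \<otimes> b"] m fN[OF m] a by (simp add: N.act_assoc M.act_assoc)
      qed (use a fN[OF m] N.act_closed in auto)
    qed (use a m M.act_closed in auto)
  qed
  moreover have "restrict f (carrier (cm M)) = h"
  proof (rule extensionalityI)
    show "h \<in> extensional (carrier (cm M))" by (rule Hom_extensional[OF h])
    fix u assume "u \<in> carrier (cm M)"
    then have u: "u \<in> carrier M" "e \<odot>\<^bsub>M\<^esub> u = u" by auto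
    have "f u = h u"
      by (rule fI) (use u hN[OF u] h_act[OF _ u] in \<open>auto simp: P_def\<close>)
    then show "restrict f (carrier (cm M)) u = h u" using u by simp
  qed simp
  ultimately show ?thesis by blast
qed

end

section \<open>Essential surjectivity of the functor M |-> M e\<close>

context corner_equivalence
begin

abbreviation Ae where "Ae \<equiv> {x \<in> carrier A. x \<otimes> e = x}"

text \<open>
  \<open>hom_set N\<close> is \<open>Hom\<^bsub>eAe\<^esub>(A e, N)\<close>, where \<open>eAe\<close> acts on \<open>N\<close> through the inverse of \<open>g\<close>.
\<close>

definition hom_set :: "('b, 'u) module \<Rightarrow> ('a \<Rightarrow> 'u) set" where
  "hom_set N = {f \<in> extensional Ae. (\<forall>x\<in>Ae. f x \<in> carrier N) \<and>
    (\<forall>x\<in>Ae. \<forall>y\<in>Ae. f (x \<oplus> y) = f x \<oplus>\<^bsub>N\<^esub> f y) \<and>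
    (\<forall>x\<in>Ae. \<forall>b\<in>carrier B. f (x \<otimes> g b) = b \<odot>\<^bsub>N\<^esub> f x)}"

definition hom_module :: "('b, 'u) module \<Rightarrow> ('a, 'a \<Rightarrow> 'u) module" where
  "hom_module N = \<lparr>carrier = hom_set N, mult = (\<lambda>u v. u), one = (\<lambda>x\<in>Ae. \<zero>\<^bsub>N\<^esub>),
     zero = (\<lambda>x\<in>Ae. \<zero>\<^bsub>N\<^esub>), add = (\<lambda>u v. \<lambda>x\<in>Ae. u x \<oplus>\<^bsub>N\<^esub> v x),
     smult = (\<lambda>a u. \<lambda>x\<in>Ae. u (a \<otimes> x))\<rparr>"

lemma hom_module_simps [simp]:
  "carrier (hom_module N) = hom_set N" "zero (hom_module N) = (\<lambda>x\<in>Ae. \<zero>\<^bsub>N\<^esub>)"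
  "u \<oplus>\<^bsub>hom_module N\<^esub> v = (\<lambda>x\<in>Ae. u x \<oplus>\<^bsub>N\<^esub> v x)"
  "a \<odot>\<^bsub>hom_module N\<^esub> u = (\<lambda>x\<in>Ae. u (a \<otimes> x))"
  by (simp_all add: hom_module_def)

lemma Ae_add: "x \<in> Ae \<Longrightarrow> y \<in> Ae \<Longrightarrow> x \<oplus> y \<in> Ae"
  and Ae_left_mult: "x \<in> Ae \<Longrightarrow> a \<in> carrier A \<Longrightarrow> a \<otimes> x \<in> Ae"
  and Ae_right_mult: "x \<in> Ae \<Longrightarrow> b \<in> carrier B \<Longrightarrow> x \<otimes> g b \<in> Ae"
  and e_Ae: "e \<in> Ae"
  by (auto simp: l_distr m_assoc g_right)

lemma hom_setD:
  assumes "u \<in> hom_set N"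
  shows "x \<in> Ae \<Longrightarrow> u x \<in> carrier N"
    and "x \<in> Ae \<Longrightarrow> y \<in> Ae \<Longrightarrow> u (x \<oplus> y) = u x \<oplus>\<^bsub>N\<^esub> u y"
    and "x \<in> Ae \<Longrightarrow> b \<in> carrier B \<Longrightarrow> u (x \<otimes> g b) = b \<odot>\<^bsub>N\<^esub> u x"
    and "u \<in> extensional Ae"
  using assms unfolding hom_set_def by blast+

lemma hom_setI:
  assumes "\<And>x. x \<in> Ae \<Longrightarrow> u x \<in> carrier N"
    and "\<And>x y. x \<in> Ae \<Longrightarrow> y \<in> Ae \<Longrightarrow> u (x \<oplus> y) = u x \<oplus>\<^bsub>N\<^esub> u y"
    and "\<And>x b. x \<in> Ae \<Longrightarrow> b \<in> carrier B \<Longrightarrow> u (x \<otimes> g b) = b \<odot>\<^bsub>N\<^esub> u x"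
  shows "restrict u Ae \<in> hom_set N"
  unfolding hom_set_def
proof (intro CollectI conjI ballI)
  show "restrict u Ae \<in> extensional Ae" by simp
  fix x assume x: "x \<in> Ae"
  show "restrict u Ae x \<in> carrier N" using assms(1)[OF x] x by simp
  show "restrict u Ae (x \<oplus> y) = restrict u Ae x \<oplus>\<^bsub>N\<^esub> restrict u Ae y" if y: "y \<in> Ae" for y
    using assms(2)[OF x y] Ae_add[OF x y] x y by simp
  show "restrict u Ae (x \<otimes> g b) = b \<odot>\<^bsub>N\<^esub> restrict u Ae x" if b: "b \<in> carrier B" for b
    using assms(3)[OF x b] Ae_right_mult[OF x b] x by simp
qed

lemma hom_set_eqI:
  assumes "u \<in> hom_set N" "v \<in> hom_set N" "\<And>x. x \<in> Ae \<Longrightarrow> u x = v x"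
  shows "u = v"
  using hom_setD(4)[OF assms(1)] hom_setD(4)[OF assms(2)] assms(3) by (rule extensionalityI)

lemma hom_right_module:
  assumes N: "right_module B N"
  shows "right_module A (hom_module N)"
proof -
  interpret N: right_module B N by fact
  have add: "(\<lambda>x\<in>Ae. u x \<oplus>\<^bsub>N\<^esub> v x) \<in> hom_set N" if uv: "u \<in> hom_set N" "v \<in> hom_set N" for u v
  proof (rule hom_setI)
    note u = hom_setD[OF uv(1)] and v = hom_setD[OF uv(2)]
    fix x assume x: "x \<in> Ae"
    show "u x \<oplus>\<^bsub>N\<^esub> v x \<in> carrier N" using u(1)[OF x] v(1)[OF x] by simp
    show "u (x \<otimes> g b) \<oplus>\<^bsub>N\<^esub> v (x \<otimes> g b) = b \<odot>\<^bsub>N\<^esub> (u x \<oplus>\<^bsub>N\<^esub> v x)" if "b \<in> carrier B" for b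
      using u(1,3)[OF x] v(1,3)[OF x] that by (simp add: N.act_add_right)
    show "u (x \<oplus> y) \<oplus>\<^bsub>N\<^esub> v (x \<oplus> y) = (u x \<oplus>\<^bsub>N\<^esub> v x) \<oplus>\<^bsub>N\<^esub> (u y \<oplus>\<^bsub>N\<^esub> v y)" if y: "y \<in> Ae" for y
      using u(2)[OF x y] v(2)[OF x y] u(1)[OF x] u(1)[OF y] v(1)[OF x] v(1)[OF y]
      by (simp add: N.M.a_ac)
  qed
  have zero: "(\<lambda>x\<in>Ae. \<zero>\<^bsub>N\<^esub>) \<in> hom_set N"
    by (rule hom_setI) (simp_all add: right_module_act_zero[OF N])
  have neg: "(\<lambda>x\<in>Ae. \<ominus>\<^bsub>N\<^esub> u x) \<in> hom_set N" if "u \<in> hom_set N" for u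
  proof (rule hom_setI)
    note u = hom_setD[OF that]
    fix x assume x: "x \<in> Ae"
    show "\<ominus>\<^bsub>N\<^esub> u x \<in> carrier N" using u(1)[OF x] by simp
    show "\<ominus>\<^bsub>N\<^esub> u (x \<oplus> y) = \<ominus>\<^bsub>N\<^esub> u x \<oplus>\<^bsub>N\<^esub> \<ominus>\<^bsub>N\<^esub> u y" if y: "y \<in> Ae" for y
      using u(2)[OF x y] u(1)[OF x] u(1)[OF y] by (simp add: N.M.minus_add)
    show "\<ominus>\<^bsub>N\<^esub> u (x \<otimes> g b) = b \<odot>\<^bsub>N\<^esub> (\<ominus>\<^bsub>N\<^esub> u x)" if b: "b \<in> carrier B" for b
    proof -
      have "b \<odot>\<^bsub>N\<^esub> (\<ominus>\<^bsub>N\<^esub> u x) \<oplus>\<^bsub>N\<^esub> b \<odot>\<^bsub>N\<^esub> u x = \<zero>\<^bsub>N\<^esub>"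
        using N.act_add_right[OF b, of "\<ominus>\<^bsub>N\<^esub> u x" "u x"] u(1)[OF x] right_module_act_zero[OF N b]
        by (simp add: N.M.l_neg)
      then show ?thesis
        using u(3)[OF x b] u(1)[OF x] b N.act_closed by (simp add: N.M.minus_equality)
    qed
  qed
  have act: "(\<lambda>x\<in>Ae. u (a \<otimes> x)) \<in> hom_set N" if u: "u \<in> hom_set N" and a: "a \<in> carrier A" for u a
  proof (rule hom_setI)
    note u = hom_setD[OF u]
    fix x assume x: "x \<in> Ae"
    note ax = Ae_left_mult[OF x a]
    show "u (a \<otimes> x) \<in> carrier N" by (rule u(1)[OF ax])
    show "u (a \<otimes> (x \<oplus> y)) = u (a \<otimes> x) \<oplus>\<^bsub>N\<^esub> u (a \<otimes> y)" if y: "y \<in> Ae" for y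
      using u(2)[OF ax Ae_left_mult[OF y a]] x y a by (simp add: r_distr)
    show "u (a \<otimes> (x \<otimes> g b)) = b \<odot>\<^bsub>N\<^esub> u (a \<otimes> x)" if b: "b \<in> carrier B" for b
      using u(3)[OF ax b] x a b by (simp add: m_assoc)
  qed
  interpret H: abelian_group "hom_module N"
  proof (rule abelian_groupI)
    fix u assume u: "u \<in> carrier (hom_module N)"
    then have "u x \<in> carrier N" if "x \<in> Ae" for x using hom_setD(1) that by simp
    then show "\<exists>v\<in>carrier (hom_module N). v \<oplus>\<^bsub>hom_module N\<^esub> u = \<zero>\<^bsub>hom_module N\<^esub>"
      using neg u by (intro bexI[of _ "\<lambda>x\<in>Ae. \<ominus>\<^bsub>N\<^esub> u x"]) (auto simp: fun_eq_iff N.M.l_neg)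
    show "\<zero>\<^bsub>hom_module N\<^esub> \<oplus>\<^bsub>hom_module N\<^esub> u = u"
      using u hom_setD(1)[of u N] hom_setD(4)[of u N]
      by (auto simp: fun_eq_iff restrict_def extensional_def)
  next
    fix u v assume "u \<in> carrier (hom_module N)" "v \<in> carrier (hom_module N)"
    then show "u \<oplus>\<^bsub>hom_module N\<^esub> v = v \<oplus>\<^bsub>hom_module N\<^esub> u"
      using hom_setD(1)[of u N] hom_setD(1)[of v N] by (auto simp: fun_eq_iff N.M.a_comm)
  next
    fix u v w assume "u \<in> carrier (hom_module N)" "v \<in> carrier (hom_module N)"
      "w \<in> carrier (hom_module N)"
    then show "u \<oplus>\<^bsub>hom_module N\<^esub> v \<oplus>\<^bsub>hom_module N\<^esub> w = u \<oplus>\<^bsub>hom_module N\<^esub> (v \<oplus>\<^bsub>hom_module N\<^esub> w)"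
      using hom_setD(1)[of u N] hom_setD(1)[of v N] hom_setD(1)[of w N]
      by (auto simp: fun_eq_iff N.M.a_assoc)
  qed (use add zero in auto)
  show ?thesis
  proof unfold_locales
    fix a u assume *: "a \<in> carrier A" "u \<in> carrier (hom_module N)"
    then show "a \<odot>\<^bsub>hom_module N\<^esub> u \<in> carrier (hom_module N)" using act by simp
    fix b assume b: "b \<in> carrier A"
    show "(a \<oplus> b) \<odot>\<^bsub>hom_module N\<^esub> u = a \<odot>\<^bsub>hom_module N\<^esub> u \<oplus>\<^bsub>hom_module N\<^esub> b \<odot>\<^bsub>hom_module N\<^esub> u"
    proof -
      have "u ((a \<oplus> b) \<otimes> x) = u (a \<otimes> x) \<oplus>\<^bsub>N\<^esub> u (b \<otimes> x)" if x: "x \<in> Ae" for x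
        using hom_setD(2)[of u N, OF _ Ae_left_mult[OF x *(1)] Ae_left_mult[OF x b]] * b x
        by (simp add: l_distr)
      then show ?thesis by (simp add: fun_eq_iff)
    qed
    show "(a \<otimes> b) \<odot>\<^bsub>hom_module N\<^esub> u = b \<odot>\<^bsub>hom_module N\<^esub> (a \<odot>\<^bsub>hom_module N\<^esub> u)"
      using * b by (auto simp: fun_eq_iff m_assoc)
  next
    fix a u v assume "a \<in> carrier A" "u \<in> carrier (hom_module N)" "v \<in> carrier (hom_module N)"
    then show "a \<odot>\<^bsub>hom_module N\<^esub> (u \<oplus>\<^bsub>hom_module N\<^esub> v) =
        a \<odot>\<^bsub>hom_module N\<^esub> u \<oplus>\<^bsub>hom_module N\<^esub> a \<odot>\<^bsub>hom_module N\<^esub> v"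
      by (auto simp: fun_eq_iff m_assoc)
  next
    fix u assume "u \<in> carrier (hom_module N)"
    then show "\<one> \<odot>\<^bsub>hom_module N\<^esub> u = u"
      using hom_setD(4)[of u N] by (auto simp: fun_eq_iff restrict_def extensional_def)
  qed
qed

text \<open>
  Finitely many values suffice because \<open>1\<close> is a finite sum of elements \<open>x e y\<close>; this is what
  makes the module fit into the universe.
\<close>

lemma hom_set_determined:
  assumes "a \<in> carrier A"
  shows "\<exists>X. finite X \<and> X \<subseteq> Ae \<and> (\<forall>u\<in>hom_set N. \<forall>v\<in>hom_set N. (\<forall>x\<in>X. u x = v x) \<longrightarrow>
    (\<forall>z\<in>Ae. u (a \<otimes> z) = v (a \<otimes> z)))"
  using full assms
proof (induction rule: full_induct)
  case zero
  \<comment> \<open>Writing 0 as e times the image of the zero of B shows that u 0 is this zero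
    acting on u e. So the point e determines it.\<close>
  have "u \<zero> = v \<zero>" if uv: "u \<in> hom_set N" "v \<in> hom_set N" "u e = v e" for u v
  proof -
    have g0: "g \<zero>\<^bsub>B\<^esub> = \<zero>"
      using g_add[of "\<zero>\<^bsub>B\<^esub>" "\<zero>\<^bsub>B\<^esub>"] by (simp add: add.l_cancel_one)
    then show ?thesis
      using hom_setD(3)[OF uv(1) e_Ae, of "\<zero>\<^bsub>B\<^esub>"] hom_setD(3)[OF uv(2) e_Ae, of "\<zero>\<^bsub>B\<^esub>"] uv(3)
      by simp
  qed
  then show ?case using e_Ae by (intro exI[of _ "{e}"]) auto
next
  case (add x y z)
  from add.IH obtain X where X: "finite X" "X \<subseteq> Ae"
    and X_det: "\<forall>u\<in>hom_set N. \<forall>v\<in>hom_set N. (\<forall>x\<in>X. u x = v x) \<longrightarrow>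
      (\<forall>w\<in>Ae. u (z \<otimes> w) = v (z \<otimes> w))"
    by (elim exE conjE) (rule that)
  have xe: "x \<otimes> e \<in> Ae" using add by (simp add: m_assoc)
  show ?case
  proof (intro exI[of _ "insert (x \<otimes> e) X"] conjI ballI impI)
    fix u v w assume *: "u \<in> hom_set N" "v \<in> hom_set N" "\<forall>x\<in>insert (x \<otimes> e) X. u x = v x" "w \<in> Ae"
    \<comment> \<open>For w in A e the product x e y w is (x e)(e y w) with e y w in eAe, so its
      value is determined by the value at x e.\<close>
    have yw: "e \<otimes> (y \<otimes> w) \<in> carrier C" using add * by (simp add: C_iff m_assoc)
    obtain b where b: "b \<in> carrier B" "e \<otimes> (y \<otimes> w) = g b" using g_surj[OF yw] by auto
    have eq: "(x \<otimes> e \<otimes> y) \<otimes> w = (x \<otimes> e) \<otimes> g b"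
      using b(2) add * by (simp add: m_assoc flip: b(2))
    have zw: "u (z \<otimes> w) = v (z \<otimes> w)"
      using bspec[OF bspec[OF X_det *(1)] *(2)] *(3,4) by simp
    have Ae: "(x \<otimes> e) \<otimes> g b \<in> Ae" "z \<otimes> w \<in> Ae"
      using Ae_right_mult[OF xe b(1)] Ae_left_mult[OF *(4)] add by auto
    have "(x \<otimes> e \<otimes> y \<oplus> z) \<otimes> w = (x \<otimes> e) \<otimes> g b \<oplus> z \<otimes> w"
      using add * unfolding eq[symmetric] by (simp add: l_distr)
    then show "u ((x \<otimes> e \<otimes> y \<oplus> z) \<otimes> w) = v ((x \<otimes> e \<otimes> y \<oplus> z) \<otimes> w)"
      using hom_setD(2)[OF *(1) Ae] hom_setD(2)[OF *(2) Ae] hom_setD(3)[OF *(1) xe b(1)]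
        hom_setD(3)[OF *(2) xe b(1)] zw *(3) by simp
  qed (use X xe in auto)
qed

text \<open>M is Hom(A e, N), encoded by the values on a finite set. Then M e consists of the maps u
  with u (e x) = u x, and evaluation at e identifies it with N; the inverse sends n to the map x |->
  n (e x).\<close>

lemma corner_essentially_surjective:
  fixes N :: "('b, 'u) module"
  assumes inf: "infinite (UNIV :: 'u set)" and N: "right_module B N"
  shows "\<exists>M :: ('a, 'u) module. right_module A M \<and> Iso B (cm M) N \<noteq> {}"
proof -
  interpret N: right_module B N by fact
  interpret H: right_module A "hom_module N" by (rule hom_right_module[OF N])
  from hom_set_determined[OF one_closed, of N] obtain X where X: "finite X" "X \<subseteq> Ae"
    and det: "\<forall>u\<in>hom_set N. \<forall>v\<in>hom_set N. (\<forall>x\<in>X. u x = v x) \<longrightarrow>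
      (\<forall>z\<in>Ae. u (\<one> \<otimes> z) = v (\<one> \<otimes> z))"
    by (elim exE conjE) (rule that)
  obtain f :: "('a \<Rightarrow> 'u) \<Rightarrow> 'u" where f: "inj_on f (X \<rightarrow>\<^sub>E UNIV)"
    using finite_PiE_lepoll[OF inf X(1) lepoll_refl] by (auto simp: lepoll_def)
  \<comment> \<open>By the choice of X, \<open>q\<close> is injective on \<open>hom_set N\<close>,
    so the congruence conditions hold trivially.\<close>
  define q where "q u = f (restrict u X)" for u
  have q_inj: "u = v" if uv: "u \<in> hom_set N" "v \<in> hom_set N" "q u = q v" for u v
  proof -
    have "restrict u X = restrict v X"
      using uv(3) unfolding q_def by (rule inj_onD[OF f]) auto
    then have "u x = v x" if "x \<in> X" for x using that by (metis restrict_apply')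
    then have "u z = v z" if "z \<in> Ae" for z
      using bspec[OF bspec[OF det uv(1)] uv(2)] that by simp
    then show ?thesis by (rule hom_set_eqI[OF uv(1,2)])
  qed
  interpret q: module_congruence A "hom_module N" q
    by unfold_locales (use q_inj in \<open>auto simp: H.act_closed\<close>)
  define M where "M = image_module q (hom_module N)"
  have M: "right_module A M" unfolding M_def by (rule q.right_module_image)
  have M_carrier: "carrier M = q ` hom_set N" by (simp add: M_def q.image_carrier)
  have M_add: "q u \<oplus>\<^bsub>M\<^esub> q v = q (\<lambda>x\<in>Ae. u x \<oplus>\<^bsub>N\<^esub> v x)" if "u \<in> hom_set N" "v \<in> hom_set N" for u v
    using q.image_add[of u v] that by (simp add: M_def)
  have M_act: "a \<odot>\<^bsub>M\<^esub> q u = q (\<lambda>x\<in>Ae. u (a \<otimes> x))" if "u \<in> hom_set N" "a \<in> carrier A" for a u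
    using q.image_act[of u a] that by (simp add: M_def)
  have act_closed: "(\<lambda>x\<in>Ae. u (a \<otimes> x)) \<in> hom_set N" if "u \<in> hom_set N" "a \<in> carrier A" for a u
    using H.act_closed[of a u] that by simp
  have add_closed: "(\<lambda>x\<in>Ae. u x \<oplus>\<^bsub>N\<^esub> v x) \<in> hom_set N" if "u \<in> hom_set N" "v \<in> hom_set N" for u v
    using H.M.a_closed[of u v] that by simp
  have cm_cases: "\<exists>u\<in>hom_set N. s = q u \<and> (\<forall>x\<in>Ae. u (e \<otimes> x) = u x)"
    if s: "s \<in> carrier (cm M)" for s
  proof -
    obtain u where u: "u \<in> hom_set N" "s = q u" using s by (auto simp: M_carrier)
    then have "q (\<lambda>x\<in>Ae. u (e \<otimes> x)) = q u" using s M_act[OF u(1) e_closed] by simp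
    then have eq: "(\<lambda>x\<in>Ae. u (e \<otimes> x)) = u" by (rule q_inj[OF act_closed[OF u(1) e_closed] u(1)])
    have "u (e \<otimes> x) = u x" if "x \<in> Ae" for x using fun_cong[OF eq, of x] that by simp
    then show ?thesis using u by blast
  qed
  define E where "E = (\<lambda>s\<in>carrier (cm M). inv_into (hom_set N) q s e)"
  have inv_q: "inv_into (hom_set N) q (q u) = u" if "u \<in> hom_set N" for u
    using q_inj that by (intro inv_into_f_f) (auto simp: inj_on_def)
  have E: "E (q u) = u e" if "u \<in> hom_set N" "q u \<in> carrier (cm M)" for u
    unfolding E_def using inv_q[OF that(1)] that(2) by (simp only: restrict_apply if_True)
  define \<psi> where "\<psi> c = inv_into (carrier B) g c" for c
  have \<psi>: "\<psi> c \<in> carrier B" "g (\<psi> c) = c" if "c \<in> carrier C" for c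
    using g_surj[OF that] unfolding \<psi>_def by (auto intro: inv_into_into f_inv_into_f)
  have \<psi>_g: "\<psi> (g b) = b" if "b \<in> carrier B" for b
    using g_inj \<psi>[OF g_C[OF that]] that by blast
  have eAe: "e \<otimes> x \<in> carrier C" if "x \<in> Ae" for x using that by (simp add: C_iff m_assoc)
  \<comment> \<open>For x in A e the product e x lies in eAe, so it acts on N through \<psi>, the
    inverse of g.\<close>
  define ev where "ev n = (\<lambda>x\<in>Ae. \<psi> (e \<otimes> x) \<odot>\<^bsub>N\<^esub> n)" for n
  have ev: "ev n \<in> hom_set N" if n: "n \<in> carrier N" for n
    unfolding ev_def
  proof (rule hom_setI)
    fix x assume x: "x \<in> Ae"
    note ex = \<psi>[OF eAe[OF x]]
    show "\<psi> (e \<otimes> x) \<odot>\<^bsub>N\<^esub> n \<in> carrier N" by (rule N.act_closed[OF ex(1) n])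
    show "\<psi> (e \<otimes> (x \<oplus> y)) \<odot>\<^bsub>N\<^esub> n = \<psi> (e \<otimes> x) \<odot>\<^bsub>N\<^esub> n \<oplus>\<^bsub>N\<^esub> \<psi> (e \<otimes> y) \<odot>\<^bsub>N\<^esub> n"
      if y: "y \<in> Ae" for y
    proof -
      note ey = \<psi>[OF eAe[OF y]]
      have "e \<otimes> (x \<oplus> y) = g (\<psi> (e \<otimes> x) \<oplus>\<^bsub>B\<^esub> \<psi> (e \<otimes> y))"
        using g_add[OF ex(1) ey(1)] ex(2) ey(2) x y by (simp add: r_distr)
      then have "\<psi> (e \<otimes> (x \<oplus> y)) = \<psi> (e \<otimes> x) \<oplus>\<^bsub>B\<^esub> \<psi> (e \<otimes> y)"
        using \<psi>_g ex(1) ey(1) by simp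
      then show ?thesis using N.act_add_left[OF ex(1) ey(1) n] by simp
    qed
    show "\<psi> (e \<otimes> (x \<otimes> g b)) \<odot>\<^bsub>N\<^esub> n = b \<odot>\<^bsub>N\<^esub> (\<psi> (e \<otimes> x) \<odot>\<^bsub>N\<^esub> n)" if b: "b \<in> carrier B" for b
    proof -
      have "e \<otimes> (x \<otimes> g b) = (e \<otimes> x) \<otimes> g b"
        using x b by (simp add: m_assoc)
      also have "\<dots> = g (\<psi> (e \<otimes> x) \<otimes>\<^bsub>B\<^esub> b)"
        using g_mult[OF ex(1) b] ex(2) by simp
      finally have "\<psi> (e \<otimes> (x \<otimes> g b)) = \<psi> (e \<otimes> x) \<otimes>\<^bsub>B\<^esub> b"
        using \<psi>_g ex(1) b by simp
      then show ?thesis using N.act_assoc[OF ex(1) b n] by simp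
    qed
  qed
  have ev_fix: "(\<lambda>x\<in>Ae. ev n (e \<otimes> x)) = ev n" for n
    by (auto simp: ev_def fun_eq_iff m_assoc)
  have ev_cm: "q (ev n) \<in> carrier (cm M)" if n: "n \<in> carrier N" for n
    using M_act[OF ev[OF n] e_closed] ev[OF n] by (simp add: M_carrier ev_fix)
  have ev_e: "ev n e = n" if "n \<in> carrier N" for n
    using \<psi>_g[of "\<one>\<^bsub>B\<^esub>"] that N.act_one by (simp add: ev_def g_one)
  have u_ev: "ev (u e) = u" if u: "u \<in> hom_set N" "\<And>x. x \<in> Ae \<Longrightarrow> u (e \<otimes> x) = u x" for u
  proof (rule hom_set_eqI[OF ev[OF hom_setD(1)[OF u(1) e_Ae]] u(1)])
    fix x assume x: "x \<in> Ae"
    have "ev (u e) x = \<psi> (e \<otimes> x) \<odot>\<^bsub>N\<^esub> u e" using x by (simp add: ev_def)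
    also have "\<dots> = u (e \<otimes> g (\<psi> (e \<otimes> x)))"
      using hom_setD(3)[OF u(1) e_Ae \<psi>(1)[OF eAe[OF x]]] by simp
    also have "\<dots> = u x" using \<psi>(2)[OF eAe[OF x]] u(2)[OF x] x by simp
    finally show "ev (u e) x = u x" .
  qed
  interpret cM: right_module B "cm M" by (rule corner_right_module[OF M])
  have "E \<in> Hom B (cm M) N"
  proof (rule HomI)
    show "E \<in> extensional (carrier (cm M))" by (simp add: E_def)
    fix s assume s: "s \<in> carrier (cm M)"
    obtain u where u: "u \<in> hom_set N" "s = q u" "\<forall>x\<in>Ae. u (e \<otimes> x) = u x"
      using cm_cases[OF s] by auto
    show "E s \<in> carrier N"
      using E[OF u(1)] s u hom_setD(1)[OF u(1) e_Ae] by simp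
    show "E (s \<oplus>\<^bsub>cm M\<^esub> t) = E s \<oplus>\<^bsub>N\<^esub> E t" if t: "t \<in> carrier (cm M)" for t
    proof -
      obtain v where v: "v \<in> hom_set N" "t = q v" using cm_cases[OF t] by auto
      have "s \<oplus>\<^bsub>cm M\<^esub> t = q (\<lambda>x\<in>Ae. u x \<oplus>\<^bsub>N\<^esub> v x)" using M_add[OF u(1) v(1)] u v by simp
      moreover have "s \<oplus>\<^bsub>cm M\<^esub> t \<in> carrier (cm M)" by (rule cM.M.a_closed[OF s t])
      ultimately have "E (s \<oplus>\<^bsub>cm M\<^esub> t) = u e \<oplus>\<^bsub>N\<^esub> v e"
        using E[OF add_closed[OF u(1) v(1)]] by simp
      then show ?thesis using E[OF u(1)] E[OF v(1)] s t u v by simp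
    qed
    show "E (b \<odot>\<^bsub>cm M\<^esub> s) = b \<odot>\<^bsub>N\<^esub> E s" if b: "b \<in> carrier B" for b
    proof -
      have "b \<odot>\<^bsub>cm M\<^esub> s = q (\<lambda>x\<in>Ae. u (g b \<otimes> x))" using M_act[OF u(1) g_closed[OF b]] u by simp
      moreover have "b \<odot>\<^bsub>cm M\<^esub> s \<in> carrier (cm M)" by (rule cM.act_closed[OF b s])
      ultimately have "E (b \<odot>\<^bsub>cm M\<^esub> s) = u (g b \<otimes> e)"
        using E[OF act_closed[OF u(1) g_closed[OF b]]] by simp
      also have "\<dots> = u (e \<otimes> g b)" using b by (simp add: g_left g_right)
      also have "\<dots> = b \<odot>\<^bsub>N\<^esub> u e" by (rule hom_setD(3)[OF u(1) e_Ae b])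
      finally show ?thesis using E[OF u(1)] s u by simp
    qed
  qed
  moreover have "bij_betw E (carrier (cm M)) (carrier N)"
  proof (rule bij_betw_byWitness[of _ "\<lambda>n. q (ev n)"])
    show "\<forall>s\<in>carrier (cm M). q (ev (E s)) = s"
    proof
      fix s assume s: "s \<in> carrier (cm M)"
      obtain u where u: "u \<in> hom_set N" "s = q u" "\<forall>x\<in>Ae. u (e \<otimes> x) = u x"
        using cm_cases[OF s] by auto
      then show "q (ev (E s)) = s" using E[OF u(1)] s u_ev[OF u(1)] by simp
    qed
    show "\<forall>n\<in>carrier N. E (q (ev n)) = n"
      using E[OF ev ev_cm] ev_e by simp
    show "E ` carrier (cm M) \<subseteq> carrier N"
      using Hom_closed[OF \<open>E \<in> Hom B (cm M) N\<close>] by blast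
    show "(\<lambda>n. q (ev n)) ` carrier N \<subseteq> carrier (cm M)"
      using ev_cm by blast
  qed
  ultimately show ?thesis using M by (auto simp: Iso_def)
qed

theorem corner_morita_equivalent:
  assumes "infinite (UNIV :: 'u set)"
  shows "morita_equivalent TYPE('u) F A B"
  by (rule fully_faithful_equivalence[OF _ _ corner_linear_functor])
    (auto intro: corner_faithful corner_full corner_essentially_surjective[OF assms] assoc_algebra_axioms
      B.assoc_algebra_axioms simp del: corner_module_simps)

end

section \<open>Consequences of a Morita equivalence\<close>

locale morita_equivalence =
  A: assoc_algebra F A + B: assoc_algebra F B +
  S: linear_functor F A B S S1 + T: linear_functor F B A T T1
  for F :: "('f, 'r) ring_scheme" and A :: "('f, 'a, 's) module_scheme"
    and B :: "('f, 'b, 't) module_scheme"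
    and S :: "('a, 'u) module \<Rightarrow> ('b, 'u) module" and S1
    and T :: "('b, 'u) module \<Rightarrow> ('a, 'u) module" and T1 +
  assumes TS: "naturally_isomorphic A A (\<lambda>M. T (S M)) (\<lambda>M N f. T1 (S M) (S N) (S1 M N f))
      (\<lambda>M. M) (\<lambda>M N f. f)"
    and ST: "naturally_isomorphic B B (\<lambda>M. S (T M)) (\<lambda>M N f. S1 (T M) (T N) (T1 M N f))
      (\<lambda>M. M) (\<lambda>M N f. f)"
begin

lemmas S_faithful = natural_iso_faithful[of A T S T1 S1, OF TS]
lemmas T_faithful = natural_iso_faithful[of B S T S1 T1, OF ST]
lemmas T_full = natural_iso_full[OF S.linear_functor_axioms T.linear_functor_axioms TS ST]

end

text \<open>R is a copy of the regular B-module whose carrier lies in the universe, with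
  \<open>p\<close> as the identification. Its image P under T is the progenerator of A behind the
  equivalence.\<close>

locale morita_regular = morita_equivalence F A B S S1 T T1
  for F :: "('f, 'r) ring_scheme" and A :: "('f, 'a, 's) module_scheme"
    and B :: "('f, 'b, 't) module_scheme"
    and S :: "('a, 'u) module \<Rightarrow> ('b, 'u) module" and S1
    and T :: "('b, 'u) module \<Rightarrow> ('a, 'u) module" and T1 +
  fixes R :: "('b, 'u) module" and p
  assumes R: "right_module B R" and p: "p \<in> Hom B (ideal_module B (carrier B)) R"
    and p_surj: "p ` carrier B = carrier R" and p_inj: "inj_on p (carrier B)"
begin

sublocale R: right_module B R by (rule R)

abbreviation P where "P \<equiv> T R"

lemma P: "right_module A P" by (rule T.obj[OF R])

sublocale P: right_module A P by (rule P)

lemma p_closed: "b \<in> carrier B \<Longrightarrow> p b \<in> carrier R"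
  using Hom_closed[OF p, of b] by simp

lemma p_add: "b \<in> carrier B \<Longrightarrow> c \<in> carrier B \<Longrightarrow> p (b \<oplus>\<^bsub>B\<^esub> c) = p b \<oplus>\<^bsub>R\<^esub> p c"
  using Hom_add[OF p, of b c] by simp

lemma p_act: "b \<in> carrier B \<Longrightarrow> c \<in> carrier B \<Longrightarrow> p (b \<otimes>\<^bsub>B\<^esub> c) = c \<odot>\<^bsub>R\<^esub> p b"
  using Hom_act[OF p, of c b] by simp

lemma R_cases:
  assumes "r \<in> carrier R"
  obtains b where "b \<in> carrier B" "r = p b"
  using assms p_surj by blast

definition left where "left b = (\<lambda>r\<in>carrier R. p (b \<otimes>\<^bsub>B\<^esub> inv_into (carrier B) p r))"

lemma left_p: "b \<in> carrier B \<Longrightarrow> c \<in> carrier B \<Longrightarrow> left b (p c) = p (b \<otimes>\<^bsub>B\<^esub> c)"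
  by (simp add: left_def p_closed inv_into_f_f[OF p_inj])

lemma left_Hom:
  assumes b: "b \<in> carrier B"
  shows "left b \<in> Hom B R R"
proof (rule HomI)
  show "left b \<in> extensional (carrier R)" by (simp add: left_def)
  fix r assume "r \<in> carrier R"
  then obtain c where c: "c \<in> carrier B" "r = p c" by (rule R_cases)
  show "left b r \<in> carrier R" using b c by (simp add: left_p p_closed)
  show "left b (d \<odot>\<^bsub>R\<^esub> r) = d \<odot>\<^bsub>R\<^esub> left b r" if d: "d \<in> carrier B" for d
    using left_p[OF b, of "c \<otimes>\<^bsub>B\<^esub> d"] b c d by (simp add: left_p p_act p_closed R.act_assoc)
  fix r' assume "r' \<in> carrier R"
  then obtain c' where c': "c' \<in> carrier B" "r' = p c'" by (rule R_cases)
  show "left b (r \<oplus>\<^bsub>R\<^esub> r') = left b r \<oplus>\<^bsub>R\<^esub> left b r'"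
    using left_p[OF b, of "c \<oplus>\<^bsub>B\<^esub> c'"] b c c' by (simp add: left_p p_add B.r_distr)
qed

text \<open>An endomorphism of the regular module is determined by the image b of 1.\<close>

lemma End_R_eq_left:
  assumes "f \<in> Hom B R R"
  obtains b where "b \<in> carrier B" "f = left b"
proof -
  have "f (p \<one>\<^bsub>B\<^esub>) \<in> carrier R" by (rule Hom_closed[OF assms p_closed[OF B.one_closed]])
  then obtain b where b: "b \<in> carrier B" "f (p \<one>\<^bsub>B\<^esub>) = p b" by (rule R_cases)
  have "f = left b"
  proof (rule Hom_eqI[OF assms left_Hom[OF b(1)]])
    fix r assume "r \<in> carrier R"
    then obtain c where c: "c \<in> carrier B" "r = p c" by (rule R_cases)
    have "f (p (\<one>\<^bsub>B\<^esub> \<otimes>\<^bsub>B\<^esub> c)) = c \<odot>\<^bsub>R\<^esub> f (p \<one>\<^bsub>B\<^esub>)"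
      using p_act[OF B.one_closed c(1)] Hom_act[OF assms c(1) p_closed[OF B.one_closed]] by simp
    then show "f r = left b r" using b c left_p[OF b(1) c(1)] p_act[OF b(1) c(1)] by simp
  qed
  then show thesis using that b by blast
qed

lemma left_inj: "b \<in> carrier B \<Longrightarrow> c \<in> carrier B \<Longrightarrow> left b = left c \<Longrightarrow> b = c"
  using left_p[of b "\<one>\<^bsub>B\<^esub>"] left_p[of c "\<one>\<^bsub>B\<^esub>"] inj_onD[OF p_inj, of b c] by simp

lemma left_one: "left \<one>\<^bsub>B\<^esub> = (\<lambda>r\<in>carrier R. r)"
  by (rule Hom_eqI[OF left_Hom Hom_id[OF R]]) (auto elim!: R_cases simp: left_p)

lemma left_add:
  assumes "b \<in> carrier B" "c \<in> carrier B"
  shows "left (b \<oplus>\<^bsub>B\<^esub> c) = (\<lambda>r\<in>carrier R. left b r \<oplus>\<^bsub>R\<^esub> left c r)"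
  by (rule Hom_eqI[OF left_Hom Hom_sum[OF R R left_Hom left_Hom]])
    (use assms in \<open>auto elim!: R_cases simp: left_p p_closed p_add B.l_distr\<close>)

lemma left_smult:
  assumes "b \<in> carrier B" "c \<in> carrier F"
  shows "left (c \<odot>\<^bsub>B\<^esub> b) = (\<lambda>r\<in>carrier R. (c \<odot>\<^bsub>B\<^esub> \<one>\<^bsub>B\<^esub>) \<odot>\<^bsub>R\<^esub> left b r)"
  by (rule Hom_eqI[OF left_Hom B.Hom_scale[OF R R left_Hom]])
    (use assms in \<open>auto elim!: R_cases simp: left_p p_closed B.smult_mult_left B.smult_one_mult
      simp flip: p_act\<close>)

lemma left_mult:
  assumes "b \<in> carrier B" "c \<in> carrier B"
  shows "compose (carrier R) (left b) (left c) = left (b \<otimes>\<^bsub>B\<^esub> c)"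
  by (rule Hom_eqI[OF Hom_compose[OF R left_Hom left_Hom] left_Hom])
    (use assms in \<open>auto elim!: R_cases simp: left_p p_closed compose_def B.m_assoc\<close>)

text \<open>An additive functor preserves zero morphisms: apply T to 0 = 0 + 0.\<close>

lemma T_left_zero: "y \<in> carrier P \<Longrightarrow> T1 R R (left \<zero>\<^bsub>B\<^esub>) y = \<zero>\<^bsub>P\<^esub>"
proof -
  assume y: "y \<in> carrier P"
  let ?z = "T1 R R (left \<zero>\<^bsub>B\<^esub>)"
  have z: "left \<zero>\<^bsub>B\<^esub> \<in> Hom B R R" by (rule left_Hom) simp
  have "?z = (\<lambda>x\<in>carrier P. ?z x \<oplus>\<^bsub>P\<^esub> ?z x)"
    using T.map_add[OF R R z z] left_add[of "\<zero>\<^bsub>B\<^esub>" "\<zero>\<^bsub>B\<^esub>"] by simp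
  from fun_cong[OF this, of y] have "?z y = ?z y \<oplus>\<^bsub>P\<^esub> ?z y" using y by simp
  then show ?thesis
    using Hom_closed[OF T.map[OF R R z] y] P.M.add.r_cancel_one'[of "?z y" "?z y"] by simp
qed

text \<open>Maps of B-modules are detected on R, since every s in S M is the image of 1 under some R
  -> S M. The equivalence carries this over to P: if f vanished on the image of every map P -> M,
  then S f and S 0 would agree at all such s.\<close>

lemma generator:
  fixes M N :: "('a, 'u) module"
  assumes M: "right_module A M" and N: "right_module A N" and f: "f \<in> Hom A M N"
    and nz: "x \<in> carrier M" "f x \<noteq> \<zero>\<^bsub>N\<^esub>"
  shows "\<exists>g\<in>Hom A P M. \<exists>y\<in>carrier P. f (g y) \<noteq> \<zero>\<^bsub>N\<^esub>"
proof (rule ccontr)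
  assume "\<not> ?thesis"
  then have zero: "f (g y) = \<zero>\<^bsub>N\<^esub>" if "g \<in> Hom A P M" "y \<in> carrier P" for g y
    using that by blast
  interpret M: right_module A M by (rule M)
  interpret N: right_module A N by (rule N)
  obtain \<eta> where \<eta>: "\<And>M. right_module A M \<Longrightarrow> \<eta> M \<in> Iso A (T (S M)) M"
    and nat: "\<And>M N f. right_module A M \<Longrightarrow> right_module A N \<Longrightarrow> f \<in> Hom A M N \<Longrightarrow>
      compose (carrier (T (S M))) (\<eta> N) (T1 (S M) (S N) (S1 M N f)) =
      compose (carrier (T (S M))) f (\<eta> M)"
    using TS unfolding naturally_isomorphic_def by blast
  define z where "z = (\<lambda>x\<in>carrier M. \<zero>\<^bsub>N\<^esub>)"
  have z: "z \<in> Hom A M N"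
    unfolding z_def by (rule HomI) (auto simp: right_module_act_zero[OF N] M.act_closed)
  note SM = S.obj[OF M] and SN = S.obj[OF N]
  note TSM = T.obj[OF SM] and TSN = T.obj[OF SN]
  have \<eta>M: "\<eta> M \<in> Hom A (T (S M)) M" using \<eta>[OF M] by (simp add: Iso_def)
  have "S1 M N f = S1 M N z"
  proof (rule Hom_eqI[OF S.map[OF M N f] S.map[OF M N z]])
    fix s assume s: "s \<in> carrier (S M)"
    interpret SM: right_module B "S M" by (rule SM)
    \<comment> \<open>The map from R that sends the copy of 1 to s. Followed by \<eta> M, its image
      under T is a map from P to M, so f vanishes on its values.\<close>
    define h where "h = (\<lambda>r\<in>carrier R. inv_into (carrier B) p r \<odot>\<^bsub>S M\<^esub> s)"
    have hp: "h (p b) = b \<odot>\<^bsub>S M\<^esub> s" if "b \<in> carrier B" for b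
      using that by (simp add: h_def p_closed inv_into_f_f[OF p_inj])
    have h: "h \<in> Hom B R (S M)"
    proof (rule HomI)
      show "h \<in> extensional (carrier R)" by (simp add: h_def)
      fix r assume "r \<in> carrier R"
      then obtain c where c: "c \<in> carrier B" "r = p c" by (rule R_cases)
      show "h r \<in> carrier (S M)" using c s by (simp add: hp SM.act_closed)
      show "h (d \<odot>\<^bsub>R\<^esub> r) = d \<odot>\<^bsub>S M\<^esub> h r" if d: "d \<in> carrier B" for d
        using hp[of "c \<otimes>\<^bsub>B\<^esub> d"] c d s by (simp add: hp p_act SM.act_assoc)
      fix r' assume "r' \<in> carrier R"
      then obtain c' where c': "c' \<in> carrier B" "r' = p c'" by (rule R_cases)
      show "h (r \<oplus>\<^bsub>R\<^esub> r') = h r \<oplus>\<^bsub>S M\<^esub> h r'"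
        using hp[of "c \<oplus>\<^bsub>B\<^esub> c'"] c c' s by (simp add: hp p_add SM.act_add_left)
    qed
    note Th = T.map[OF R SM h]
    have comp: "compose (carrier R) (S1 M N f') h \<in> Hom B R (S N)" if "f' \<in> Hom A M N" for f'
      by (rule Hom_compose[OF R h S.map[OF M N that]])
    have T_comp: "\<eta> N (T1 R (S N) (compose (carrier R) (S1 M N f') h) y) = f' (\<eta> M (T1 R (S M) h y))"
      if f': "f' \<in> Hom A M N" and y: "y \<in> carrier P" for f' y
      using T.map_comp[OF R SM SN h S.map[OF M N f']] y
        fun_cong[OF nat[OF M N f'], of "T1 R (S M) h y"] Hom_closed[OF Th y]
      by (simp add: compose_def)
    have "T1 R (S N) (compose (carrier R) (S1 M N f) h) = T1 R (S N) (compose (carrier R) (S1 M N z) h)"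
    proof (rule Hom_eqI[OF T.map[OF R SN comp[OF f]] T.map[OF R SN comp[OF z]]])
      fix y assume y: "y \<in> carrier P"
      have "f (compose (carrier P) (\<eta> M) (T1 R (S M) h) y) = \<zero>\<^bsub>N\<^esub>"
        by (rule zero[OF Hom_compose[OF P Th \<eta>M] y])
      then have "f (\<eta> M (T1 R (S M) h y)) = z (\<eta> M (T1 R (S M) h y))"
        using y Hom_closed[OF \<eta>M Hom_closed[OF Th y]] by (simp add: compose_def z_def)
      then have "\<eta> N (T1 R (S N) (compose (carrier R) (S1 M N f) h) y) =
          \<eta> N (T1 R (S N) (compose (carrier R) (S1 M N z) h) y)"
        using T_comp[OF f y] T_comp[OF z y] by simp
      then show "T1 R (S N) (compose (carrier R) (S1 M N f) h) y =
          T1 R (S N) (compose (carrier R) (S1 M N z) h) y"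
        using \<eta>[OF N] Hom_closed[OF T.map[OF R SN comp[OF f]] y]
          Hom_closed[OF T.map[OF R SN comp[OF z]] y]
        by (auto simp: Iso_def bij_betw_def dest: inj_onD)
    qed
    then have "compose (carrier R) (S1 M N f) h = compose (carrier R) (S1 M N z) h"
      by (rule T_faithful[OF R SN comp[OF f] comp[OF z]])
    from fun_cong[OF this, of "p \<one>\<^bsub>B\<^esub>"] show "S1 M N f s = S1 M N z s"
      using s by (simp add: compose_def hp p_closed SM.act_one)
  qed
  then have "f = z" by (rule S_faithful[OF M N f z])
  then show False using nz by (simp add: z_def)
qed

end

text \<open>
  Since \<open>P\<close> is a generator, \<open>eA\<close> is a direct summand of it; since \<open>End P \<cong> B\<close> has only the
  trivial idempotents, \<open>P \<cong> eA\<close>. The maps \<open>\<rho>\<close> and \<open>u \<mapsto> y1 u\<close> are the two isomorphisms.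
\<close>

lemma (in morita_regular) generator_iso_corner:
  assumes e: "local_corner F A e" and emb: "carrier A \<lesssim> (UNIV :: 'u set)"
    and dual: "dual_numbers F B x"
  obtains \<rho> y1 where "y1 \<in> carrier P" "e \<odot>\<^bsub>P\<^esub> y1 = y1"
    "\<rho> y1 = e" "\<And>y. y \<in> carrier P \<Longrightarrow> \<rho> y \<in> carrier A \<and> e \<otimes>\<^bsub>A\<^esub> \<rho> y = \<rho> y"
    "\<And>y y'. y \<in> carrier P \<Longrightarrow> y' \<in> carrier P \<Longrightarrow> \<rho> (y \<oplus>\<^bsub>P\<^esub> y') = \<rho> y \<oplus>\<^bsub>A\<^esub> \<rho> y'"
    "\<And>a y. a \<in> carrier A \<Longrightarrow> y \<in> carrier P \<Longrightarrow> \<rho> (a \<odot>\<^bsub>P\<^esub> y) = \<rho> y \<otimes>\<^bsub>A\<^esub> a"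
    "\<And>y. y \<in> carrier P \<Longrightarrow> \<rho> y \<odot>\<^bsub>P\<^esub> y1 = y"
proof -
  interpret e: local_corner F A e by (rule e)
  interpret dual: dual_numbers F B x by (rule dual)
  obtain E :: "('a, 'u) module" and \<pi> where E: "right_module A E"
    and \<pi>: "\<pi> \<in> Hom A (ideal_module A e.eA) E" "\<pi> ` e.eA = carrier E" "inj_on \<pi> e.eA"
    by (rule A.ex_module_copy[OF emb e.eA_right_ideal]) (rule that)
  obtain S0 :: "('a, 'u) module" and p0 where S0: "simple_module A S0"
    and p0: "p0 \<in> Hom A (ideal_module A e.eA) S0" "p0 ` e.eA = carrier S0"
      "\<And>x. x \<in> e.eA \<Longrightarrow> p0 x = \<zero>\<^bsub>S0\<^esub> \<longleftrightarrow> x \<in> e.eJ"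
    by (rule e.simple_top[OF emb]) (rule that)
  have S0m: "right_module A S0" using S0 by (simp add: simple_module_def)
  interpret E: right_module A E by (rule E)
  interpret S0: right_module A S0 by (rule S0m)
  have e_eA: "e \<in> e.eA" by (simp add: e.eA_iff)
  have eA_add: "u \<oplus>\<^bsub>A\<^esub> v \<in> e.eA" if "u \<in> e.eA" "v \<in> e.eA" for u v
    by (rule right_ideal_add[OF e.eA_right_ideal that])
  have eA_mult: "u \<otimes>\<^bsub>A\<^esub> a \<in> e.eA" if "u \<in> e.eA" "a \<in> carrier A" for u a
    by (rule right_ideal_mult[OF e.eA_right_ideal that])
  have \<pi>_add: "\<pi> (u \<oplus>\<^bsub>A\<^esub> v) = \<pi> u \<oplus>\<^bsub>E\<^esub> \<pi> v" if "u \<in> e.eA" "v \<in> e.eA" for u v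
    using Hom_add[OF \<pi>(1), of u v] that by simp
  have \<pi>_act: "\<pi> (u \<otimes>\<^bsub>A\<^esub> a) = a \<odot>\<^bsub>E\<^esub> \<pi> u" if "u \<in> e.eA" "a \<in> carrier A" for u a
    using Hom_act[OF \<pi>(1), of a u] that by simp
  define \<sigma> where "\<sigma> s = inv_into e.eA \<pi> s" for s
  have \<sigma>: "\<sigma> s \<in> e.eA" "\<pi> (\<sigma> s) = s" if "s \<in> carrier E" for s
    using that \<pi>(2) unfolding \<sigma>_def by (auto intro: inv_into_into f_inv_into_f)
  have \<sigma>_\<pi>: "\<sigma> (\<pi> u) = u" if "u \<in> e.eA" for u
    unfolding \<sigma>_def using that by (rule inv_into_f_f[OF \<pi>(3)])
  have \<pi>_closed: "\<pi> u \<in> carrier E" if "u \<in> e.eA" for u using that \<pi>(2) by blast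
  have \<sigma>_add: "\<sigma> (s \<oplus>\<^bsub>E\<^esub> t) = \<sigma> s \<oplus>\<^bsub>A\<^esub> \<sigma> t" if "s \<in> carrier E" "t \<in> carrier E" for s t
    using \<pi>_add[of "\<sigma> s" "\<sigma> t"] \<sigma>_\<pi>[of "\<sigma> s \<oplus>\<^bsub>A\<^esub> \<sigma> t"] eA_add \<sigma> that by metis
  have \<sigma>_act: "\<sigma> (a \<odot>\<^bsub>E\<^esub> s) = \<sigma> s \<otimes>\<^bsub>A\<^esub> a" if "s \<in> carrier E" "a \<in> carrier A" for s a
    using \<pi>_act[of "\<sigma> s" a] \<sigma>_\<pi>[of "\<sigma> s \<otimes>\<^bsub>A\<^esub> a"] eA_mult \<sigma> that by metis
  define f where "f = (\<lambda>s\<in>carrier E. p0 (\<sigma> s))"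
  have f: "f \<in> Hom A E S0"
  proof (rule HomI)
    show "f \<in> extensional (carrier E)" by (simp add: f_def)
    fix s assume s: "s \<in> carrier E"
    show "f s \<in> carrier S0" using s \<sigma>(1)[OF s] p0(2) by (auto simp: f_def)
    show "f (s \<oplus>\<^bsub>E\<^esub> t) = f s \<oplus>\<^bsub>S0\<^esub> f t" if t: "t \<in> carrier E" for t
      using Hom_add[OF p0(1), of "\<sigma> s" "\<sigma> t"] \<sigma>(1)[OF s] \<sigma>(1)[OF t] s t
      by (simp add: f_def \<sigma>_add)
    show "f (a \<odot>\<^bsub>E\<^esub> s) = a \<odot>\<^bsub>S0\<^esub> f s" if a: "a \<in> carrier A" for a
      using Hom_act[OF p0(1) a, of "\<sigma> s"] \<sigma>(1)[OF s] s a
      by (simp add: f_def \<sigma>_act E.act_closed)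
  qed
  have "e \<notin> e.eJ"
  proof
    assume "e \<in> e.eJ"
    then have "e.eA \<subseteq> e.eJ" using right_ideal_mult[OF e.eJ_right_ideal] by auto
    then show False using e.eJ_less by blast
  qed
  then have "f (\<pi> e) \<noteq> \<zero>\<^bsub>S0\<^esub>"
    using p0(3)[OF e_eA] by (simp add: f_def \<sigma>_\<pi>[OF e_eA] \<pi>_closed[OF e_eA])
  \<comment> \<open>Up to the encoding, f is the projection of eA onto eA / eJ. A map from P to eA
    that f does not kill has a value outside \<open>eJ\<close>; this value generates eA, so the map
    is onto.\<close>
  then obtain g y0 where g: "g \<in> Hom A P E" and y0: "y0 \<in> carrier P" "f (g y0) \<noteq> \<zero>\<^bsub>S0\<^esub>"
    using generator[OF E S0m f \<pi>_closed[OF e_eA]] by blast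
  define \<rho> where "\<rho> y = \<sigma> (g y)" for y
  have \<rho>: "\<rho> y \<in> e.eA" if "y \<in> carrier P" for y
    unfolding \<rho>_def by (rule \<sigma>(1)[OF Hom_closed[OF g that]])
  have \<rho>_add: "\<rho> (y \<oplus>\<^bsub>P\<^esub> y') = \<rho> y \<oplus>\<^bsub>A\<^esub> \<rho> y'" if "y \<in> carrier P" "y' \<in> carrier P" for y y'
    unfolding \<rho>_def using \<sigma>_add[OF Hom_closed[OF g that(1)] Hom_closed[OF g that(2)]]
      Hom_add[OF g that] by simp
  have \<rho>_act: "\<rho> (a \<odot>\<^bsub>P\<^esub> y) = \<rho> y \<otimes>\<^bsub>A\<^esub> a" if "a \<in> carrier A" "y \<in> carrier P" for a y
    unfolding \<rho>_def using \<sigma>_act[OF Hom_closed[OF g that(2)] that(1)] Hom_act[OF g that] by simp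
  have \<rho>A: "\<rho> y \<in> carrier A" if "y \<in> carrier P" for y using \<rho>[OF that] by (simp add: e.eA_iff)
  let ?N = "\<rho> ` carrier P"
  have "right_ideal A ?N"
  proof (rule right_idealI)
    show "?N \<subseteq> carrier A" using \<rho>A by auto
    have "\<rho> \<zero>\<^bsub>P\<^esub> = \<rho> \<zero>\<^bsub>P\<^esub> \<oplus>\<^bsub>A\<^esub> \<rho> \<zero>\<^bsub>P\<^esub>" using \<rho>_add[of "\<zero>\<^bsub>P\<^esub>" "\<zero>\<^bsub>P\<^esub>"] by simp
    then have "\<rho> \<zero>\<^bsub>P\<^esub> = \<zero>\<^bsub>A\<^esub>" using \<rho>A[of "\<zero>\<^bsub>P\<^esub>"] A.add.r_cancel_one' by simp
    then show "\<zero>\<^bsub>A\<^esub> \<in> ?N" by (intro image_eqI[of _ _ "\<zero>\<^bsub>P\<^esub>"]) auto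
    fix u assume "u \<in> ?N"
    then obtain y where y: "y \<in> carrier P" "u = \<rho> y" by auto
    show "u \<otimes>\<^bsub>A\<^esub> a \<in> ?N" if a: "a \<in> carrier A" for a
      using \<rho>_act[OF a y(1)] y P.act_closed[OF a y(1)] by (intro image_eqI[of _ _ "a \<odot>\<^bsub>P\<^esub> y"]) auto
    fix v assume "v \<in> ?N"
    then obtain y' where y': "y' \<in> carrier P" "v = \<rho> y'" by auto
    show "u \<oplus>\<^bsub>A\<^esub> v \<in> ?N"
      using \<rho>_add[OF y(1) y'(1)] y y' by (intro image_eqI[of _ _ "y \<oplus>\<^bsub>P\<^esub> y'"]) auto
  qed
  moreover have "\<rho> y0 \<notin> e.eJ"
    using y0 p0(3)[OF \<rho>[OF y0(1)]] Hom_closed[OF g y0(1)] by (simp add: f_def \<rho>_def)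
  ultimately have "e.eA \<subseteq> ?N" using e.eA_generated[of ?N "\<rho> y0"] y0 \<rho> by blast
  then have "e \<in> ?N" by (rule subsetD[OF _ e_eA])
  then obtain y2 where e_eq: "e = \<rho> y2" and y2P: "y2 \<in> carrier P" by (rule imageE)
  note y2 = y2P e_eq[symmetric]
  \<comment> \<open>Replacing y2 by y2 e keeps the value e under \<rho> and makes the vector fixed
    by e. Then u |-> y1 u on eA is a section of \<rho>.\<close>
  define y1 where "y1 = e \<odot>\<^bsub>P\<^esub> y2"
  have y1: "y1 \<in> carrier P" "e \<odot>\<^bsub>P\<^esub> y1 = y1" "\<rho> y1 = e"
    using y2 P.act_assoc[of e e y2] \<rho>_act[of e y2] by (simp_all add: y1_def P.act_closed)
  \<comment> \<open>The idempotent endomorphism of P whose image is y1 A, the copy of eA in P. As T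
    is full and faithful, it comes from an idempotent b of B.\<close>
  define k where "k = (\<lambda>y\<in>carrier P. \<rho> y \<odot>\<^bsub>P\<^esub> y1)"
  have k: "k \<in> Hom A P P"
  proof (rule HomI)
    show "k \<in> extensional (carrier P)" by (simp add: k_def)
    fix y assume y: "y \<in> carrier P"
    show "k y \<in> carrier P" using y y1 \<rho>A by (simp add: k_def P.act_closed)
    show "k (y \<oplus>\<^bsub>P\<^esub> y') = k y \<oplus>\<^bsub>P\<^esub> k y'" if "y' \<in> carrier P" for y'
      using y that y1 \<rho>A by (simp add: k_def \<rho>_add P.act_add_left)
    show "k (a \<odot>\<^bsub>P\<^esub> y) = a \<odot>\<^bsub>P\<^esub> k y" if "a \<in> carrier A" for a
      using y that y1 \<rho>A by (simp add: k_def \<rho>_act P.act_assoc P.act_closed)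
  qed
  have \<rho>_k: "\<rho> (\<rho> y \<odot>\<^bsub>P\<^esub> y1) = \<rho> y" if "y \<in> carrier P" for y
    using \<rho>_act[OF \<rho>A[OF that] y1(1)] \<rho>[OF that] y1(3) by (simp add: e.eA_iff)
  have kk: "compose (carrier P) k k = k"
    using \<rho>_k y1 \<rho>A P.act_closed by (auto simp: fun_eq_iff compose_def k_def)
  obtain \<kappa> where \<kappa>: "\<kappa> \<in> Hom B R R" "T1 R R \<kappa> = k" using T_full[OF R R k] by blast
  obtain b where b: "b \<in> carrier B" "\<kappa> = left b" by (rule End_R_eq_left[OF \<kappa>(1)])
  have "compose (carrier R) \<kappa> \<kappa> = \<kappa>"
  proof (rule T_faithful[OF R R Hom_compose[OF R \<kappa>(1) \<kappa>(1)] \<kappa>(1)])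
    show "T1 R R (compose (carrier R) \<kappa> \<kappa>) = T1 R R \<kappa>"
      using T.map_comp[OF R R R \<kappa>(1) \<kappa>(1)] \<kappa>(2) kk by simp
  qed
  then have "b \<otimes>\<^bsub>B\<^esub> b = b"
    using left_mult[OF b(1) b(1)] left_inj[OF B.m_closed[OF b(1) b(1)] b(1)] b(2) by simp
  then have "b = \<zero>\<^bsub>B\<^esub> \<or> b = \<one>\<^bsub>B\<^esub>" by (rule dual.idempotent_trivial[OF b(1)])
  \<comment> \<open>Otherwise k = 0. But k fixes y1, and y1 is not zero because \<rho> y1 =
    e.\<close>
  moreover have "b \<noteq> \<zero>\<^bsub>B\<^esub>"
  proof
    assume "b = \<zero>\<^bsub>B\<^esub>"
    then have "k y1 = \<zero>\<^bsub>P\<^esub>" using T_left_zero[OF y1(1)] \<kappa>(2) b(2) by simp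
    then have "y1 = \<zero>\<^bsub>P\<^esub>" using y1 by (simp add: k_def)
    then have "e = e \<oplus>\<^bsub>A\<^esub> e" using \<rho>_add[OF y1(1) y1(1)] y1(3) by simp
    then have "e = \<zero>\<^bsub>A\<^esub>" using A.add.r_cancel_one'[of e e] by simp
    then show False using e.e_nonzero by simp
  qed
  ultimately have k_id: "k = (\<lambda>y\<in>carrier P. y)"
    using \<kappa>(2) b(2) left_one T.map_id[OF R] by simp
  have "\<rho> y \<odot>\<^bsub>P\<^esub> y1 = y" if "y \<in> carrier P" for y
    using fun_cong[OF k_id, of y] that by (simp add: k_def)
  then show thesis
    using that[of y1 \<rho>] y1 \<rho> \<rho>_add \<rho>_act by (simp add: e.eA_iff)
qed

text \<open>As P is isomorphic to eA, the spaces eAe, End(eA), End(P), End(R) and B are all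
  identified. The map \<open>z\<close> is this linear bijection from B to eAe in explicit form, and
  it carries 1, x to a basis of eAe.\<close>

theorem (in morita_regular) dual_numbers_invariants:
  assumes fd: "A.fin_dim" and emb: "carrier A \<lesssim> (UNIV :: 'u set)" and dual: "dual_numbers F B x"
  shows "commutator_codim F A = 2" "num_simple_modules TYPE('u) A = 1"
proof -
  interpret dual: dual_numbers F B x by (rule dual)
  have B1: "\<one>\<^bsub>B\<^esub> \<noteq> \<zero>\<^bsub>B\<^esub>"
    using dual.indep[of "\<one>\<^bsub>F\<^esub>" "\<zero>\<^bsub>F\<^esub>"] by auto
  \<comment> \<open>Over the zero algebra P is zero, and T would identify the endomorphisms of R
    given by 1 and by 0.\<close>
  have "\<one>\<^bsub>A\<^esub> \<noteq> \<zero>\<^bsub>A\<^esub>"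
  proof
    assume "\<one>\<^bsub>A\<^esub> = \<zero>\<^bsub>A\<^esub>"
    then have zero: "y = \<zero>\<^bsub>P\<^esub>" if "y \<in> carrier P" for y
      using P.act_one[OF that] right_module_zero_act[OF P that] by simp
    have "T1 R R (left b) y = \<zero>\<^bsub>P\<^esub>" if "b \<in> carrier B" "y \<in> carrier P" for b y
      by (rule zero[OF Hom_closed[OF T.map[OF R R left_Hom[OF that(1)]] that(2)]])
    then have "T1 R R (left \<one>\<^bsub>B\<^esub>) = T1 R R (left \<zero>\<^bsub>B\<^esub>)"
      by (intro Hom_eqI[OF T.map[OF R R left_Hom] T.map[OF R R left_Hom]]) auto
    then have "left \<one>\<^bsub>B\<^esub> = left \<zero>\<^bsub>B\<^esub>"
      by (intro T_faithful[OF R R left_Hom left_Hom]) auto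
    then show False using left_inj[of "\<one>\<^bsub>B\<^esub>" "\<zero>\<^bsub>B\<^esub>"] B1 by simp
  qed
  then obtain e where e: "e \<in> carrier A" "e \<otimes>\<^bsub>A\<^esub> e = e" "nil_local_ring (corner A e)"
    by (rule A.ex_local_idempotent[OF fd]) (rule that)
  interpret e: local_corner F A e
    by (intro local_corner.intro idempotent_algebra.intro idempotent_algebra_axioms.intro
        local_corner_axioms.intro A.assoc_algebra_axioms e)
  obtain \<rho> y1 where y1: "y1 \<in> carrier P" "e \<odot>\<^bsub>P\<^esub> y1 = y1" "\<rho> y1 = e"
    and \<rho>: "\<And>y. y \<in> carrier P \<Longrightarrow> \<rho> y \<in> carrier A \<and> e \<otimes>\<^bsub>A\<^esub> \<rho> y = \<rho> y"
    and \<rho>_add: "\<And>y y'. y \<in> carrier P \<Longrightarrow> y' \<in> carrier P \<Longrightarrow> \<rho> (y \<oplus>\<^bsub>P\<^esub> y') = \<rho> y \<oplus>\<^bsub>A\<^esub> \<rho> y'"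
    and \<rho>_act: "\<And>a y. a \<in> carrier A \<Longrightarrow> y \<in> carrier P \<Longrightarrow> \<rho> (a \<odot>\<^bsub>P\<^esub> y) = \<rho> y \<otimes>\<^bsub>A\<^esub> a"
    and gen: "\<And>y. y \<in> carrier P \<Longrightarrow> \<rho> y \<odot>\<^bsub>P\<^esub> y1 = y"
    by (rule generator_iso_corner[OF e.local_corner_axioms emb dual]) (rule that)
  have full: "\<one>\<^bsub>A\<^esub> \<in> e.AeA"
  proof (rule ccontr)
    assume "\<one>\<^bsub>A\<^esub> \<notin> e.AeA"
    then obtain N :: "('a, 'u) module" where N: "simple_module A N"
      "\<And>s. s \<in> carrier N \<Longrightarrow> e \<odot>\<^bsub>N\<^esub> s = \<zero>\<^bsub>N\<^esub>"
      by (rule e.ex_simple_annihilated[OF emb fd]) (rule that)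
    have Nm: "right_module A N" using N by (simp add: simple_module_def)
    interpret N: right_module A N by (rule Nm)
    obtain s where s: "s \<in> carrier N" "s \<noteq> \<zero>\<^bsub>N\<^esub>"
      using N(1) N.M.zero_closed unfolding simple_module_def by blast
    \<comment> \<open>A generator maps nontrivially to N. But y1 generates P, and its image h y1 =
      (h y1) e vanishes.\<close>
    obtain h y where h: "h \<in> Hom A P N" and y: "y \<in> carrier P" "h y \<noteq> \<zero>\<^bsub>N\<^esub>"
      using generator[OF Nm Nm Hom_id[OF Nm] s(1)] s Hom_closed by fastforce
    have "h y1 = \<zero>\<^bsub>N\<^esub>"
      using Hom_act[OF h e.e_closed y1(1)] y1(2) N(2)[OF Hom_closed[OF h y1(1)]] by simp
    then have "h (\<rho> y \<odot>\<^bsub>P\<^esub> y1) = \<zero>\<^bsub>N\<^esub>"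
      using Hom_act[OF h _ y1(1)] \<rho>[OF y(1)] right_module_act_zero[OF Nm] by simp
    then show False using gen[OF y(1)] y(2) by simp
  qed
  obtain S0 :: "('a, 'u) module" where S0: "simple_module A S0"
    by (rule e.simple_top[OF emb]) (rule that)
  show "num_simple_modules TYPE('u) A = 1"
    unfolding num_simple_modules_eq_1_iff
    by (intro conjI exI[of _ S0] allI impI S0 e.simple_modules_isomorphic[OF full]) simp_all
  define z where "z b = \<rho> (T1 R R (left b) y1)" for b
  have TH: "T1 R R (left b) \<in> Hom A P P" if "b \<in> carrier B" for b
    by (rule T.map[OF R R left_Hom[OF that]])
  have TP: "T1 R R (left b) y1 \<in> carrier P" if "b \<in> carrier B" for b
    by (rule Hom_closed[OF TH[OF that] y1(1)])
  have zC: "z b \<in> carrier e.C" if b: "b \<in> carrier B" for b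
    using \<rho>[OF TP[OF b]] \<rho>_act[OF e.e_closed TP[OF b]] Hom_act[OF TH[OF b] e.e_closed y1(1)] y1(2)
    by (simp add: e.C_iff z_def)
  have z_add: "z (b \<oplus>\<^bsub>B\<^esub> c) = z b \<oplus>\<^bsub>A\<^esub> z c" if "b \<in> carrier B" "c \<in> carrier B" for b c
  proof -
    have "T1 R R (left (b \<oplus>\<^bsub>B\<^esub> c)) y1 = T1 R R (left b) y1 \<oplus>\<^bsub>P\<^esub> T1 R R (left c) y1"
      unfolding left_add[OF that] T.map_add[OF R R left_Hom[OF that(1)] left_Hom[OF that(2)]]
      using y1(1) by simp
    then show ?thesis
      using \<rho>_add[OF TP[OF that(1)] TP[OF that(2)]] by (simp add: z_def)
  qed
  have z_smult: "z (c \<odot>\<^bsub>B\<^esub> b) = c \<odot>\<^bsub>A\<^esub> z b" if "b \<in> carrier B" "c \<in> carrier F" for b c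
  proof -
    have c1: "c \<odot>\<^bsub>A\<^esub> \<one>\<^bsub>A\<^esub> \<in> carrier A" using that(2) by simp
    have "T1 R R (left (c \<odot>\<^bsub>B\<^esub> b)) y1 = (c \<odot>\<^bsub>A\<^esub> \<one>\<^bsub>A\<^esub>) \<odot>\<^bsub>P\<^esub> T1 R R (left b) y1"
      unfolding left_smult[OF that] T.map_smult[OF R R left_Hom[OF that(1)] that(2)]
      using y1(1) by simp
    then show ?thesis
      using \<rho>_act[OF c1 TP[OF that(1)]] \<rho>[OF TP[OF that(1)]] that(2)
      by (simp add: z_def A.smult_one_mult)
  qed
  have z_one: "z \<one>\<^bsub>B\<^esub> = e"
    using left_one T.map_id[OF R] y1 by (simp add: z_def)
  have z_inj: "b = c" if bc: "b \<in> carrier B" "c \<in> carrier B" "z b = z c" for b c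
  proof -
    have "T1 R R (left b) y1 = \<rho> (T1 R R (left b) y1) \<odot>\<^bsub>P\<^esub> y1"
      by (rule gen[OF TP[OF bc(1)], symmetric])
    also have "\<rho> (T1 R R (left b) y1) = \<rho> (T1 R R (left c) y1)"
      using bc(3) by (simp only: z_def)
    also have "\<rho> (T1 R R (left c) y1) \<odot>\<^bsub>P\<^esub> y1 = T1 R R (left c) y1"
      by (rule gen[OF TP[OF bc(2)]])
    finally have eq: "T1 R R (left b) y1 = T1 R R (left c) y1" .
    have "T1 R R (left b) = T1 R R (left c)"
    proof (rule Hom_eqI[OF TH[OF bc(1)] TH[OF bc(2)]])
      fix y assume y: "y \<in> carrier P"
      have "T1 R R (left b) (\<rho> y \<odot>\<^bsub>P\<^esub> y1) = T1 R R (left c) (\<rho> y \<odot>\<^bsub>P\<^esub> y1)"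
        using Hom_act[OF TH[OF bc(1)] _ y1(1)] Hom_act[OF TH[OF bc(2)] _ y1(1)] \<rho>[OF y] eq by simp
      then show "T1 R R (left b) y = T1 R R (left c) y" using gen[OF y] by simp
    qed
    then have "left b = left c" by (rule T_faithful[OF R R left_Hom[OF bc(1)] left_Hom[OF bc(2)]])
    then show ?thesis by (rule left_inj[OF bc(1,2)])
  qed
  have z_surj: "\<exists>b\<in>carrier B. c = z b" if c: "c \<in> carrier e.C" for c
  proof -
    have cA: "c \<in> carrier A" using c by (rule e.C_closed)
    \<comment> \<open>Left multiplication by c on eA, transported to P. As T is full it comes from
      an endomorphism \<open>left b\<close> of R, and evaluation at y1 gives z b = c.\<close>
    define k where "k = (\<lambda>y\<in>carrier P. (c \<otimes>\<^bsub>A\<^esub> \<rho> y) \<odot>\<^bsub>P\<^esub> y1)"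
    have k: "k \<in> Hom A P P"
    proof (rule HomI)
      show "k \<in> extensional (carrier P)" by (simp add: k_def)
      fix y assume y: "y \<in> carrier P"
      show "k y \<in> carrier P" using y y1 \<rho> cA by (simp add: k_def P.act_closed)
      show "k (y \<oplus>\<^bsub>P\<^esub> y') = k y \<oplus>\<^bsub>P\<^esub> k y'" if "y' \<in> carrier P" for y'
        using y that y1 \<rho> cA by (simp add: k_def \<rho>_add P.act_add_left A.r_distr)
      show "k (a \<odot>\<^bsub>P\<^esub> y) = a \<odot>\<^bsub>P\<^esub> k y" if "a \<in> carrier A" for a
        using y that y1 \<rho> cA P.act_assoc[of "c \<otimes>\<^bsub>A\<^esub> \<rho> y" a y1]
        by (simp add: k_def \<rho>_act P.act_closed A.m_assoc)
    qed
    obtain \<kappa> where \<kappa>: "\<kappa> \<in> Hom B R R" "T1 R R \<kappa> = k" using T_full[OF R R k] by blast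
    obtain b where b: "b \<in> carrier B" "\<kappa> = left b" by (rule End_R_eq_left[OF \<kappa>(1)])
    have "z b = \<rho> (c \<odot>\<^bsub>P\<^esub> y1)"
      using b \<kappa> y1 e.C_right[OF c] by (simp add: z_def k_def)
    also have "\<dots> = c" using \<rho>_act[OF cA y1(1)] y1(3) e.C_left[OF c] by simp
    finally show ?thesis using b by auto
  qed
  have xB: "x \<in> carrier B" by simp
  have zxA: "z x \<in> carrier A" by (rule e.C_closed[OF zC[OF xB]])
  have z_el: "z (dual.el \<alpha> \<beta>) = \<alpha> \<odot>\<^bsub>A\<^esub> e \<oplus>\<^bsub>A\<^esub> \<beta> \<odot>\<^bsub>A\<^esub> z x"
    if "\<alpha> \<in> carrier F" "\<beta> \<in> carrier F" for \<alpha> \<beta>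
    using that by (simp add: dual.el_def z_add z_smult z_one)
  have C_el: "\<exists>\<alpha>\<in>carrier F. \<exists>\<beta>\<in>carrier F. c = \<alpha> \<odot>\<^bsub>A\<^esub> e \<oplus>\<^bsub>A\<^esub> \<beta> \<odot>\<^bsub>A\<^esub> z x"
    if c: "c \<in> carrier e.C" for c
  proof -
    obtain b where b: "b \<in> carrier B" "c = z b" using z_surj[OF c] by auto
    obtain \<alpha> \<beta> where "\<alpha> \<in> carrier F" "\<beta> \<in> carrier F" "b = dual.el \<alpha> \<beta>"
      by (rule dual.el_cases[OF b(1)])
    then show ?thesis using b z_el by blast
  qed
  have "e.C.dim = 2"
  proof (rule e.C.dim_eq_2I)
    show "e \<in> carrier e.C" using e.C.one_closed by simp
    show "z x \<in> carrier e.C" by (rule zC[OF xB])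
    show "\<exists>\<alpha>\<in>carrier F. \<exists>\<beta>\<in>carrier F. c = \<alpha> \<odot>\<^bsub>e.C\<^esub> e \<oplus>\<^bsub>e.C\<^esub> \<beta> \<odot>\<^bsub>e.C\<^esub> z x"
      if "c \<in> carrier e.C" for c using C_el[OF that] by simp
    fix \<alpha> \<beta> assume ab: "\<alpha> \<in> carrier F" "\<beta> \<in> carrier F"
      "\<alpha> \<odot>\<^bsub>e.C\<^esub> e \<oplus>\<^bsub>e.C\<^esub> \<beta> \<odot>\<^bsub>e.C\<^esub> z x = \<zero>\<^bsub>e.C\<^esub>"
    have "z (dual.el \<zero>\<^bsub>F\<^esub> \<zero>\<^bsub>F\<^esub>) = \<zero>\<^bsub>A\<^esub>" using z_el[of "\<zero>\<^bsub>F\<^esub>" "\<zero>\<^bsub>F\<^esub>"] zxA by simp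
    then have "dual.el \<alpha> \<beta> = dual.el \<zero>\<^bsub>F\<^esub> \<zero>\<^bsub>F\<^esub>"
      using z_el[OF ab(1,2)] ab by (intro z_inj) auto
    from dual.el_inj[OF ab(1,2) _ _ this] show "\<alpha> = \<zero>\<^bsub>F\<^esub> \<and> \<beta> = \<zero>\<^bsub>F\<^esub>" by simp
  qed
  \<comment> \<open>Spanned by its unit e and one further element, eAe is commutative.\<close>
  moreover have "commutator_codim F e.C = e.C.dim"
  proof (rule e.C.commutator_codim_commutative[OF e.C_fin_dim[OF fd]])
    fix c d assume cd: "c \<in> carrier e.C" "d \<in> carrier e.C"
    note zx = zC[OF xB]
    obtain \<alpha> \<beta> where c: "\<alpha> \<in> carrier F" "\<beta> \<in> carrier F" "c = \<alpha> \<odot>\<^bsub>A\<^esub> e \<oplus>\<^bsub>A\<^esub> \<beta> \<odot>\<^bsub>A\<^esub> z x"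
      using C_el[OF cd(1)] by blast
    have zd: "z x \<otimes>\<^bsub>A\<^esub> d = d \<otimes>\<^bsub>A\<^esub> z x"
    proof -
      obtain \<gamma> \<delta> where d: "\<gamma> \<in> carrier F" "\<delta> \<in> carrier F" "d = \<gamma> \<odot>\<^bsub>A\<^esub> e \<oplus>\<^bsub>A\<^esub> \<delta> \<odot>\<^bsub>A\<^esub> z x"
        using C_el[OF cd(2)] by blast
      then show ?thesis
        using zxA e.C_left[OF zx] e.C_right[OF zx]
        by (simp add: A.l_distr A.r_distr A.smult_mult_left A.smult_mult_right)
    qed
    show "c \<otimes>\<^bsub>e.C\<^esub> d = d \<otimes>\<^bsub>e.C\<^esub> c"
      using c zd zxA e.C_closed[OF cd(2)] e.C_left[OF cd(2)] e.C_right[OF cd(2)]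
      by (simp add: A.l_distr A.r_distr A.smult_mult_left A.smult_mult_right)
  qed
  ultimately show "commutator_codim F A = 2"
    using e.commutator_codim_corner[OF full fd] by simp
qed

section \<open>The theorem\<close>

lemma morita_equivalent_imp_invariants:
  fixes F :: "('f, 'r) ring_scheme" and A :: "('f, 'a, 's) module_scheme"
    and B :: "('f, 'b, 't) module_scheme"
  assumes A: "assoc_algebra F A" and fd: "vectorspace.fin_dim F A"
    and inf: "infinite (UNIV :: 'u set)" and F: "carrier F \<lesssim> (UNIV :: 'u set)"
    and dual: "dual_numbers F B x" and morita: "morita_equivalent TYPE('u) F A B"
  shows "commutator_codim F A = 2 \<and> num_simple_modules TYPE('u) A = 1"
proof -
  interpret A: assoc_algebra F A by (rule A)
  interpret dual: dual_numbers F B x by (rule dual)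
  obtain S :: "('a, 'u) module \<Rightarrow> ('b, 'u) module" and S1
    and T :: "('b, 'u) module \<Rightarrow> ('a, 'u) module" and T1 where
    *: "linear_functor F A B S S1" "linear_functor F B A T T1"
      "naturally_isomorphic A A
        (\<lambda>M. T (S M)) (\<lambda>M N f. T1 (S M) (S N) (S1 M N f)) (\<lambda>M. M) (\<lambda>M N f. f)"
      "naturally_isomorphic B B
        (\<lambda>M. S (T M)) (\<lambda>M N f. S1 (T M) (T N) (T1 M N f)) (\<lambda>M. M) (\<lambda>M N f. f)"
    using morita unfolding morita_equivalent_def by blast
  have right: "right_ideal B (carrier B)" by (rule right_idealI) auto
  obtain R :: "('b, 'u) module" and p where
    R: "right_module B R" "p \<in> Hom B (ideal_module B (carrier B)) R" "p ` carrier B = carrier R"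
      "inj_on p (carrier B)"
    by (rule dual.ex_module_copy[OF dual.dual_numbers_lepoll[OF inf F] right]) (rule that)
  interpret morita_regular F A B S S1 T T1 R p
    by (intro morita_regular.intro morita_equivalence.intro morita_equivalence_axioms.intro
        morita_regular_axioms.intro A dual.assoc_algebra_axioms * R)
  show ?thesis
    using dual_numbers_invariants[OF fd A.fin_dim_lepoll[OF inf F fd] dual] by simp
qed

lemma invariants_imp_morita_equivalent:
  fixes F :: "('f, 'r) ring_scheme" and A :: "('f, 'a, 's) module_scheme"
    and B :: "('f, 'b, 't) module_scheme"
  assumes A: "assoc_algebra F A" and fd: "vectorspace.fin_dim F A"
    and inf: "infinite (UNIV :: 'u set)" and F: "carrier F \<lesssim> (UNIV :: 'u set)"
    and split: "splitting_field TYPE('u) F A" and dual: "dual_numbers F B x"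
    and codim: "commutator_codim F A = 2" and num: "num_simple_modules TYPE('u) A = 1"
  shows "morita_equivalent TYPE('u) F A B"
proof -
  interpret A: assoc_algebra F A by (rule A)
  interpret dual: dual_numbers F B x by (rule dual)
  have emb: "carrier A \<lesssim> (UNIV :: 'u set)" by (rule A.fin_dim_lepoll[OF inf F fd])
  note num' = num[unfolded num_simple_modules_eq_1_iff]
  obtain S :: "('a, 'u) module" where S: "simple_module A S"
    using conjunct1[OF num'] by (rule exE)
  have iso: "Iso A M N \<noteq> {}" if "simple_module A M" "simple_module A N"
    for M :: "('a, 'u) module" and N :: "('a, 'u) module"
    using conjunct2[OF num'] that by simp
  \<comment> \<open>Over the zero algebra every module is zero, yet a simple one exists.\<close>
  have "\<one>\<^bsub>A\<^esub> \<noteq> \<zero>\<^bsub>A\<^esub>"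
  proof
    assume zero: "\<one>\<^bsub>A\<^esub> = \<zero>\<^bsub>A\<^esub>"
    have Sm: "right_module A S" using S by (simp add: simple_module_def)
    interpret S: right_module A S by (rule Sm)
    have "s = \<zero>\<^bsub>S\<^esub>" if "s \<in> carrier S" for s
      using S.act_one[OF that] right_module_zero_act[OF Sm that] zero by simp
    then show False using S S.M.zero_closed unfolding simple_module_def by blast
  qed
  then obtain e where e: "e \<in> carrier A" "e \<otimes>\<^bsub>A\<^esub> e = e" "nil_local_ring (corner A e)"
    by (rule A.ex_local_idempotent[OF fd]) (rule that)
  interpret e: local_corner F A e
    by (intro local_corner.intro idempotent_algebra.intro idempotent_algebra_axioms.intro
        local_corner_axioms.intro A.assoc_algebra_axioms e)
  interpret C: nil_local_ring e.C by (rule e(3))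
  have full: "\<one>\<^bsub>A\<^esub> \<in> e.AeA" by (rule e.full_if_unique_simple[OF emb fd iso])
  have residue: "\<exists>c\<in>carrier F. b \<ominus>\<^bsub>e.C\<^esub> c \<odot>\<^bsub>e.C\<^esub> \<one>\<^bsub>e.C\<^esub> \<notin> Units e.C"
    if b: "b \<in> carrier e.C" for b
  proof -
    obtain c where c: "c \<in> carrier F" "b \<ominus>\<^bsub>A\<^esub> c \<odot>\<^bsub>A\<^esub> e \<notin> Units e.C"
      using e.residue_field[OF emb split b] by auto
    have "c \<odot>\<^bsub>e.C\<^esub> \<one>\<^bsub>e.C\<^esub> \<in> carrier e.C"
      by (rule e.C.smult_closed[OF c(1) e.C.one_closed])
    then show ?thesis using e.C_minus[OF b, of "c \<odot>\<^bsub>A\<^esub> e"] c by (intro bexI[of _ c]) auto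
  qed
  interpret C: split_local_algebra F e.C
    by unfold_locales (use e.C_fin_dim[OF fd] residue in auto)
  obtain y where y: "dual_numbers F e.C y"
    using C.ex_dual_numbers e.commutator_codim_corner[OF full fd] codim by auto
  \<comment> \<open>Both eAe and B are dual numbers, so B can take the place of eAe in the
    equivalence.\<close>
  obtain g where g: "g \<in> algebra_isos F B e.C"
    using dual_numbers_isomorphic[OF dual y] by blast
  interpret corner_equivalence F A e B g
    by unfold_locales (fact g, fact full)
  show ?thesis by (rule corner_morita_equivalent[OF inf])
qed

theorem theorem1p3:
  fixes F :: "('f, 'r) ring_scheme"
    and A :: "('f, 'a, 's) module_scheme"
  assumes alg: "assoc_algebra F A"
    and fin_dim: "vectorspace.fin_dim F A"
    and universe: "infinite (UNIV :: 'u set)" "carrier F \<lesssim> (UNIV :: 'u set)"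
    and split: "splitting_field TYPE('u) F A"
  shows "morita_equivalent TYPE('u) F A (poly_mod_X2 F) \<longleftrightarrow>
    commutator_codim F A = 2 \<and> num_simple_modules TYPE('u) A = 1"
proof -
  have "field F"
    using alg by (simp add: assoc_algebra_def vectorspace_def)
  then obtain x where x: "dual_numbers F (poly_mod_X2 F) x"
    using poly_mod_X2_dual_numbers by blast
  show ?thesis
    using morita_equivalent_imp_invariants[OF alg fin_dim universe x]
      invariants_imp_morita_equivalent[OF alg fin_dim universe split x] by blast
qed

end
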